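(* Let $0 < \alpha < 1$. Suppose the Deterministic 3SUM Hypothesis holds. Then for every $\epsilon > 0$ there is no deterministic data structure for the Convolution Witness problem with preprocessing time $O(n^{2-\alpha})$ and query time $O(n^{\alpha/2-\epsilon})$ per reported witness.
   Context: $[n]=\{1,\dots,n\}$. 3SUM over $[U]$: given a set $A \subseteq [U]$ of $n$ integers, decide whether there exist $a,b,c\in A$ with $a+b=c$. Deterministic 3SUM Hypothesis: for every $\epsilon > 0$ there is a constant $c$ such that there is no deterministic algorithm for 3SUM over $[n^c]$ running in time $O(n^{2-\epsilon})$. Convolution Witness: preprocess two vectors $X, Y \in \{0,1\}^n$ such that, upon a query index $k$, the list of all witnesses $\{(i,j) \in [n]^2 : i + j = k,\ X[i] = Y[j] = 1\}$ is returned. *)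

theory Defs
  imports Complex_Main "HOL-Library.Log_Nat" "HOL-Library.Landau_Symbols"
begin

unbundle bit_operations_syntax

section \<open>Word RAM\<close>

text \<open>
  A deterministic word RAM with \<open>w\<close>-bit words and unit-cost instructions. Words are natural numbers
  below \<open>2 ^ w\<close>; since \<open>w\<close> depends on the input size, it is a parameter of the semantics and not a
  type. A program is a fixed list of instructions, independent of \<open>w\<close>, and mentions only finitely
  many registers; the memory is addressed by words.
\<close>

datatype binop = Add | Sub | Mul | Div | Mod | And | Or | Xor | Shl | Shr | Less | Eq

datatype instr =
    Const nat nat
  | Op binop nat nat nat
  | Load nat nat
  | Store nat nat
  | JumpIf nat nat
  | Output nat

type_synonym program = "instr list"

record config =
  pc :: nat
  regs :: "nat \<Rightarrow> nat"
  mem :: "nat \<Rightarrow> nat"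
  out :: "nat list"

fun binop_val :: "nat \<Rightarrow> binop \<Rightarrow> nat \<Rightarrow> nat \<Rightarrow> nat" where
  "binop_val w Add a b = take_bit w (a + b)"
| "binop_val w Sub a b = take_bit w (a + (2 ^ w - b))"
| "binop_val w Mul a b = take_bit w (a * b)"
| "binop_val w Div a b = a div b"
| "binop_val w Mod a b = a mod b"
| "binop_val w And a b = a AND b"
| "binop_val w Or a b = a OR b"
| "binop_val w Xor a b = a XOR b"
| "binop_val w Shl a b = take_bit w (push_bit b a)"
| "binop_val w Shr a b = drop_bit b a"
| "binop_val w Less a b = of_bool (a < b)"
| "binop_val w Eq a b = of_bool (a = b)"

fun exec_instr :: "nat \<Rightarrow> instr \<Rightarrow> config \<Rightarrow> config" where
  "exec_instr w (Const r v) s = s\<lparr>pc := Suc (pc s), regs := (regs s)(r := take_bit w v)\<rparr>"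
| "exec_instr w (Op f r a b) s =
     s\<lparr>pc := Suc (pc s), regs := (regs s)(r := binop_val w f (regs s a) (regs s b))\<rparr>"
| "exec_instr w (Load r a) s = s\<lparr>pc := Suc (pc s), regs := (regs s)(r := mem s (regs s a))\<rparr>"
| "exec_instr w (Store a r) s = s\<lparr>pc := Suc (pc s), mem := (mem s)(regs s a := regs s r)\<rparr>"
| "exec_instr w (JumpIf r l) s = s\<lparr>pc := (if regs s r \<noteq> 0 then l else Suc (pc s))\<rparr>"
| "exec_instr w (Output r) s = s\<lparr>pc := Suc (pc s), out := out s @ [regs s r]\<rparr>"

text \<open>A program halts by leaving the range of its instructions; a halted configuration is stationary.\<close>

definition halted :: "program \<Rightarrow> config \<Rightarrow> bool" where
  "halted P s \<longleftrightarrow> length P \<le> pc s"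

definition step :: "nat \<Rightarrow> program \<Rightarrow> config \<Rightarrow> config" where
  "step w P s = (if halted P s then s else exec_instr w (P ! pc s) s)"

text \<open>
  Since halted configurations are stationary, \<open>halts_within w P s t s'\<close> says that \<open>P\<close> halts in \<open>s'\<close>
  after at most \<open>t\<close> instructions.
\<close>

definition halts_within :: "nat \<Rightarrow> program \<Rightarrow> config \<Rightarrow> nat \<Rightarrow> config \<Rightarrow> bool" where
  "halts_within w P s t s' \<longleftrightarrow> (step w P ^^ t) s = s' \<and> halted P s'"

text \<open>A run starts with a single argument in register 0; all other registers are 0.\<close>

definition start :: "nat \<Rightarrow> (nat \<Rightarrow> nat) \<Rightarrow> config" where
  "start a M = \<lparr>pc = 0, regs = (\<lambda>_. 0)(0 := a), mem = M, out = []\<rparr>"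

definition mem_of :: "nat list \<Rightarrow> nat \<Rightarrow> nat" where
  "mem_of xs a = (if a < length xs then xs ! a else 0)"

text \<open>
  Words have \<open>\<Theta>(log n)\<close> bits on inputs of size \<open>n\<close>: \<^term>\<open>floorlog 2 n\<close> is the length of the binary
  representation of \<open>n\<close>, and every algorithm comes with its own constant factor \<open>\<kappa>\<close>.
\<close>

definition word_size :: "nat \<Rightarrow> nat \<Rightarrow> nat" where
  "word_size \<kappa> n = \<kappa> * floorlog 2 n"

lemma power_less_word_size:
  assumes "n \<ge> 1" "\<kappa> \<ge> 1" "c \<le> \<kappa>"
  shows "n ^ c < 2 ^ word_size \<kappa> n"
proof -
  have *: "n < 2 ^ floorlog 2 n"
    using floorlog_bounds[of n 2] assms(1) by simp
  have "n ^ c \<le> n ^ \<kappa>"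
    using assms by (intro power_increasing) auto
  also have "\<dots> < (2 ^ floorlog 2 n) ^ \<kappa>"
    using * assms by (intro power_strict_mono) auto
  finally show ?thesis
    by (simp add: word_size_def power_mult[symmetric] mult.commute)
qed

section \<open>3SUM\<close>

definition has_3sum :: "nat set \<Rightarrow> bool" where
  "has_3sum A \<longleftrightarrow> (\<exists>a\<in>A. \<exists>b\<in>A. \<exists>c\<in>A. a + b = c)"

text \<open>
  The input set is stored in memory cells \<open>0, \<dots>, n - 1\<close> in arbitrary order, and \<open>n\<close> is the argument.
  The lower bounds on \<open>\<kappa>\<close> ensure that the input fits into words.
\<close>

definition solves_3sum :: "nat \<Rightarrow> nat \<Rightarrow> program \<Rightarrow> (nat \<Rightarrow> real) \<Rightarrow> bool" where
  "solves_3sum c \<kappa> P T \<longleftrightarrow> 1 \<le> \<kappa> \<and> c \<le> \<kappa> \<and>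
     (\<forall>n\<ge>1. \<forall>xs. distinct xs \<and> length xs = n \<and> set xs \<subseteq> {1..n ^ c} \<longrightarrow>
        (\<exists>t s. halts_within (word_size \<kappa> n) P (start n (mem_of xs)) t s \<and> real t \<le> T n \<and>
               out s = [of_bool (has_3sum (set xs))]))"

definition deterministic_3sum_hypothesis :: bool where
  "deterministic_3sum_hypothesis \<longleftrightarrow>
     (\<forall>\<epsilon>::real. \<epsilon> > 0 \<longrightarrow> (\<exists>c. \<not> (\<exists>\<kappa> P T. solves_3sum c \<kappa> P T \<and>
        T \<in> O(\<lambda>n. real n powr (2 - \<epsilon>)))))"

section \<open>Convolution Witness\<close>

definition bit_vector :: "nat \<Rightarrow> nat list \<Rightarrow> bool" where
  "bit_vector n X \<longleftrightarrow> length X = n \<and> set X \<subseteq> {0, 1}"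

text \<open>Vectors are indexed from 1 in the problem, hence the shift in the list positions.\<close>

definition witnesses :: "nat \<Rightarrow> nat list \<Rightarrow> nat list \<Rightarrow> nat \<Rightarrow> (nat \<times> nat) set" where
  "witnesses n X Y k =
     {(i, j). i \<in> {1..n} \<and> j \<in> {1..n} \<and> i + j = k \<and> X ! (i - 1) = 1 \<and> Y ! (j - 1) = 1}"

text \<open>
  The preprocessing program \<open>Pre\<close> gets \<open>X\<close> followed by \<open>Y\<close> in memory and \<open>n\<close> as the argument; the
  query program \<open>Qry\<close> gets \<open>k\<close> as the argument and the memory left behind by the preprocessing and
  the queries answered so far. The predicate below describes the possible memory contents between
  queries.
\<close>

inductive ds_memory ::
  "nat \<Rightarrow> program \<Rightarrow> program \<Rightarrow> nat \<Rightarrow> nat list \<Rightarrow> nat list \<Rightarrow> (nat \<Rightarrow> nat) \<Rightarrow> bool"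
  for w Pre Qry n X Y where
  preprocess:
    "halts_within w Pre (start n (mem_of (X @ Y))) t s \<Longrightarrow> ds_memory w Pre Qry n X Y (mem s)"
| query:
    "ds_memory w Pre Qry n X Y M \<Longrightarrow> k \<in> {1..2 * n} \<Longrightarrow> halts_within w Qry (start k M) t s \<Longrightarrow>
     ds_memory w Pre Qry n X Y (mem s)"

text \<open>
  A query outputs the components \<open>i\<^sub>1, j\<^sub>1, i\<^sub>2, j\<^sub>2, \<dots>\<close> of all witnesses, in any order and without
  repetition. Time \<open>q n\<close> per witness means total time \<open>q n * (1 + r)\<close> for \<open>r\<close> witnesses, so that a
  query without witnesses is also granted time \<open>q n\<close>. As \<open>2 * n < 2 ^ word_size \<kappa> n\<close> for \<open>\<kappa> \<ge> 2\<close>,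
  all inputs and query indices fit into words.
\<close>

definition convolution_witness_ds ::
  "nat \<Rightarrow> program \<Rightarrow> program \<Rightarrow> (nat \<Rightarrow> real) \<Rightarrow> (nat \<Rightarrow> real) \<Rightarrow> bool" where
  "convolution_witness_ds \<kappa> Pre Qry p q \<longleftrightarrow> 2 \<le> \<kappa> \<and>
     (\<forall>n\<ge>1. \<forall>X Y. bit_vector n X \<and> bit_vector n Y \<longrightarrow>
        (\<exists>t s. halts_within (word_size \<kappa> n) Pre (start n (mem_of (X @ Y))) t s \<and> real t \<le> p n) \<and>
        (\<forall>M k. ds_memory (word_size \<kappa> n) Pre Qry n X Y M \<and> k \<in> {1..2 * n} \<longrightarrow>
           (\<exists>t s ws. halts_within (word_size \<kappa> n) Qry (start k M) t s \<and>
              distinct ws \<and> set ws = witnesses n X Y k \<and>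
              out s = concat (map (\<lambda>(i, j). [i, j]) ws) \<and>
              real t \<le> q n * (1 + real (card (witnesses n X Y k))))))"

end

theory Submission imports Defs "HOL-Number_Theory.Cong"
begin

text \<open>
  Suppose that there were a data structure with these bounds, and write \<open>\<gamma>\<close> for the exponent of its
  query time. The given numbers are hashed to their residues modulo a product \<open>m\<close> of \<open>k\<close> factors from
  \<open>{1..Y}\<close>, chosen greedily so as to minimize the number of triples with \<open>a + b \<equiv> c\<close> modulo \<open>m\<close>. For
  a triple with \<open>a + b \<noteq> c\<close> only \<open>n\<^bsup>o(1)\<^esup>\<close> of the candidates \<open>d\<close> for the next factor preserve a
  congruence modulo \<open>m\<close>, by the divisor bound, so each stage reduces the number of false solutions by a
  factor \<open>Y / n\<^bsup>o(1)\<^esup>\<close>. With \<open>Y\<^sup>k = n\<^bsup>\<beta>\<^esup>\<close> there remain \<open>n\<^bsup>3 - \<beta> + o(1)\<^esup>\<close> of them.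

  The solutions modulo \<open>m\<close> are counted deterministically as a convolution, by a Fourier transform on
  \<open>(\<int>/r)\<^sup>K\<close> for a constant \<open>r\<close> with coefficients modulo \<open>X\<^bsup>r/2\<^esup> + 1\<close>, where \<open>X\<close> is a root of unity of
  order \<open>r\<close>. The dimension \<open>K\<close> is logarithmic, and embedding the residues costs only a factor
  \<open>2\<^sup>K\<close>, an arbitrarily small power of \<open>n\<close> for large \<open>r\<close>.

  Finally one data structure for the set of residues enumerates, for every \<open>c\<close>, all pairs of residues
  with sum \<open>c\<close> modulo \<open>m\<close>, until a true solution is found. The total time is about
  \<open>n\<^bsup>\<beta>(2 - \<alpha>)\<^esup> + n\<^bsup>\<beta>\<gamma>\<^esup> (n + n\<^bsup>3 - \<beta>\<^esup>)\<close>, which is subquadratic for \<open>1 / (1 - \<gamma>) < \<beta> < 2 / (2 - \<alpha>)\<close>. This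
  range is nonempty exactly because \<open>\<gamma> < \<alpha> / 2\<close>.
\<close>

section \<open>A structured language on top of the word RAM\<close>

text \<open>The assumed data structure runs with words of its own length, logarithmic in a size of
  about n^\<beta>. It may use every address of that length and alter its memory during queries. It
  is therefore simulated inside one array of a machine with longer words, with results masked to the
  shorter length.

  Trying every modulus up to n^\<beta> with one convolution each would take more than n^(2\<beta>)
  steps, which is superquadratic since \<beta> > 1. Composing the modulus of k factors leaves only k
  * Y convolutions. No primality of the factors enters: if m * e divides a difference, then e
  divides its quotient by m, so a divisor bound limits the bad e.

  Only the number of all congruent triples can be computed. It differs from the number of false ones
  by a constant independent of the modulus, so both have the same minimizers.

  There may be about n^2 true solutions, too many to enumerate. Stopping at the first c that has one
  leaves at most n of them.

  The number \<open>Q = X ^ b + 1\<close>, with X a power of two above n, fits into a word because b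
  is constant, but it need not be prime. Orthogonality of characters modulo Q thus rests on a
  factorization of geometric sums.\<close>

datatype exp = N nat | V nat | Bin binop exp exp | Arr nat exp

datatype com =
    Skip
  | Assign nat exp
  | Write nat exp exp
  | Seq com com  (infixr ";;" 60)
  | If exp com com
  | While exp com
  | Out exp
  | Call program nat

record hstate =
  vars :: "nat \<Rightarrow> nat"
  arr :: "nat \<Rightarrow> nat \<Rightarrow> nat"
  outs :: "nat list"
  clk :: nat

text \<open>
  Variable \<open>v\<close> lives in register \<open>3 * v\<close>, temporaries in registers \<open>3 * d + 1\<close>, and register \<open>r\<close> of a
  simulated program in \<open>3 * r + 2\<close>. Cell \<open>i\<close> of array \<open>j\<close> is the memory cell \<open>j * Z + i\<close>, where \<open>Z\<close> is
  kept in variable 0. Array 1 is the memory of the simulated program and array 2 its output.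
  Variable 10 holds the word mask of the simulated program, variable 11 the length of its output.
\<close>

abbreviation tmp :: "nat \<Rightarrow> nat" where "tmp d \<equiv> 3 * d + 1"
abbreviation sreg :: "nat \<Rightarrow> nat" where "sreg r \<equiv> 3 * r + 2"

fun comp :: "nat \<Rightarrow> exp \<Rightarrow> instr list" where
  "comp d (N c) = [Const (tmp d) c]"
| "comp d (V v) = [Op And (tmp d) (3 * v) (3 * v)]"
| "comp d (Bin f a b) = comp d a @ comp (Suc d) b @ [Op f (tmp d) (tmp d) (tmp (Suc d))]"
| "comp d (Arr j e) = comp d e @ [Const (tmp (Suc d)) j, Op Mul (tmp (Suc d)) (tmp (Suc d)) 0,
     Op Add (tmp d) (tmp d) (tmp (Suc d)), Load (tmp d) (tmp d)]"

fun cost :: "exp \<Rightarrow> nat" where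
  "cost (N c) = 1"
| "cost (V v) = 1"
| "cost (Bin f a b) = cost a + cost b + 1"
| "cost (Arr j e) = cost e + 4"

lemma length_comp [simp]: "length (comp d e) = cost e"
  by (induction e arbitrary: d) auto

text \<open>Jump targets are absolute, so code placed behind a prefix has to be relocated by the
  length of that prefix.\<close>

fun shift_instr :: "nat \<Rightarrow> instr \<Rightarrow> instr" where
  "shift_instr k (JumpIf r l) = JumpIf r (l + k)"
| "shift_instr k i = i"

abbreviation shift :: "nat \<Rightarrow> program \<Rightarrow> program" where
  "shift k P \<equiv> map (shift_instr k) P"

text \<open>Every instruction becomes exactly five, padded by writes to a scratch register, so
  target \<open>l\<close> turns into \<open>5 * l\<close>. The minimum with the program length
  \<open>p\<close> lets any jump out of range end exactly behind the code. Only \<open>Const\<close>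
  and \<open>Op\<close> can produce values that are too long, hence the mask of variable 10.
  Addresses are moved into array 1, and outputs are appended to array 2.\<close>

fun sim_instr :: "nat \<Rightarrow> instr \<Rightarrow> instr list" where
  "sim_instr p (Const r v) = [Const (sreg r) v, Op And (sreg r) (sreg r) (3 * 10),
     Const (tmp 1) 0, Const (tmp 1) 0, Const (tmp 1) 0]"
| "sim_instr p (Op f r a b) = [Op f (sreg r) (sreg a) (sreg b), Op And (sreg r) (sreg r) (3 * 10),
     Const (tmp 1) 0, Const (tmp 1) 0, Const (tmp 1) 0]"
| "sim_instr p (Load r a) = [Op Add (tmp 0) (sreg a) 0, Load (sreg r) (tmp 0),
     Const (tmp 1) 0, Const (tmp 1) 0, Const (tmp 1) 0]"
| "sim_instr p (Store a r) = [Op Add (tmp 0) (sreg a) 0, Store (tmp 0) (sreg r),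
     Const (tmp 1) 0, Const (tmp 1) 0, Const (tmp 1) 0]"
| "sim_instr p (JumpIf r l) = [JumpIf (sreg r) (5 * min l p),
     Const (tmp 1) 0, Const (tmp 1) 0, Const (tmp 1) 0, Const (tmp 1) 0]"
| "sim_instr p (Output r) = [Op Add (tmp 0) 0 0, Op Add (tmp 0) (tmp 0) (3 * 11),
     Store (tmp 0) (sreg r), Const (tmp 0) 1, Op Add (3 * 11) (3 * 11) (tmp 0)]"

definition sim :: "program \<Rightarrow> program" where
  "sim P = concat (map (sim_instr (length P)) P)"

fun instr_regs :: "instr \<Rightarrow> nat" where
  "instr_regs (Const r v) = r"
| "instr_regs (Op f r a b) = r + a + b"
| "instr_regs (Load r a) = r + a"
| "instr_regs (Store a r) = a + r"
| "instr_regs (JumpIf r l) = r"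
| "instr_regs (Output r) = r"

text \<open>A crude bound above every register index that occurs; the sum is at least as large as
  each summand.\<close>

definition num_regs :: "program \<Rightarrow> nat" where
  "num_regs P = Suc (sum_list (map instr_regs P))"

text \<open>A run starts with all registers 0, but an earlier call leaves values behind, so the
  simulated registers are cleared before the argument is passed.\<close>

definition call_init :: "program \<Rightarrow> nat \<Rightarrow> program" where
  "call_init P v = map (\<lambda>r. Const (sreg r) 0) [0..<num_regs P] @
     [Op And (sreg 0) (3 * v) (3 * v), Const (3 * 11) 0]"

fun compile :: "com \<Rightarrow> program" where
  "compile Skip = []"
| "compile (Assign v e) = comp 0 e @ [Op And (3 * v) (tmp 0) (tmp 0)]"
| "compile (Write j a e) = comp 0 a @ comp 1 e @
     [Const (tmp 2) j, Op Mul (tmp 2) (tmp 2) 0, Op Add (tmp 0) (tmp 0) (tmp 2), Store (tmp 0) (tmp 1)]"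
| "compile (c1 ;; c2) = compile c1 @ shift (length (compile c1)) (compile c2)"
| "compile (If e c1 c2) =
     (let C1 = compile c1; C2 = compile c2; p = cost e + 1; q = p + length C2 + 2 in
      comp 0 e @ [JumpIf (tmp 0) q] @ shift p C2 @
        [Const (tmp 0) 1, JumpIf (tmp 0) (q + length C1)] @ shift q C1)"
| "compile (While e c) =
     (let C = compile c; p = cost e + 3 in
      comp 0 (Bin Eq e (N 0)) @ [JumpIf (tmp 0) (p + length C + 2)] @ shift p C @
        [Const (tmp 0) 1, JumpIf (tmp 0) 0])"
| "compile (Out e) = comp 0 e @ [Output (tmp 0)]"
| "compile (Call P v) = call_init P v @ shift (length (call_init P v)) (sim P)"

fun opv :: "binop \<Rightarrow> nat \<Rightarrow> nat \<Rightarrow> nat" where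
  "opv Add a b = a + b"
| "opv Sub a b = a - b"
| "opv Mul a b = a * b"
| "opv Div a b = a div b"
| "opv Mod a b = a mod b"
| "opv Less a b = of_bool (a < b)"
| "opv Eq a b = of_bool (a = b)"
| "opv _ a b = 0"

fun eval :: "exp \<Rightarrow> hstate \<Rightarrow> nat" where
  "eval (N c) h = c"
| "eval (V v) h = vars h v"
| "eval (Bin f a b) h = opv f (eval a h) (eval b h)"
| "eval (Arr j e) h = arr h j (eval e h)"

text \<open>The condition under which the machine operation agrees with exact arithmetic on natural
  numbers, without wrap-around or truncated subtraction. Bit operations are excluded from the
  structured language.\<close>

fun opok :: "nat \<Rightarrow> binop \<Rightarrow> nat \<Rightarrow> nat \<Rightarrow> bool" where
  "opok w Add a b \<longleftrightarrow> a + b < 2 ^ w"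
| "opok w Sub a b \<longleftrightarrow> b \<le> a \<and> a < 2 ^ w"
| "opok w Mul a b \<longleftrightarrow> a * b < 2 ^ w"
| "opok w Div a b \<longleftrightarrow> True"
| "opok w Mod a b \<longleftrightarrow> True"
| "opok w Less a b \<longleftrightarrow> True"
| "opok w Eq a b \<longleftrightarrow> True"
| "opok w _ a b \<longleftrightarrow> False"

lemma opok_binop_val: "opok w f a b \<Longrightarrow> binop_val w f a b = opv f a b"
proof (cases f)
  case Sub
  assume "opok w f a b"
  then have b: "b \<le> a" "a < 2 ^ w" using Sub by auto
  then have "a + (2 ^ w - b) = (a - b) + 2 ^ w" by auto
  then have "(a + (2 ^ w - b)) mod 2 ^ w = (a - b) mod 2 ^ w" by (simp only: mod_add_self2)
  then show ?thesis using Sub b by (simp add: take_bit_eq_mod del: add_diff_assoc)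
qed (auto simp: take_bit_eq_mod)

section \<open>Executions of the machine and relocation of code\<close>

lemma step_halted: "halted P s \<Longrightarrow> (step w P ^^ t) s = s"
  by (induction t) (auto simp: step_def)

definition reach :: "nat \<Rightarrow> program \<Rightarrow> nat \<Rightarrow> config \<Rightarrow> config \<Rightarrow> bool" where
  "reach w P t s s' \<longleftrightarrow> (\<exists>t'\<le>t. (step w P ^^ t') s = s')"

lemma reach_trans: "reach w P t s s' \<Longrightarrow> reach w P t' s' s'' \<Longrightarrow> reach w P (t + t') s s''"
  unfolding reach_def
proof (elim exE conjE)
  fix a b assume "a \<le> t" "(step w P ^^ a) s = s'" "b \<le> t'" "(step w P ^^ b) s' = s''"
  then show "\<exists>x\<le>t + t'. (step w P ^^ x) s = s''"
    by (intro exI[of _ "b + a"]) (auto simp: funpow_add)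
qed

lemma reach_mono: "reach w P t s s' \<Longrightarrow> t \<le> t' \<Longrightarrow> reach w P t' s s'"
  unfolding reach_def using order_trans by blast

lemma reach_refl: "reach w P t s s"
  unfolding reach_def by (intro exI[of _ 0]) auto

lemma reach_step: "step w P s = s' \<Longrightarrow> reach w P 1 s s'"
  unfolding reach_def by (intro exI[of _ 1]) auto

fun nojump :: "instr \<Rightarrow> bool" where
  "nojump (JumpIf r l) = False"
| "nojump i = True"

lemma exec_nojump: "nojump i \<Longrightarrow> exec_instr w i (s\<lparr>pc := p\<rparr>) = (exec_instr w i s)\<lparr>pc := Suc p\<rparr>"
  by (cases i) auto

abbreviation runl :: "nat \<Rightarrow> program \<Rightarrow> config \<Rightarrow> config" where
  "runl w \<equiv> fold (exec_instr w)"

lemma straight_steps: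
  assumes "list_all nojump c"
  shows "(step w (L @ c @ R) ^^ length c) (s\<lparr>pc := length L\<rparr>) =
    (runl w c s)\<lparr>pc := length L + length c\<rparr>"
  using assms
proof (induction c arbitrary: L s)
  case (Cons i c)
  have st: "step w (L @ (i # c) @ R) (s\<lparr>pc := length L\<rparr>) =
      (exec_instr w i s)\<lparr>pc := length (L @ [i])\<rparr>"
    using Cons.prems by (simp add: step_def halted_def nth_append exec_nojump)
  have "(step w (L @ (i # c) @ R) ^^ length (i # c)) (s\<lparr>pc := length L\<rparr>) =
      (step w (L @ (i # c) @ R) ^^ length c) ((exec_instr w i s)\<lparr>pc := length (L @ [i])\<rparr>)"
    unfolding st[symmetric] by (simp add: funpow_swap1)
  also have "\<dots> = (runl w c (exec_instr w i s))\<lparr>pc := length (L @ [i]) + length c\<rparr>"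
    using Cons.IH[of "L @ [i]" "exec_instr w i s"] Cons.prems by simp
  finally show ?case by simp
qed auto

lemma reach_straight:
  assumes "list_all nojump c"
  shows "reach w (L @ c @ R) (length c) (s\<lparr>pc := length L\<rparr>)
    ((runl w c s)\<lparr>pc := length L + length c\<rparr>)"
  unfolding reach_def using straight_steps[OF assms] by blast

lemma exec_shift:
  "exec_instr w (shift_instr k i) (s\<lparr>pc := pc s + k\<rparr>) =
    (exec_instr w i s)\<lparr>pc := pc (exec_instr w i s) + k\<rparr>"
  by (cases i) auto

text \<open>The copy follows the original as long as the original stays inside its code. A jump
  beyond \<open>length P\<close> would halt the original there for good, contradicting the
  assumption that it ends with counter exactly \<open>length P\<close>.\<close>

lemma steps_shift:
  assumes "(step w P ^^ t) s = s'" "pc s' = length P" "pc s \<le> length P"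
  shows "reach w (L @ shift (length L) P @ R) t (s\<lparr>pc := pc s + length L\<rparr>)
    (s'\<lparr>pc := length L + length P\<rparr>)"
  using assms
proof (induction t arbitrary: s)
  case 0
  then show ?case by (auto simp: reach_def add.commute)
next
  case (Suc t)
  show ?case
  proof (cases "pc s < length P")
    case False
    then have "s' = s" using Suc.prems step_halted[of P s "Suc t" w] by (simp add: halted_def)
    then show ?thesis using Suc.prems reach_refl[of w _ "Suc t" "s\<lparr>pc := pc s + length L\<rparr>"]
      by (simp add: add.commute)
  next
    case True
    let ?s1 = "step w P s"
    have s1: "(step w P ^^ t) ?s1 = s'" using Suc.prems(1) by (simp add: funpow_swap1)
    have le: "pc ?s1 \<le> length P"
    proof (rule ccontr)
      assume "\<not> pc ?s1 \<le> length P"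
      then have "s' = ?s1" using s1 step_halted[of P ?s1 t w] by (simp add: halted_def)
      then show False using Suc.prems(2) \<open>\<not> pc ?s1 \<le> length P\<close> by simp
    qed
    have "step w (L @ shift (length L) P @ R) (s\<lparr>pc := pc s + length L\<rparr>) =
        ?s1\<lparr>pc := pc ?s1 + length L\<rparr>"
      using True by (simp add: step_def halted_def nth_append exec_shift)
    from reach_trans[OF reach_step[OF this] Suc.IH[OF s1 Suc.prems(2) le]]
    show ?thesis by simp
  qed
qed

lemma reach_shift:
  assumes "reach w P t (s\<lparr>pc := 0\<rparr>) (s'\<lparr>pc := length P\<rparr>)"
  shows "reach w (L @ shift (length L) P @ R) t (s\<lparr>pc := length L\<rparr>)
    (s'\<lparr>pc := length L + length P\<rparr>)"
proof -
  obtain t' where t': "t' \<le> t" "(step w P ^^ t') (s\<lparr>pc := 0\<rparr>) = s'\<lparr>pc := length P\<rparr>"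
    using assms by (auto simp: reach_def)
  from steps_shift[OF t'(2), of L R] show ?thesis using t'(1) by (auto intro: reach_mono)
qed

lemma nojump_comp [simp]: "list_all nojump (comp d e)"
  by (induction e arbitrary: d) auto

text \<open>\<open>w\<close> is the word length of the real machine and \<open>wd\<close> that of
  the simulated one. The factor 40 makes the addresses of 40 arrays of length \<open>Z\<close>
  representable, and \<open>2 ^ wd \<le> Z\<close> puts the whole address space of the simulated
  program into one array.\<close>

locale ram =
  fixes w Z wd :: nat
  assumes Z: "0 < Z" "40 * Z \<le> 2 ^ w" and wd: "1 \<le> wd" "2 ^ wd \<le> Z"
begin

lemma wd_le_w: "wd \<le> w"
proof -
  have "(2::nat) ^ wd \<le> 2 ^ w" using Z wd by linarith
  then show ?thesis by simp
qed

definition rel :: "hstate \<Rightarrow> config \<Rightarrow> bool" where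
  "rel h s \<longleftrightarrow> (\<forall>v. regs s (3 * v) = vars h v) \<and>
     (\<forall>j. \<forall>i<Z. mem s (j * Z + i) = arr h j i) \<and> out s = outs h"

fun ok :: "exp \<Rightarrow> hstate \<Rightarrow> bool" where
  "ok (N c) h \<longleftrightarrow> c < 2 ^ w"
| "ok (V v) h \<longleftrightarrow> True"
| "ok (Bin f a b) h \<longleftrightarrow> ok a h \<and> ok b h \<and> opok w f (eval a h) (eval b h)"
| "ok (Arr j e) h \<longleftrightarrow> ok e h \<and> eval e h < Z \<and> j < 40 \<and> vars h 0 = Z"

lemma addr_less: assumes "j < 40" "i < Z" shows "j * Z + i < 2 ^ w" "j < 2 ^ w" "j * Z < 2 ^ w"
proof -
  have "j * Z + Z \<le> 40 * Z" using assms(1) mult_le_mono1[of "Suc j" 40 Z] by simp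
  then show "j * Z + i < 2 ^ w" using Z assms by linarith
  then show "j * Z < 2 ^ w" by linarith
  have "j < 40 * Z" using assms Z by (cases Z) auto
  then show "j < 2 ^ w" using Z by linarith
qed

text \<open>The induction needs that registers below \<open>tmp d\<close> survive: the left operand
  waits in \<open>tmp d\<close> while the right one is evaluated from \<open>tmp (Suc d)\<close>
  on.\<close>

lemma comp_correct:
  assumes "ok e h" "\<forall>v. regs s (3 * v) = vars h v" "\<forall>j. \<forall>i<Z. mem s (j * Z + i) = arr h j i"
  shows "regs (runl w (comp d e) s) (tmp d) = eval e h \<and>
    (\<forall>r. r mod 3 \<noteq> 1 \<or> r < tmp d \<longrightarrow> regs (runl w (comp d e) s) r = regs s r) \<and>
    mem (runl w (comp d e) s) = mem s \<and> out (runl w (comp d e) s) = out s"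
  using assms
proof (induction e arbitrary: d s)
  case (N c)
  then show ?case by (auto simp: take_bit_eq_mod)
next
  case (V v)
  then show ?case by auto
next
  case (Bin f a b)
  define s1 where "s1 = runl w (comp d a) s"
  define s2 where "s2 = runl w (comp (Suc d) b) s1"
  have m3: "3 * v mod 3 \<noteq> 1" for v :: nat by simp
  have 1: "regs s1 (tmp d) = eval a h" "\<forall>r. r mod 3 \<noteq> 1 \<or> r < tmp d \<longrightarrow> regs s1 r = regs s r"
    "mem s1 = mem s" "out s1 = out s"
    using Bin.IH(1)[of s d] Bin.prems by (auto simp: s1_def)
  have 2: "regs s2 (tmp (Suc d)) = eval b h"
    "\<forall>r. r mod 3 \<noteq> 1 \<or> r < tmp (Suc d) \<longrightarrow> regs s2 r = regs s1 r"
    "mem s2 = mem s1" "out s2 = out s1"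
    using Bin.IH(2)[of s1 "Suc d"] Bin.prems 1 m3 by (auto simp: s2_def)
  have r: "runl w (comp d (Bin f a b)) s =
      exec_instr w (Op f (tmp d) (tmp d) (tmp (Suc d))) s2"
    by (simp add: s1_def s2_def)
  have e1: "regs s2 (tmp d) = eval a h" using 2(2) 1(1) by simp
  have v: "binop_val w f (eval a h) (eval b h) = opv f (eval a h) (eval b h)"
    using Bin.prems by (simp add: opok_binop_val)
  have "regs s2 r = regs s r" if "r mod 3 \<noteq> 1 \<or> r < tmp d" for r
    using that 1(2) 2(2) by auto
  then show ?case unfolding r using e1 2 1 v by (auto simp del: binop_val.simps)
next
  case (Arr j e)
  define s1 where "s1 = runl w (comp d e) s"
  have m3: "3 * v mod 3 \<noteq> 1" for v :: nat by simp
  have 1: "regs s1 (tmp d) = eval e h" "\<forall>r. r mod 3 \<noteq> 1 \<or> r < tmp d \<longrightarrow> regs s1 r = regs s r"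
    "mem s1 = mem s" "out s1 = out s"
    using Arr.IH[of s d] Arr.prems by (auto simp: s1_def)
  have z: "regs s1 0 = Z" using 1(2) Arr.prems by (metis mod_0 mult_zero_right ok.simps(4) zero_neq_one)
  have o: "eval e h < Z" "j < 40" using Arr.prems by auto
  note al = addr_less[OF o(2,1)]
  have jz: "take_bit w (take_bit w j * Z) = j * Z" using al by (simp add: take_bit_eq_mod)
  have a: "take_bit w (eval e h + j * Z) = j * Z + eval e h"
    using al by (simp add: take_bit_eq_mod add.commute)
  have m: "mem s (j * Z + eval e h) = arr h j (eval e h)" using Arr.prems o by blast
  show ?case
    using 1 by (auto simp: s1_def[symmetric] z jz a m)
qed

lemma comp_rel:
  assumes "ok e h" "rel h s"
  shows "regs (runl w (comp d e) s) (tmp d) = eval e h" "rel h (runl w (comp d e) s)"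
    "\<And>r. r < tmp d \<Longrightarrow> regs (runl w (comp d e) s) r = regs s r"
proof -
  have m3: "3 * v mod 3 \<noteq> 1" for v :: nat by simp
  note c = comp_correct[of e h s d]
  show "regs (runl w (comp d e) s) (tmp d) = eval e h" using c assms by (simp add: rel_def)
  show "rel h (runl w (comp d e) s)" using c assms m3 by (simp add: rel_def)
  show "\<And>r. r < tmp d \<Longrightarrow> regs (runl w (comp d e) s) r = regs s r"
    using c assms by (simp add: rel_def)
qed

lemma rel_pc [simp]: "rel h (s\<lparr>pc := p\<rparr>) = rel h s" by (simp add: rel_def)
lemma rel_clk [simp]: "rel (h\<lparr>clk := k\<rparr>) s = rel h s" by (simp add: rel_def)

lemma addr_inj: "i < Z \<Longrightarrow> i' < Z \<Longrightarrow> j * Z + i = j' * Z + i' \<longleftrightarrow> j = j' \<and> i = i'"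
  by (metis Z(1) add.commute add_right_cancel div_less div_mult_self1 add_0_right
      less_numeral_extra(3) add_left_cancel)

abbreviation tick :: "nat \<Rightarrow> hstate \<Rightarrow> hstate" where "tick k h \<equiv> h\<lparr>clk := clk h + k\<rparr>"

text \<open>The clock counts compiled instructions. A taken \<open>If\<close> costs one jump beyond
  the test; the other branch adds the two instructions that jump over the first.
  \<open>While\<close> tests \<open>e = 0\<close>, which takes two more instructions than
  \<open>e\<close>, then a jump, and two further instructions to return to the test. An execution
  exists only if no operation overflows and no index leaves its array.\<close>

inductive exec :: "com \<Rightarrow> hstate \<Rightarrow> hstate \<Rightarrow> bool" where
  Skip: "exec Skip h h"
| Assign: "ok e h \<Longrightarrow> exec (Assign v e) h
    (h\<lparr>vars := (vars h)(v := eval e h), clk := clk h + (cost e + 1)\<rparr>)"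
| Write: "ok a h \<Longrightarrow> ok e h \<Longrightarrow> eval a h < Z \<Longrightarrow> j < 40 \<Longrightarrow> vars h 0 = Z \<Longrightarrow>
    exec (Write j a e) h (h\<lparr>arr := (arr h)(j := (arr h j)(eval a h := eval e h)),
      clk := clk h + (cost a + cost e + 4)\<rparr>)"
| Seq: "exec c1 h h1 \<Longrightarrow> exec c2 h1 h2 \<Longrightarrow> exec (c1 ;; c2) h h2"
| IfTrue: "ok e h \<Longrightarrow> eval e h \<noteq> 0 \<Longrightarrow> exec c1 (tick (cost e + 1) h) h' \<Longrightarrow> exec (If e c1 c2) h h'"
| IfFalse: "ok e h \<Longrightarrow> eval e h = 0 \<Longrightarrow> exec c2 (tick (cost e + 3) h) h' \<Longrightarrow> exec (If e c1 c2) h h'"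
| WhileFalse: "ok e h \<Longrightarrow> eval e h = 0 \<Longrightarrow> exec (While e c) h (tick (cost e + 3) h)"
| WhileTrue: "ok e h \<Longrightarrow> eval e h \<noteq> 0 \<Longrightarrow> exec c (tick (cost e + 5) h) h1 \<Longrightarrow>
    exec (While e c) h1 h2 \<Longrightarrow> exec (While e c) h h2"
| Out: "ok e h \<Longrightarrow> exec (Out e) h (h\<lparr>outs := outs h @ [eval e h], clk := clk h + (cost e + 1)\<rparr>)"
| Call: "halts_within wd P (start (vars h v) (arr h 1)) t s \<Longrightarrow>
    vars h 0 = Z \<Longrightarrow> vars h 10 = 2 ^ wd - 1 \<Longrightarrow> vars h v < 2 ^ wd \<Longrightarrow> \<forall>i. arr h 1 i < 2 ^ wd \<Longrightarrow>
    length (out s) < Z \<Longrightarrow>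
    exec (Call P v) h (h\<lparr>vars := (vars h)(11 := length (out s)),
      arr := (arr h)(1 := mem s, 2 := (\<lambda>i. if i < length (out s) then out s ! i else arr h 2 i)),
      clk := clk h + (num_regs P + 2 + 5 * t)\<rparr>)"

end

section \<open>Simulation of a machine with shorter words\<close>

lemma nth_concat_const:
  assumes "\<And>x. x \<in> set xs \<Longrightarrow> length (f x) = k" "p < length xs"
  shows "\<exists>L R. concat (map f xs) = L @ f (xs ! p) @ R \<and> length L = k * p"
  using assms
proof (induction xs arbitrary: p)
  case (Cons x xs)
  show ?case
  proof (cases p)
    case 0
    then show ?thesis by (intro exI[of _ "[]"] exI[of _ "concat (map f xs)"]) auto
  next
    case (Suc q)
    then obtain L R where "concat (map f xs) = L @ f (xs ! q) @ R" "length L = k * q"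
      using Cons.IH[of q] Cons.prems by auto
    then show ?thesis using Suc Cons.prems(1)[of x]
      by (intro exI[of _ "f x @ L"] exI[of _ R]) auto
  qed
qed auto

lemma length_sim_instr [simp]: "length (sim_instr p i) = 5"
  by (cases i) auto

lemma length_sim [simp]: "length (sim P) = 5 * length P"
  unfolding sim_def by (simp add: length_concat o_def sum_list_triv)

lemma sim_at:
  assumes "p < length P"
  shows "\<exists>L R. sim P = L @ sim_instr (length P) (P ! p) @ R \<and> length L = 5 * p"
  unfolding sim_def by (rule nth_concat_const) (use assms in auto)

lemma instr_regs_less: "i \<in> set P \<Longrightarrow> instr_regs i < num_regs P"
  unfolding num_regs_def using member_le_sum_list[of "instr_regs i" "map instr_regs P"] by fastforce

lemma out_step_mono: "\<exists>ys. out (step w P s) = out s @ ys"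
proof (cases "halted P s")
  case False
  then show ?thesis by (cases "P ! pc s") (auto simp: step_def)
qed (auto simp: step_def)

lemma out_steps_mono: "\<exists>ys. out ((step w P ^^ t) s) = out s @ ys"
proof (induction t)
  case (Suc t)
  then show ?case using out_step_mono[of w P "(step w P ^^ t) s"] by auto
qed auto

lemma less_exp_take_bit: "(x::nat) < 2 ^ k \<longleftrightarrow> take_bit k x = x"
  by (simp add: take_bit_nat_eq_self_iff)

lemma and_mask_nat: "(x::nat) AND (2 ^ k - 1) = take_bit k x"
  by (simp add: take_bit_eq_mask mask_eq_exp_minus_1)

lemma bitop_less:
  assumes "(a::nat) < 2 ^ k" "b < 2 ^ k"
  shows "a AND b < 2 ^ k" "a OR b < 2 ^ k" "a XOR b < 2 ^ k"
  using assms unfolding less_exp_take_bit by (simp_all add: take_bit_or take_bit_xor)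

lemma binop_val_less:
  assumes "1 \<le> k" "a < 2 ^ k" "b < 2 ^ k"
  shows "binop_val k f a b < 2 ^ k"
proof (cases f)
  case Div
  then show ?thesis using assms by (simp add: order_le_less_trans[OF div_le_dividend])
next
  case Mod
  then show ?thesis using assms by (simp add: order_le_less_trans[OF mod_less_eq_dividend])
next
  case Shr
  then show ?thesis using assms
    by (simp add: drop_bit_eq_div order_le_less_trans[OF div_le_dividend])
next
  case Less
  have "(1::nat) < 2 ^ k" using assms(1) by (intro one_less_power) auto
  then show ?thesis using Less by (auto simp: of_bool_def)
next
  case Eq
  have "(1::nat) < 2 ^ k" using assms(1) by (intro one_less_power) auto
  then show ?thesis using Eq by (auto simp: of_bool_def)
qed (use assms bitop_less in \<open>auto simp: take_bit_nat_less_exp\<close>)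

text \<open>Addition, subtraction, multiplication and left shift commute with reduction modulo
  \<open>2 ^ k\<close>. The other operations do not depend on the word length and map
  \<open>k\<close>-bit arguments to \<open>k\<close>-bit results, so the mask leaves them
  unchanged.\<close>

lemma binop_val_mask:
  assumes "1 \<le> k" "k \<le> w" "a < 2 ^ k" "b < 2 ^ k"
  shows "take_bit k (binop_val w f a b) = binop_val k f a b"
proof -
  have m: "min k w = k" using assms by simp
  have same: "binop_val w f a b = binop_val k f a b \<Longrightarrow> ?thesis"
    using binop_val_less[of k a b f] assms by (simp add: less_exp_take_bit)
  show ?thesis
  proof (cases f)
    case Sub
    \<comment> \<open>The two machines complement \<open>b\<close> with \<open>2 ^ w\<close> and
      with \<open>2 ^ k\<close>; these differ by a multiple of \<open>2 ^ k\<close>.\<close>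
    have "(2::nat) ^ w = 2 ^ k * 2 ^ (w - k)" using assms by (simp add: power_add[symmetric])
    moreover have "(2::nat) ^ (w - k) = Suc (2 ^ (w - k) - 1)" by simp
    ultimately have "(2::nat) ^ w = 2 ^ k * (2 ^ (w - k) - 1) + 2 ^ k"
      by (metis mult_Suc_right add.commute)
    then have "a + (2 ^ w - b) = (a + (2 ^ k - b)) + 2 ^ k * (2 ^ (w - k) - 1)"
      using assms(4) by linarith
    then have "(a + (2 ^ w - b)) mod 2 ^ k = (a + (2 ^ k - b)) mod 2 ^ k" by (simp only: mod_mult_self2)
    then show ?thesis using Sub m by (simp add: take_bit_take_bit take_bit_eq_mod[of k] del: add_diff_assoc)
  next
    case Add
    then show ?thesis using m by (simp add: take_bit_take_bit)
  next
    case Mul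
    then show ?thesis using m by (simp add: take_bit_take_bit)
  next
    case Shl
    then show ?thesis using m by (simp add: take_bit_take_bit)
  qed (rule same, simp)+
qed

context ram begin

definition bnd :: "config \<Rightarrow> bool" where
  "bnd s \<longleftrightarrow> (\<forall>r. regs s r < 2 ^ wd) \<and> (\<forall>i. mem s i < 2 ^ wd)"

lemma bnd_step: "bnd s \<Longrightarrow> bnd (step wd P s)"
  using wd(1) by (cases "halted P s"; cases "P ! pc s")
    (auto simp: step_def bnd_def take_bit_nat_less_exp intro!: binop_val_less simp del: binop_val.simps)

lemma bnd_steps: "bnd s \<Longrightarrow> bnd ((step wd P ^^ t) s)"
  by (induction t) (auto simp: bnd_step)

text \<open>\<open>h\<close> stays fixed at the state before the call. Variable 11, array 1 and an
  initial segment of array 2 are overlaid with the current state \<open>s\<close> of the simulated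
  run.\<close>

definition simR :: "program \<Rightarrow> hstate \<Rightarrow> config \<Rightarrow> config \<Rightarrow> bool" where
  "simR P h s \<sigma> \<longleftrightarrow> (\<forall>r<num_regs P. regs \<sigma> (sreg r) = regs s r) \<and>
     (\<forall>v. regs \<sigma> (3 * v) = (if v = 11 then length (out s) else vars h v)) \<and>
     (\<forall>j. \<forall>i<Z. mem \<sigma> (j * Z + i) =
        (if j = 1 then mem s i else if j = 2 \<and> i < length (out s) then out s ! i else arr h j i)) \<and>
     out \<sigma> = outs h"

text \<open>Disjointness of the three residue classes of registers, in the numeral and successor
  forms to which simplification rewrites them.\<close>

lemma mod3: "3 * a \<noteq> 3 * b + 2" "3 * b + 2 \<noteq> 3 * a" "3 * a \<noteq> Suc (3 * b)" "Suc (3 * b) \<noteq> 3 * (a::nat)"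
  "Suc (3 * a) \<noteq> Suc (Suc (3 * b))" "Suc (Suc (3 * b)) \<noteq> Suc (3 * a)"
  "Suc (Suc (3 * b)) \<noteq> 3 * a" "3 * a \<noteq> Suc (Suc (3 * b))" "Suc 0 \<noteq> 3 * a" "3 * a \<noteq> Suc 0"
  "Suc (Suc 0) \<noteq> 3 * a" "3 * a \<noteq> Suc (Suc 0)" "33 \<noteq> Suc (Suc (3 * b))" "Suc (Suc (3 * b)) \<noteq> 33"
  "4 \<noteq> Suc (Suc (3 * b))" "Suc (Suc (3 * b)) \<noteq> 4" "4 \<noteq> 3 * a" "3 * a \<noteq> 4"
  "3 * a \<noteq> 28" "3 * a \<noteq> 2" "2 \<noteq> 3 * a" "3 * a \<noteq> 7" "7 \<noteq> 3 * a" "3 * a \<noteq> 31" "31 \<noteq> 3 * a"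
  "Suc 0 \<noteq> Suc (Suc (3 * b))" "0 \<noteq> Suc (Suc (3 * b))"
  by presburger+

lemma simR_pc [simp]: "simR P h s (\<sigma>\<lparr>pc := p\<rparr>) = simR P h s \<sigma>" "simR P h (s\<lparr>pc := p\<rparr>) \<sigma> = simR P h s \<sigma>"
  by (simp_all add: simR_def)

lemma sim_exec:
  assumes R: "simR P h s \<sigma>" and b: "bnd s" and i: "i \<in> set P" and nj: "nojump i"
    and h: "vars h 0 = Z" "vars h 10 = 2 ^ wd - 1" and o: "length (out s) < Z"
  shows "simR P h (exec_instr wd i s) (runl w (sim_instr p i) \<sigma>)"
proof -
  have ir: "instr_regs i < num_regs P" using i by (rule instr_regs_less)
  have R1: "\<And>r. r < num_regs P \<Longrightarrow> regs \<sigma> (sreg r) = regs s r"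
    and R2: "\<And>v. regs \<sigma> (3 * v) = (if v = 11 then length (out s) else vars h v)"
    and R3: "\<And>j i. i < Z \<Longrightarrow> mem \<sigma> (j * Z + i) =
        (if j = 1 then mem s i else if j = 2 \<and> i < length (out s) then out s ! i else arr h j i)"
    and R4: "out \<sigma> = outs h"
    using R by (auto simp: simR_def)
  have z: "regs \<sigma> 0 = Z" using R2[of 0] h by simp
  have m: "regs \<sigma> 30 = 2 ^ wd - 1" using R2[of 10] h by simp
  have oc: "regs \<sigma> 33 = length (out s)" using R2[of 11] by simp
  have w1: "take_bit w (Suc 0) = Suc 0" using wd(1) wd_le_w by simp
  have rb: "regs s r < 2 ^ wd" "mem s r < 2 ^ wd" for r using b by (auto simp: bnd_def)
  have rZ: "regs s r < Z" for r using rb(1)[of r] wd(2) by linarith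
  have ad: "take_bit w (regs s r + Z) = 1 * Z + regs s r" for r
    using addr_less[of 1 "regs s r"] rZ[of r] by (simp add: take_bit_eq_mod)
  have zz: "take_bit w (2 * Z + length (out s)) = 2 * Z + length (out s)" "take_bit w (Z + Z) = 2 * Z"
    "take_bit w (Suc (length (out s))) = Suc (length (out s))"
    using addr_less[of 2 "length (out s)"] o Z(2) by (auto simp: take_bit_eq_mod)
  have mk: "take_bit wd (binop_val w f (regs s a) (regs s c)) = binop_val wd f (regs s a) (regs s c)"
    for f a c using binop_val_mask[OF wd(1) wd_le_w rb(1) rb(1)] .
  have mn: "min wd w = wd" using wd_le_w by simp
  show ?thesis
  proof (cases i)
    case (Const r v)
    then show ?thesis unfolding simR_def using ir
      by (auto simp: R1 R1[simplified] R2 R3 R4 m and_mask_nat[of _ wd, simplified] mod3 take_bit_take_bit mn)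
  next
    case (Op f r a c)
    then have "a < num_regs P" "c < num_regs P" "r < num_regs P" using ir by auto
    then show ?thesis unfolding simR_def Op using mk[of f a c]
      by (auto simp: R1 R1[simplified] R2 R3 R4 m and_mask_nat[of _ wd, simplified] mod3 simp del: binop_val.simps(1-5,7-12))
  next
    case (Load r a)
    then have "a < num_regs P" "r < num_regs P" using ir by auto
    then show ?thesis unfolding simR_def Load using R3[OF rZ, of 1 a]
      by (auto simp: R1 R1[simplified] R2 R3 R4 z ad mod3)
  next
    case (Store a r)
    then have "a < num_regs P" "r < num_regs P" using ir by auto
    then show ?thesis unfolding simR_def Store using rZ[of a] addr_inj[of _ "regs s a" _ 1] R3[of _ 1]
      by (auto simp: R1 R1[simplified] R2 R3 R4 z ad mod3)
  next
    case (JumpIf r l)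
    then show ?thesis using nj by simp
  next
    case (Output r)
    then have "r < num_regs P" using ir by auto
    then show ?thesis unfolding simR_def Output using addr_inj[of _ "length (out s)" _ 2] o R3[of _ 1] wd(1) wd_le_w
      by (auto simp: R1 R1[simplified] R2 R3 R4 z zz oc w1 mod3 nth_append)
  qed
qed


lemma pc_eq: "s\<lparr>pc := pc s\<rparr> = (s::config)" by simp

lemma sim_step:
  assumes R: "simR P h s \<sigma>" and b: "bnd s" and p: "pc s < length P" "pc \<sigma> = 5 * pc s"
    and h: "vars h 0 = Z" "vars h 10 = 2 ^ wd - 1" and o: "length (out s) < Z"
  shows "\<exists>\<sigma>'. reach w (sim P) 5 \<sigma> \<sigma>' \<and> simR P h (step wd P s) \<sigma>' \<and>
    pc \<sigma>' = 5 * min (pc (step wd P s)) (length P)"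
proof -
  define i where "i = P ! pc s"
  have i: "i \<in> set P" using p by (auto simp: i_def)
  obtain L R' where LR: "sim P = L @ sim_instr (length P) i @ R'" "length L = 5 * pc s"
    using sim_at[OF p(1)] by (auto simp: i_def)
  have st: "step wd P s = exec_instr wd i s" using p by (simp add: step_def halted_def i_def)
  have \<sigma>: "\<sigma>\<lparr>pc := 5 * pc s\<rparr> = \<sigma>" using p(2) by (cases \<sigma>) simp
  show ?thesis
  proof (cases "nojump i")
    case True
    have nj: "list_all nojump (sim_instr (length P) i)" using True by (cases i) auto
    have pc: "pc (step wd P s) = Suc (pc s)" unfolding st using True by (cases i) auto
    show ?thesis
      using reach_straight[OF nj, of w L R' \<sigma>] sim_exec[OF R b i True h o] pc p LR(2)
      by (intro exI[of _ "(runl w (sim_instr (length P) i) \<sigma>)\<lparr>pc := length L + 5\<rparr>"])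
        (simp add: LR(1)[symmetric] \<sigma> st[symmetric])
  next
    case False
    then obtain r l where rl: "i = JumpIf r l" by (cases i) auto
    have "r < num_regs P" using instr_regs_less[OF i] rl by simp
    then have sr: "regs \<sigma> (sreg r) = regs s r" using R unfolding simR_def by blast
    have s1: "step w (sim P) \<sigma> = \<sigma>\<lparr>pc := if regs s r \<noteq> 0 then 5 * min l (length P) else Suc (pc \<sigma>)\<rparr>"
      using p sr LR by (simp add: step_def halted_def nth_append rl)
    show ?thesis
    proof (cases "regs s r = 0")
      case False
      then show ?thesis using reach_step[OF s1] R
        by (intro exI[of _ "\<sigma>\<lparr>pc := 5 * min l (length P)\<rparr>"])
          (auto simp: st rl intro: reach_mono)
    next
      case True
      \<comment> \<open>A jump that is not taken still has to pass through its four padding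
        instructions.\<close>
      let ?c = "[Const (tmp 1) 0, Const (tmp 1) 0, Const (tmp 1) 0, Const (tmp 1) 0]"
      have eq: "sim P = (L @ [JumpIf (sreg r) (5 * min l (length P))]) @ ?c @ R'"
        using LR rl by simp
      have rs: "reach w (sim P) 4 (\<sigma>\<lparr>pc := 5 * pc s + 1\<rparr>) ((runl w ?c \<sigma>)\<lparr>pc := 5 * pc s + 5\<rparr>)"
        unfolding eq using reach_straight[of ?c w "L @ [JumpIf (sreg r) (5 * min l (length P))]" R' \<sigma>] LR(2)
        by (simp add: eval_nat_numeral)
      have s1': "step w (sim P) \<sigma> = \<sigma>\<lparr>pc := 5 * pc s + 1\<rparr>" using s1 True p(2) by simp
      have "reach w (sim P) (1 + 4) \<sigma> ((runl w ?c \<sigma>)\<lparr>pc := 5 * pc s + 5\<rparr>)"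
        by (rule reach_trans[OF reach_step[OF s1'] rs])
      moreover have "simR P h (step wd P s) ((runl w ?c \<sigma>)\<lparr>pc := 5 * pc s + 5\<rparr>)"
        using R unfolding st rl simR_def by (auto simp: mod3)
      ultimately show ?thesis using True p(1)
        by (intro exI[of _ "(runl w ?c \<sigma>)\<lparr>pc := 5 * pc s + 5\<rparr>"]) (simp add: st rl del: simR_pc)
    qed
  qed
qed

lemma sim_steps:
  assumes "(step wd P ^^ t) s = s'" "halted P s'" "length (out s') < Z"
    "simR P h s \<sigma>" "bnd s" "pc \<sigma> = 5 * min (pc s) (length P)"
    and h: "vars h 0 = Z" "vars h 10 = 2 ^ wd - 1"
  shows "\<exists>\<sigma>'. reach w (sim P) (5 * t) \<sigma> \<sigma>' \<and> simR P h s' \<sigma>' \<and> pc \<sigma>' = 5 * length P"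
  using assms(1,4,5,6)
proof (induction t arbitrary: s \<sigma>)
  case 0
  then show ?case using assms(2) reach_refl by (intro exI[of _ \<sigma>]) (auto simp: halted_def)
next
  case (Suc t)
  show ?case
  proof (cases "halted P s")
    case True
    then have "s' = s" using Suc.prems(1) step_halted[OF True, of "Suc t" wd] by simp
    then show ?thesis using Suc.prems True reach_refl by (intro exI[of _ \<sigma>]) (auto simp: halted_def)
  next
    case False
    then have p: "pc s < length P" by (simp add: halted_def)
    \<comment> \<open>Output only grows, so the bound on the final output holds at every earlier
      moment.\<close>
    have "length (out s) < Z"
      using out_steps_mono[where t="Suc t" and w=wd and P=P and s=s] Suc.prems(1) assms(3) by auto
    from sim_step[OF Suc.prems(2,3) p _ h this] obtain \<sigma>1 where
      1: "reach w (sim P) 5 \<sigma> \<sigma>1" "simR P h (step wd P s) \<sigma>1"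
        "pc \<sigma>1 = 5 * min (pc (step wd P s)) (length P)"
      using Suc.prems(4) p by auto
    from Suc.IH[OF _ 1(2) bnd_step[OF Suc.prems(3)] 1(3)] Suc.prems(1)
    obtain \<sigma>' where "reach w (sim P) (5 * t) \<sigma>1 \<sigma>'" "simR P h s' \<sigma>'" "pc \<sigma>' = 5 * length P"
      by (auto simp: funpow_swap1)
    with reach_trans[OF 1(1) this(1)] show ?thesis by auto
  qed
qed

section \<open>Calls and correctness of compilation\<close>

lemma runl_zero:
  "regs (runl w (map (\<lambda>r. Const (sreg r) 0) [0..<m]) s) = (\<lambda>x. if \<exists>r<m. x = sreg r then 0 else regs s x)
   \<and> mem (runl w (map (\<lambda>r. Const (sreg r) 0) [0..<m]) s) = mem s
   \<and> out (runl w (map (\<lambda>r. Const (sreg r) 0) [0..<m]) s) = out s"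
  by (induction m) (auto simp: fun_eq_iff less_Suc_eq)

lemma call_init_simR:
  assumes "rel h s" 
  shows "simR P h (start (vars h v) (arr h 1)) (runl w (call_init P v) s)"
proof -
  let ?z = "map (\<lambda>r. Const (sreg r) 0) [0..<num_regs P]"
  define s1 where "s1 = runl w ?z s"
  have z: "regs s1 = (\<lambda>x. if \<exists>r<num_regs P. x = sreg r then 0 else regs s x)" "mem s1 = mem s"
    "out s1 = out s" using runl_zero[of "num_regs P" s] by (auto simp: s1_def)
  have v: "regs s1 (3 * v) = vars h v" for v
    using assms unfolding z rel_def by (auto simp: mod3)
  have e: "runl w (call_init P v) s =
     exec_instr w (Const (3 * 11) 0) (exec_instr w (Op And (sreg 0) (3 * v) (3 * v)) s1)"
    by (simp add: call_init_def s1_def)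
  have s: "regs s1 (Suc (Suc (3 * r))) = 0" if "r < num_regs P" for r
    using that by (auto simp: z)
  show ?thesis unfolding e simR_def start_def using assms
    by (auto simp: v s z(2,3) rel_def mod3)
qed

lemma call_correct:
  assumes H: "halts_within wd P (start (vars h v) (arr h 1)) t s"
    and h: "vars h 0 = Z" "vars h 10 = 2 ^ wd - 1" "vars h v < 2 ^ wd" "\<forall>i. arr h 1 i < 2 ^ wd"
    and o: "length (out s) < Z" and r: "rel h \<sigma>"
  shows "\<exists>\<sigma>'. reach w (compile (Call P v)) (num_regs P + 2 + 5 * t) (\<sigma>\<lparr>pc := 0\<rparr>)
      (\<sigma>'\<lparr>pc := length (compile (Call P v))\<rparr>) \<and>
    rel (h\<lparr>vars := (vars h)(11 := length (out s)),
      arr := (arr h)(1 := mem s, 2 := (\<lambda>i. if i < length (out s) then out s ! i else arr h 2 i))\<rparr>) \<sigma>'"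
proof -
  let ?I = "call_init P v"
  let ?s = "start (vars h v) (arr h 1)"
  let ?\<sigma>1 = "runl w ?I \<sigma>"
  have lI: "length ?I = num_regs P + 2" by (simp add: call_init_def)
  have nj: "list_all nojump ?I" by (auto simp: call_init_def list_all_iff)
  have c: "compile (Call P v) = ?I @ shift (length ?I) (sim P)" by simp
  have 1: "reach w (compile (Call P v)) (num_regs P + 2) (\<sigma>\<lparr>pc := 0\<rparr>) (?\<sigma>1\<lparr>pc := length ?I\<rparr>)"
    using reach_straight[OF nj, of w "[]" "shift (length ?I) (sim P)" \<sigma>] unfolding c lI by simp
  have b: "bnd ?s" using h wd by (auto simp: bnd_def start_def)
  have R: "simR P h ?s (?\<sigma>1\<lparr>pc := 0\<rparr>)" using call_init_simR[OF r] by simp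
  obtain \<sigma>' where 2: "reach w (sim P) (5 * t) (?\<sigma>1\<lparr>pc := 0\<rparr>) \<sigma>'" "simR P h s \<sigma>'" "pc \<sigma>' = 5 * length P"
    using sim_steps[OF _ _ o R b _ h(1,2), of t] H by (auto simp: halts_within_def start_def)
  have 3: "reach w (compile (Call P v)) (5 * t) (?\<sigma>1\<lparr>pc := length ?I\<rparr>)
      (\<sigma>'\<lparr>pc := length ?I + length (sim P)\<rparr>)"
  proof -
    have "\<sigma>'\<lparr>pc := 5 * length P\<rparr> = \<sigma>'" using 2(3) by (cases \<sigma>') simp
    then have "reach w (sim P) (5 * t) (?\<sigma>1\<lparr>pc := 0\<rparr>) (\<sigma>'\<lparr>pc := length (sim P)\<rparr>)"
      using 2(1) by (metis length_sim)
    from reach_shift[OF this, of ?I "[]"] show ?thesis unfolding c by simp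
  qed
  show ?thesis
    using reach_trans[OF 1 3] 2(2)
    by (intro exI[of _ \<sigma>']) (auto simp: simR_def rel_def lI)
qed

theorem compile_correct:
  assumes "exec c h h'" "rel h s"
  shows "clk h \<le> clk h' \<and> (\<exists>s'. reach w (compile c) (clk h' - clk h) (s\<lparr>pc := 0\<rparr>)
    (s'\<lparr>pc := length (compile c)\<rparr>) \<and> rel h' s')"
  using assms
proof (induction arbitrary: s rule: exec.induct)
  case (Skip h)
  then show ?case using reach_refl by (auto intro!: exI[of _ s])
next
  case (Assign e h v)
  let ?c = "comp 0 e @ [Op And (3 * v) (tmp 0) (tmp 0)]"
  have "reach w (compile (Assign v e)) (cost e + 1) (s\<lparr>pc := 0\<rparr>)
      ((runl w ?c s)\<lparr>pc := length (compile (Assign v e))\<rparr>)"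
    using reach_straight[of ?c w "[]" "[]" s] by simp
  moreover have "rel (h\<lparr>vars := (vars h)(v := eval e h), clk := clk h + (cost e + 1)\<rparr>) (runl w ?c s)"
    using comp_rel(1,2)[OF Assign, of 0] by (auto simp: rel_def)
  ultimately show ?case by (intro conjI exI[of _ "runl w ?c s"]) auto
next
  case (Write a h e j)
  define s1 where "s1 = runl w (comp 0 a) s"
  define s2 where "s2 = runl w (comp 1 e) s1"
  let ?t = "[Const (tmp 2) j, Op Mul (tmp 2) (tmp 2) 0, Op Add (tmp 0) (tmp 0) (tmp 2), Store (tmp 0) (tmp 1)]"
  let ?c = "comp 0 a @ comp 1 e @ ?t"
  have 1: "rel h s1" "regs s1 (tmp 0) = eval a h"
    using comp_rel(1,2)[OF Write(1) Write.prems, of 0] by (auto simp: s1_def)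
  have 2: "rel h s2" "regs s2 (tmp 0) = eval a h" "regs s2 (tmp 1) = eval e h"
    using comp_rel[OF Write(2) 1(1), of 1] 1(2) by (auto simp: s2_def)
  have z: "regs s2 0 = Z" using 2(1) Write(5) unfolding rel_def by (metis mult_zero_right)
  note al = addr_less[OF Write(4,3)]
  have tb: "take_bit w (take_bit w j * Z) = j * Z" "take_bit w (eval a h + j * Z) = j * Z + eval a h"
    using al by (simp_all add: take_bit_eq_mod add.commute)
  have "reach w (compile (Write j a e)) (cost a + cost e + 4) (s\<lparr>pc := 0\<rparr>)
      ((runl w ?c s)\<lparr>pc := length (compile (Write j a e))\<rparr>)"
    using reach_straight[of ?c w "[]" "[]" s] by (simp add: numeral_eq_Suc)
  moreover have rc: "runl w ?c s = runl w ?t s2" by (simp add: s1_def s2_def)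
  moreover have "rel (h\<lparr>arr := (arr h)(j := (arr h j)(eval a h := eval e h)),
      clk := clk h + (cost a + cost e + 4)\<rparr>) (runl w ?t s2)"
    using 2 addr_inj[OF _ Write(3)] Write(3) unfolding rel_def
    by (auto simp: z tb mod3)
  ultimately show ?case by (intro conjI exI[of _ "runl w ?c s"]) (auto simp del: fold.simps)
next
  case (Seq c1 h h1 c2 h2)
  let ?C1 = "compile c1" let ?C2 = "compile c2"
  from Seq.IH(1)[OF Seq.prems] obtain s1 where
    1: "clk h \<le> clk h1" "reach w ?C1 (clk h1 - clk h) (s\<lparr>pc := 0\<rparr>) (s1\<lparr>pc := length ?C1\<rparr>)" "rel h1 s1" by auto
  from Seq.IH(2)[OF 1(3)] obtain s2 where
    2: "clk h1 \<le> clk h2" "reach w ?C2 (clk h2 - clk h1) (s1\<lparr>pc := 0\<rparr>) (s2\<lparr>pc := length ?C2\<rparr>)" "rel h2 s2" by auto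
  \<comment> \<open>The first command of a sequence is compiled without relocation, while the
    relocation lemma always produces a shift, here by 0.\<close>
  have "shift_instr 0 i = i" for i by (cases i) auto
  then have id: "shift 0 P = P" for P by (induction P) auto
  have "reach w (compile (c1 ;; c2)) (clk h1 - clk h) (s\<lparr>pc := 0\<rparr>) (s1\<lparr>pc := length ?C1\<rparr>)"
    using reach_shift[OF 1(2), of "[]" "shift (length ?C1) ?C2"] by (simp add: id)
  moreover have "reach w (compile (c1 ;; c2)) (clk h2 - clk h1) (s1\<lparr>pc := length ?C1\<rparr>)
      (s2\<lparr>pc := length (compile (c1 ;; c2))\<rparr>)"
    using reach_shift[OF 2(2), of ?C1 "[]"] by simp
  ultimately have "reach w (compile (c1 ;; c2)) (clk h1 - clk h + (clk h2 - clk h1)) (s\<lparr>pc := 0\<rparr>)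
      (s2\<lparr>pc := length (compile (c1 ;; c2))\<rparr>)" by (rule reach_trans)
  moreover have "clk h1 - clk h + (clk h2 - clk h1) = clk h2 - clk h" using 1(1) 2(1) by linarith
  ultimately show ?case using 1(1) 2(1,3) by auto
next
  case (IfTrue e h c1 h' c2)
  let ?C1 = "compile c1" let ?C2 = "compile c2" let ?P = "compile (com.If e c1 c2)"
  let ?p = "cost e + 1" let ?q = "?p + length ?C2 + 2"
  let ?L = "comp 0 e @ [JumpIf (tmp 0) ?q] @ shift ?p ?C2 @ [Const (tmp 0) 1, JumpIf (tmp 0) (?q + length ?C1)]"
  let ?s1 = "runl w (comp 0 e) s"
  have P: "?P = comp 0 e @ [JumpIf (tmp 0) ?q] @ shift ?p ?C2 @
      [Const (tmp 0) 1, JumpIf (tmp 0) (?q + length ?C1)] @ shift ?q ?C1" by (simp add: Let_def)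
  have L: "length ?L = ?q" by simp
  have r1: "rel h ?s1" "regs ?s1 (tmp 0) = eval e h" using comp_rel[OF IfTrue(1) IfTrue.prems, of 0] by auto
  from r1(1) have "rel (tick (cost e + 1) h) ?s1" by simp
  from IfTrue.IH[OF this] obtain s' where
    1: "clk h + (cost e + 1) \<le> clk h'" "reach w ?C1 (clk h' - (clk h + (cost e + 1))) (?s1\<lparr>pc := 0\<rparr>) (s'\<lparr>pc := length ?C1\<rparr>)"
      "rel h' s'" by auto
  have a: "reach w ?P (cost e) (s\<lparr>pc := 0\<rparr>) (?s1\<lparr>pc := cost e\<rparr>)"
    unfolding P using reach_straight[of "comp 0 e" w "[]" _ s] by simp
  have b: "reach w ?P 1 (?s1\<lparr>pc := cost e\<rparr>) (?s1\<lparr>pc := ?q\<rparr>)"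
    by (rule reach_step) (use r1(2) IfTrue(2) in \<open>auto simp: P step_def halted_def nth_append simp del: compile.simps\<close>)
  have c: "reach w ?P (clk h' - (clk h + (cost e + 1))) (?s1\<lparr>pc := ?q\<rparr>) (s'\<lparr>pc := length ?P\<rparr>)"
    using reach_shift[OF 1(2), of ?L "[]"] unfolding P L by (simp add: add_ac)
  have "reach w ?P (cost e + (1 + (clk h' - (clk h + (cost e + 1))))) (s\<lparr>pc := 0\<rparr>) (s'\<lparr>pc := length ?P\<rparr>)"
    using reach_trans[OF a reach_trans[OF b c]] .
  moreover have "cost e + (1 + (clk h' - (clk h + (cost e + 1)))) = clk h' - clk h" using 1(1) by linarith
  ultimately show ?case using 1 by (auto simp del: compile.simps)
next
  case (IfFalse e h c2 h' c1)
  let ?C1 = "compile c1" let ?C2 = "compile c2" let ?P = "compile (com.If e c1 c2)"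
  let ?p = "cost e + 1" let ?q = "?p + length ?C2 + 2"
  let ?L = "comp 0 e @ [JumpIf (tmp 0) ?q]"
  let ?R = "[Const (tmp 0) 1, JumpIf (tmp 0) (?q + length ?C1)] @ shift ?q ?C1"
  let ?s1 = "runl w (comp 0 e) s"
  have P: "?P = ?L @ shift ?p ?C2 @ ?R" by (simp add: Let_def)
  have L: "length ?L = ?p" by simp
  have r1: "rel h ?s1" "regs ?s1 (tmp 0) = eval e h" using comp_rel[OF IfFalse(1) IfFalse.prems, of 0] by auto
  from r1(1) have "rel (tick (cost e + 3) h) ?s1" by simp
  from IfFalse.IH[OF this] obtain s' where
    1: "clk h + (cost e + 3) \<le> clk h'" "reach w ?C2 (clk h' - (clk h + (cost e + 3))) (?s1\<lparr>pc := 0\<rparr>) (s'\<lparr>pc := length ?C2\<rparr>)"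
      "rel h' s'" by auto
  have a: "reach w ?P (cost e) (s\<lparr>pc := 0\<rparr>) (?s1\<lparr>pc := cost e\<rparr>)"
    unfolding P using reach_straight[of "comp 0 e" w "[]" _ s] by simp
  have b: "reach w ?P 1 (?s1\<lparr>pc := cost e\<rparr>) (?s1\<lparr>pc := ?p\<rparr>)"
    by (rule reach_step) (use r1(2) IfFalse(2) in \<open>auto simp: P step_def halted_def nth_append simp del: compile.simps\<close>)
  have c: "reach w ?P (clk h' - (clk h + (cost e + 3))) (?s1\<lparr>pc := ?p\<rparr>) (s'\<lparr>pc := ?p + length ?C2\<rparr>)"
    using reach_shift[OF 1(2), of ?L ?R] unfolding P L by simp
  define s2 where "s2 = s'\<lparr>regs := (regs s')(tmp 0 := 1)\<rparr>"
  have w1: "0 < w" using wd(1) wd_le_w by simp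
  have d: "reach w ?P 1 (s'\<lparr>pc := ?p + length ?C2\<rparr>) (s2\<lparr>pc := ?p + length ?C2 + 1\<rparr>)"
    by (rule reach_step) (auto simp: P step_def halted_def nth_append s2_def w1 simp del: compile.simps)
  have e: "reach w ?P 1 (s2\<lparr>pc := ?p + length ?C2 + 1\<rparr>) (s2\<lparr>pc := length ?P\<rparr>)"
    by (rule reach_step) (auto simp: P step_def halted_def nth_append s2_def simp del: compile.simps)
  have "reach w ?P (cost e + (1 + (clk h' - (clk h + (cost e + 3)) + (1 + 1)))) (s\<lparr>pc := 0\<rparr>) (s2\<lparr>pc := length ?P\<rparr>)"
    by (rule reach_trans[OF a reach_trans[OF b reach_trans[OF c reach_trans[OF d e]]]])
  moreover have "cost e + (1 + (clk h' - (clk h + (cost e + 3)) + (1 + 1))) = clk h' - clk h" using 1(1) by linarith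
  moreover have "rel h' s2" using 1(3) by (auto simp: rel_def s2_def mod3)
  ultimately show ?case using 1(1) by (auto simp del: compile.simps)
next
  case (WhileFalse e h c)
  let ?C = "compile c" let ?P = "compile (While e c)" let ?e = "Bin Eq e (N 0)"
  let ?s1 = "runl w (comp 0 ?e) s"
  have P: "?P = comp 0 ?e @ [JumpIf (tmp 0) (cost e + 3 + length ?C + 2)] @ shift (cost e + 3) ?C @
      [Const (tmp 0) 1, JumpIf (tmp 0) 0]" by (simp add: Let_def)
  have ok: "ok ?e h" using WhileFalse(1) by simp
  have r1: "rel h ?s1" "regs ?s1 (tmp 0) = 1"
    using comp_rel(1,2)[OF ok WhileFalse.prems, of 0] WhileFalse(2) by (auto simp del: comp.simps)
  have a: "reach w ?P (cost e + 2) (s\<lparr>pc := 0\<rparr>) (?s1\<lparr>pc := cost e + 2\<rparr>)"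
    unfolding P using reach_straight[of "comp 0 ?e" w "[]" _ s] by (simp del: comp.simps)
  have b: "reach w ?P 1 (?s1\<lparr>pc := cost e + 2\<rparr>) (?s1\<lparr>pc := length ?P\<rparr>)"
    by (rule reach_step) (use r1(2) in \<open>auto simp: P step_def halted_def nth_append simp del: comp.simps compile.simps\<close>)
  have "reach w ?P (cost e + 3) (s\<lparr>pc := 0\<rparr>) (?s1\<lparr>pc := length ?P\<rparr>)"
    using reach_trans[OF a b] by (rule reach_mono) simp
  with r1(1) show ?case by (auto simp del: comp.simps compile.simps)
next
  case (WhileTrue e h c h1 h2)
  let ?C = "compile c" let ?P = "compile (While e c)" let ?e = "Bin Eq e (N 0)"
  let ?s1 = "runl w (comp 0 ?e) s" let ?p = "cost e + 3"
  let ?L = "comp 0 ?e @ [JumpIf (tmp 0) (cost e + 3 + length ?C + 2)]"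
  let ?R = "[Const (tmp 0) 1, JumpIf (tmp 0) 0]"
  have P: "?P = ?L @ shift ?p ?C @ ?R" by (simp add: Let_def)
  have L: "length ?L = ?p" by simp
  have ok: "ok ?e h" using WhileTrue(1) by simp
  have r1: "rel h ?s1" "regs ?s1 (tmp 0) = 0"
    using comp_rel(1,2)[OF ok WhileTrue.prems, of 0] WhileTrue(2) by (auto simp del: comp.simps)
  from r1(1) have "rel (tick (cost e + 5) h) ?s1" by simp
  from WhileTrue.IH(1)[OF this] obtain s' where
    1: "clk h + (cost e + 5) \<le> clk h1" "reach w ?C (clk h1 - (clk h + (cost e + 5))) (?s1\<lparr>pc := 0\<rparr>) (s'\<lparr>pc := length ?C\<rparr>)"
      "rel h1 s'" by (auto simp del: comp.simps)
  have a: "reach w ?P (cost e + 2) (s\<lparr>pc := 0\<rparr>) (?s1\<lparr>pc := cost e + 2\<rparr>)"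
    unfolding P using reach_straight[of "comp 0 ?e" w "[]" _ s] by (simp del: comp.simps)
  have b: "reach w ?P 1 (?s1\<lparr>pc := cost e + 2\<rparr>) (?s1\<lparr>pc := ?p\<rparr>)"
    by (rule reach_step) (use r1(2) in \<open>auto simp: P step_def halted_def nth_append simp del: comp.simps compile.simps\<close>)
  have c: "reach w ?P (clk h1 - (clk h + (cost e + 5))) (?s1\<lparr>pc := ?p\<rparr>) (s'\<lparr>pc := ?p + length ?C\<rparr>)"
    using reach_shift[OF 1(2), of ?L ?R] unfolding P L by (simp del: comp.simps)
  define s2 where "s2 = s'\<lparr>regs := (regs s')(tmp 0 := 1)\<rparr>"
  have w1: "0 < w" using wd(1) wd_le_w by simp
  have d: "reach w ?P 1 (s'\<lparr>pc := ?p + length ?C\<rparr>) (s2\<lparr>pc := ?p + length ?C + 1\<rparr>)"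
    by (rule reach_step) (auto simp: P step_def halted_def nth_append s2_def w1 simp del: comp.simps compile.simps)
  have e: "reach w ?P 1 (s2\<lparr>pc := ?p + length ?C + 1\<rparr>) (s2\<lparr>pc := 0\<rparr>)"
    by (rule reach_step) (auto simp: P step_def halted_def nth_append s2_def simp del: comp.simps compile.simps)
  have "rel h1 s2" using 1(3) by (auto simp: rel_def s2_def mod3)
  from WhileTrue.IH(2)[OF this] obtain s3 where
    2: "clk h1 \<le> clk h2" "reach w ?P (clk h2 - clk h1) (s2\<lparr>pc := 0\<rparr>) (s3\<lparr>pc := length ?P\<rparr>)" "rel h2 s3"
    by blast
  have "reach w ?P (cost e + 2 + (1 + (clk h1 - (clk h + (cost e + 5)) + (1 + (1 + (clk h2 - clk h1))))))
      (s\<lparr>pc := 0\<rparr>) (s3\<lparr>pc := length ?P\<rparr>)"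
    by (rule reach_trans[OF a reach_trans[OF b reach_trans[OF c reach_trans[OF d reach_trans[OF e 2(2)]]]]])
  moreover have "cost e + 2 + (1 + (clk h1 - (clk h + (cost e + 5)) + (1 + (1 + (clk h2 - clk h1))))) = clk h2 - clk h"
    using 1(1) 2(1) by linarith
  ultimately show ?case using 1(1) 2 by (auto simp del: compile.simps)
next
  case (Out e h)
  let ?c = "comp 0 e @ [Output (tmp 0)]"
  have "reach w (compile (Out e)) (cost e + 1) (s\<lparr>pc := 0\<rparr>)
      ((runl w ?c s)\<lparr>pc := length (compile (Out e))\<rparr>)"
    using reach_straight[of ?c w "[]" "[]" s] by simp
  moreover have "rel (h\<lparr>outs := outs h @ [eval e h], clk := clk h + (cost e + 1)\<rparr>) (runl w ?c s)"
    using comp_rel(1,2)[OF Out, of 0] by (auto simp: rel_def)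
  ultimately show ?case by (intro conjI exI[of _ "runl w ?c s"]) auto
next
  case (Call P h v t s')
  from call_correct[OF Call(1-6) Call.prems] show ?case by (auto simp: rel_def simp del: compile.simps)
qed

end

section \<open>Frame conditions and weakest preconditions\<close>

fun modv :: "com \<Rightarrow> nat set" where
  "modv Skip = {}"
| "modv (Assign v e) = {v}"
| "modv (Write j a e) = {}"
| "modv (c1 ;; c2) = modv c1 \<union> modv c2"
| "modv (If e c1 c2) = modv c1 \<union> modv c2"
| "modv (While e c) = modv c"
| "modv (Out e) = {}"
| "modv (Call P v) = {11}"

fun moda :: "com \<Rightarrow> nat set" where
  "moda Skip = {}"
| "moda (Assign v e) = {}"
| "moda (Write j a e) = {j}"
| "moda (c1 ;; c2) = moda c1 \<union> moda c2"
| "moda (If e c1 c2) = moda c1 \<union> moda c2"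
| "moda (While e c) = moda c"
| "moda (Out e) = {}"
| "moda (Call P v) = {1, 2}"

fun silent :: "com \<Rightarrow> bool" where
  "silent (c1 ;; c2) \<longleftrightarrow> silent c1 \<and> silent c2"
| "silent (If e c1 c2) \<longleftrightarrow> silent c1 \<and> silent c2"
| "silent (While e c) \<longleftrightarrow> silent c"
| "silent (Out e) \<longleftrightarrow> False"
| "silent _ \<longleftrightarrow> True"

text \<open>Determined by syntax alone, so that invariants about untouched variables and arrays pass
  over a command without mention in its specification.\<close>

definition frame :: "com \<Rightarrow> hstate \<Rightarrow> hstate \<Rightarrow> bool" where
  "frame c h h' \<longleftrightarrow> (\<forall>v. v \<notin> modv c \<longrightarrow> vars h' v = vars h v) \<and>
     (\<forall>j. j \<notin> moda c \<longrightarrow> arr h' j = arr h j) \<and> (silent c \<longrightarrow> outs h' = outs h)"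

definition For :: "nat \<Rightarrow> exp \<Rightarrow> com \<Rightarrow> com" where
  "For v e c = Assign v (N 0) ;; While (Bin Less (V v) e) (c ;; Assign v (Bin Add (V v) (N 1)))"

lemma mod_For [simp]: "modv (For v e c) = insert v (modv c)" "moda (For v e c) = moda c"
    "silent (For v e c) = silent c"
  by (auto simp: For_def)

text \<open>Loop bounds have to be variables or constants.\<close>

fun atom :: "exp \<Rightarrow> nat set \<Rightarrow> bool" where
  "atom (N c) S \<longleftrightarrow> True"
| "atom (V v) S \<longleftrightarrow> v \<notin> S"
| "atom _ S \<longleftrightarrow> False"

context ram begin

lemma exec_frame: "exec c h h' \<Longrightarrow> frame c h h'"
  by (induction rule: exec.induct) (auto simp: frame_def)

text \<open>Total correctness in existential form: one terminating execution is exhibited, and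
  \<open>compile_correct\<close> carries exactly that one over to the machine.\<close>

definition wp :: "com \<Rightarrow> (hstate \<Rightarrow> bool) \<Rightarrow> hstate \<Rightarrow> bool" where
  "wp c Q h \<longleftrightarrow> (\<exists>h'. exec c h h' \<and> Q h')"

lemma wp_mono: "wp c Q h \<Longrightarrow> (\<And>h'. Q h' \<Longrightarrow> frame c h h' \<Longrightarrow> Q' h') \<Longrightarrow> wp c Q' h"
  unfolding wp_def using exec_frame by blast

lemma wp_Skip: "Q h \<Longrightarrow> wp Skip Q h"
  unfolding wp_def using exec.Skip by blast

lemma wp_Assign:
  "ok e h \<Longrightarrow> Q (h\<lparr>vars := (vars h)(v := eval e h), clk := clk h + (cost e + 1)\<rparr>) \<Longrightarrow> wp (Assign v e) Q h"
  unfolding wp_def using exec.Assign by blast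

lemma wp_Write:
  "ok a h \<Longrightarrow> ok e h \<Longrightarrow> eval a h < Z \<Longrightarrow> j < 40 \<Longrightarrow> vars h 0 = Z \<Longrightarrow>
    Q (h\<lparr>arr := (arr h)(j := (arr h j)(eval a h := eval e h)), clk := clk h + (cost a + cost e + 4)\<rparr>) \<Longrightarrow>
    wp (Write j a e) Q h"
  unfolding wp_def using exec.Write by blast

lemma wp_Seq: "wp c1 (wp c2 Q) h \<Longrightarrow> wp (c1 ;; c2) Q h"
  unfolding wp_def using exec.Seq by blast

lemma wp_If:
  assumes "ok e h" "eval e h \<noteq> 0 \<Longrightarrow> wp c1 Q (tick (cost e + 1) h)"
    "eval e h = 0 \<Longrightarrow> wp c2 Q (tick (cost e + 3) h)"
  shows "wp (If e c1 c2) Q h"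
  using assms unfolding wp_def by (metis exec.IfTrue exec.IfFalse)

lemma wp_Out:
  "ok e h \<Longrightarrow> Q (h\<lparr>outs := outs h @ [eval e h], clk := clk h + (cost e + 1)\<rparr>) \<Longrightarrow> wp (Out e) Q h"
  unfolding wp_def using exec.Out by blast

lemma wp_Call:
  "halts_within wd P (start (vars h v) (arr h 1)) t s \<Longrightarrow>
    vars h 0 = Z \<Longrightarrow> vars h 10 = 2 ^ wd - 1 \<Longrightarrow> vars h v < 2 ^ wd \<Longrightarrow> \<forall>i. arr h 1 i < 2 ^ wd \<Longrightarrow>
    length (out s) < Z \<Longrightarrow>
    Q (h\<lparr>vars := (vars h)(11 := length (out s)),
      arr := (arr h)(1 := mem s, 2 := (\<lambda>i. if i < length (out s) then out s ! i else arr h 2 i)),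
      clk := clk h + (num_regs P + 2 + 5 * t)\<rparr>) \<Longrightarrow> wp (Call P v) Q h"
  unfolding wp_def using exec.Call by blast

text \<open>Each round pays 8 for the test and the jumps and 4 for the increment; the failing test
  pays 6, and \<open>wp_For\<close> adds 2 for the initial assignment. The invariant is insensitive
  to counter and clock because both change outside the body. An atomic bound costs 1 and, not being
  modified, keeps its value in every round.\<close>

lemma wp_For_aux:
  fixes J :: "nat \<Rightarrow> hstate \<Rightarrow> bool" and h0 :: hstate
  assumes e: "eval e h0 = n" "atom e (insert v (modv c))" "v \<notin> modv c" "n < 2 ^ w"
    and J: "\<And>i h x k. J i (h\<lparr>vars := (vars h)(v := x), clk := k\<rparr>) = J i h"
    and body: "\<And>i h. i < n \<Longrightarrow> J i h \<Longrightarrow> frame (For v e c) h0 h \<Longrightarrow> vars h v = i \<Longrightarrow>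
      wp c (\<lambda>h'. J (Suc i) h' \<and> clk h' \<le> clk h + t i) h"
    and h: "vars h v = i" "i \<le> n" "J i h" "frame (For v e c) h0 h"
  shows "wp (While (Bin Less (V v) e) (c ;; Assign v (Bin Add (V v) (N 1))))
    (\<lambda>h'. J n h' \<and> vars h' v = n \<and> frame (For v e c) h0 h' \<and>
      clk h' \<le> clk h + (\<Sum>i\<in>{i..<n}. t i + 12) + 6) h"
  using h
proof (induction "n - i" arbitrary: i h)
  case 0
  let ?b = "Bin Less (V v) e"
  have ev: "eval e h = n" using 0 e unfolding frame_def by (cases e) auto
  have ok: "ok ?b h" using e by (cases e) auto
  have ce: "cost e = 1" using e(2) by (cases e) auto
  have "exec (While ?b (c ;; Assign v (Bin Add (V v) (N 1)))) h (tick (cost ?b + 3) h)"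
    by (rule exec.WhileFalse[OF ok]) (use 0 ev in auto)
  moreover have "frame (For v e c) h0 (tick (cost ?b + 3) h)" using 0(5) by (simp add: frame_def)
  moreover have "J n (tick (cost ?b + 3) h)"
    using 0 J[where i = n and h = h and x = "vars h v" and k = "clk h + (cost ?b + 3)"] by (cases h) auto
  ultimately show ?case using 0 ce unfolding wp_def by (intro exI[of _ "tick (cost ?b + 3) h"]) auto
next
  case (Suc m)
  let ?b = "Bin Less (V v) e"
  have i: "i < n" using Suc by linarith
  have ev: "eval e h = n" using Suc.prems e unfolding frame_def by (cases e) auto
  have ok: "ok ?b h" using e by (cases e) auto
  have ce: "cost e = 1" using e(2) by (cases e) auto
  define h1 where "h1 = tick (cost ?b + 5) h"
  have f1: "frame (For v e c) h0 h1" using Suc.prems by (simp add: frame_def h1_def)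
  have j1: "J i h1"
    using Suc.prems J[where i = i and h = h and x = "vars h v" and k = "clk h + (cost ?b + 5)"] by (cases h) (auto simp: h1_def)
  obtain h2 where h2: "exec c h1 h2" "J (Suc i) h2" "clk h2 \<le> clk h1 + t i"
    using body[OF i j1 f1] Suc.prems(1) by (auto simp: wp_def h1_def)
  have fr2: "frame c h1 h2" using exec_frame[OF h2(1)] .
  have v2: "vars h2 v = i" using fr2 e(3) Suc.prems(1) by (auto simp: frame_def h1_def)
  define h3 where "h3 = h2\<lparr>vars := (vars h2)(v := Suc i), clk := clk h2 + 4\<rparr>"
  have "(1::nat) < 2 ^ w" using wd(1) wd_le_w by (intro one_less_power) auto
  then have "exec (Assign v (Bin Add (V v) (N 1))) h2 h3"
    using exec.Assign[of "Bin Add (V v) (N 1)" h2 v] v2 i e(4) by (simp add: h3_def eval_nat_numeral)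
  then have b: "exec (c ;; Assign v (Bin Add (V v) (N 1))) h1 h3" using h2(1) exec.Seq by blast
  have f3: "frame (For v e c) h0 h3" using f1 fr2 unfolding frame_def h3_def by auto
  have j3: "J (Suc i) h3" using h2(2) J unfolding h3_def by blast
  have "wp (While ?b (c ;; Assign v (Bin Add (V v) (N 1))))
     (\<lambda>h'. J n h' \<and> vars h' v = n \<and> frame (For v e c) h0 h' \<and>
      clk h' \<le> clk h3 + (\<Sum>i\<in>{Suc i..<n}. t i + 12) + 6) h3"
    by (rule Suc.hyps(1)) (use Suc.hyps(2) i j3 f3 in \<open>auto simp: h3_def\<close>)
  then obtain h4 where h4: "exec (While ?b (c ;; Assign v (Bin Add (V v) (N 1)))) h3 h4"
    "J n h4" "vars h4 v = n" "frame (For v e c) h0 h4" "clk h4 \<le> clk h3 + (\<Sum>i\<in>{Suc i..<n}. t i + 12) + 6"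
    by (auto simp: wp_def)
  have "clk h4 \<le> clk h + (\<Sum>i\<in>{i..<n}. t i + 12) + 6"
    using h4(5) h2(3) ce i by (simp add: h3_def h1_def sum.atLeast_Suc_lessThan)
  moreover have "exec (While ?b (c ;; Assign v (Bin Add (V v) (N 1)))) h h4"
    by (rule exec.WhileTrue[OF ok _ b[unfolded h1_def] h4(1)]) (use Suc.prems(1) i ev in auto)
  ultimately show ?case using h4 unfolding wp_def by blast
qed

lemma wp_For:
  fixes J :: "nat \<Rightarrow> hstate \<Rightarrow> bool"
  assumes e: "eval e h = n" "atom e (insert v (modv c))" "v \<notin> modv c" "n < 2 ^ w"
    and J: "\<And>i h x k. J i (h\<lparr>vars := (vars h)(v := x), clk := k\<rparr>) = J i h"
    and 0: "J 0 h"
    and body: "\<And>i h'. i < n \<Longrightarrow> J i h' \<Longrightarrow> frame (For v e c) h h' \<Longrightarrow> vars h' v = i \<Longrightarrow>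
      wp c (\<lambda>h''. J (Suc i) h'' \<and> clk h'' \<le> clk h' + t i) h'"
    and Q: "\<And>h'. J n h' \<Longrightarrow> vars h' v = n \<Longrightarrow> frame (For v e c) h h' \<Longrightarrow>
      clk h' \<le> clk h + (\<Sum>i<n. t i + 12) + 8 \<Longrightarrow> Q h'"
  shows "wp (For v e c) Q h"
  unfolding For_def
proof (rule wp_Seq, rule wp_Assign)
  show "ok (N 0) h" by simp
  let ?h = "h\<lparr>vars := (vars h)(v := eval (N 0) h), clk := clk h + (cost (N 0) + 1)\<rparr>"
  have "J 0 ?h" using 0 J by blast
  moreover have f: "frame (For v e c) h ?h" by (auto simp: frame_def)
  ultimately have "wp (While (Bin Less (V v) e) (c ;; Assign v (Bin Add (V v) (N 1))))
    (\<lambda>h'. J n h' \<and> vars h' v = n \<and> frame (For v e c) h h' \<and>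
      clk h' \<le> clk ?h + (\<Sum>i\<in>{0..<n}. t i + 12) + 6) ?h"
    by (intro wp_For_aux[where J = J and i = 0, OF e J body]) (assumption | simp)+
  then show "wp (While (Bin Less (V v) e) (c ;; Assign v (Bin Add (V v) (N 1)))) Q ?h"
    by (rule wp_mono) (rule Q, simp_all add: lessThan_atLeast0)
qed

lemma wp_start:
  assumes "wp c Q h" "vars h = (\<lambda>_. 0)(0 := a)" "\<forall>j. \<forall>i<Z. M (j * Z + i) = arr h j i" "outs h = []" "clk h = 0"
  obtains t s h' where "Q h'" "halts_within w (compile c) (start a M) t s" "t \<le> clk h'" "out s = outs h'"
proof -
  obtain h' where h': "exec c h h'" "Q h'" using assms(1) by (auto simp: wp_def)
  have r: "rel h (start a M)" using assms by (auto simp: rel_def start_def)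
  from compile_correct[OF h'(1) r] assms(5) obtain s' where
    s: "reach w (compile c) (clk h') ((start a M)\<lparr>pc := 0\<rparr>) (s'\<lparr>pc := length (compile c)\<rparr>)" "rel h' s'"
    by auto
  then obtain t where t: "t \<le> clk h'" "(step w (compile c) ^^ t) (start a M) = s'\<lparr>pc := length (compile c)\<rparr>"
    by (auto simp: reach_def start_def)
  show thesis
    by (rule that[OF h'(2) _ t(1), of "s'\<lparr>pc := length (compile c)\<rparr>"])
      (use t s(2) in \<open>auto simp: halts_within_def halted_def rel_def\<close>)
qed

text \<open>Replaces the record expression left by a series of assignments with a named state; the
  equality is then settled field by field.\<close>

lemma wp_eq: "wp c R h \<Longrightarrow> h = h' \<Longrightarrow> wp c R h'"
  by simp

end

section \<open>Multidimensional discrete Fourier transform\<close>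

definition dig :: "nat \<Rightarrow> nat \<Rightarrow> nat \<Rightarrow> nat" where
  "dig r i x = x div r ^ i mod r"

definition dot :: "nat \<Rightarrow> nat \<Rightarrow> nat \<Rightarrow> nat \<Rightarrow> nat" where
  "dot r K x y = (\<Sum>i<K. dig r i x * dig r i y)"

text \<open>The Fourier transform along the lowest \<open>l\<close> axes only: in the index
  \<open>e\<close>, digits below \<open>l\<close> are frequencies and the others still positions.
  The factor \<open>s\<close> is 1, or \<open>r - 1\<close> for the transform at the negated
  frequency.\<close>

definition pdft :: "nat \<Rightarrow> nat \<Rightarrow> nat \<Rightarrow> (nat \<Rightarrow> nat) \<Rightarrow> nat \<Rightarrow> nat \<Rightarrow> nat" where
  "pdft r \<omega> s f l e = (\<Sum>x<r ^ l. f (e div r ^ l * r ^ l + x) * \<omega> ^ (s * dot r l e x))"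

lemma sum_lessThan_mult:
  fixes f :: "nat \<Rightarrow> 'a::comm_monoid_add"
  shows "(\<Sum>x<n * m. f x) = (\<Sum>c<n. \<Sum>y<m. f (c * m + y))"
proof -
  have "(\<Sum>x<n * m. f x) = (\<Sum>c<n. sum f {c * m..<c * m + m})"
    by (rule sum.nat_group[symmetric])
  also have "\<dots> = (\<Sum>c<n. \<Sum>y<m. f (c * m + y))"
  proof (rule sum.cong[OF refl])
    fix c
    have "sum f {c * m..<c * m + m} = (\<Sum>y\<in>{0..<m}. f (y + c * m))"
      using sum.shift_bounds_nat_ivl[of f 0 "c * m" m] by (simp add: add.commute)
    then show "sum f {c * m..<c * m + m} = (\<Sum>y<m. f (c * m + y))"
      by (simp add: lessThan_atLeast0 add.commute)
  qed
  finally show ?thesis .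
qed

lemma dig_low:
  assumes "i < l" "0 < r"
  shows "dig r i (c * r ^ l + y) = dig r i y"
proof -
  have "c * r ^ l = (c * r ^ (l - Suc i) * r) * r ^ i"
    using assms by (simp add: power_add[symmetric] power_Suc[symmetric] mult.assoc del: power_Suc)
  then have "(c * r ^ l + y) div r ^ i = c * r ^ (l - Suc i) * r + y div r ^ i"
    using assms by (simp only: div_mult_self4 power_not_zero) (simp add: add.commute)
  then show ?thesis by (simp add: dig_def)
qed

lemma dig_top: "y < r ^ l \<Longrightarrow> c < r \<Longrightarrow> dig r l (c * r ^ l + y) = c"
  by (simp add: dig_def)

lemma dig_less: "0 < r \<Longrightarrow> dig r i x < r"
  by (simp add: dig_def)

lemma pdft_0 [simp]: "pdft r \<omega> s f 0 e = f e"
  by (simp add: pdft_def dot_def)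

text \<open>Splitting the top digit off the summation variable shows that the next stage is a
  transform of length \<open>r\<close> along axis \<open>l\<close>. Its inputs are the entries whose
  index differs from \<open>e\<close> at most in digit \<open>l\<close>.\<close>

lemma pdft_Suc:
  assumes r: "0 < r"
  shows "pdft r \<omega> s f (Suc l) e =
    (\<Sum>j<r. pdft r \<omega> s f l (e - dig r l e * r ^ l + j * r ^ l) * \<omega> ^ (s * (dig r l e * j)))"
proof -
  let ?q = "e div r ^ Suc l" and ?y = "e mod r ^ l"
  have "e div r ^ l div r = ?q" by (simp add: power_Suc2 div_mult2_eq del: power_Suc)
  then have qd: "?q * r + dig r l e = e div r ^ l" unfolding dig_def by (metis div_mult_mod_eq)
  have e: "e = (?q * r + dig r l e) * r ^ l + ?y" unfolding qd by (rule div_mult_mod_eq[symmetric])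
  have "(?q * r + dig r l e) * r ^ l + ?y - dig r l e * r ^ l = (?q * r) * r ^ l + ?y"
    by (simp add: distrib_right)
  then have e': "e - dig r l e * r ^ l = (?q * r) * r ^ l + ?y" using e by metis
  have y: "?y < r ^ l" using r by simp
  have j: "pdft r \<omega> s f l (e - dig r l e * r ^ l + j * r ^ l) =
      (\<Sum>x<r ^ l. f (?q * r ^ Suc l + (j * r ^ l + x)) * \<omega> ^ (s * dot r l e x))" if "j < r" for j
  proof -
    have 1: "e - dig r l e * r ^ l + j * r ^ l = (?q * r + j) * r ^ l + ?y"
      unfolding e' by (simp add: algebra_simps)
    have 2: "(e - dig r l e * r ^ l + j * r ^ l) div r ^ l = ?q * r + j"
      unfolding 1 using y r by simp
    have 3: "dot r l (e - dig r l e * r ^ l + j * r ^ l) x = dot r l e x" for x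
      unfolding dot_def 1
      by (rule sum.cong[OF refl], subst (2) e) (simp only: dig_low[OF _ r] lessThan_iff)
    show ?thesis unfolding pdft_def 2 3 by (simp add: algebra_simps)
  qed
  have d: "dot r (Suc l) e (j * r ^ l + x) = dot r l e x + dig r l e * j" if "j < r" "x < r ^ l" for j x
    unfolding dot_def using that r by (simp add: dig_low dig_top)
  have "pdft r \<omega> s f (Suc l) e =
      (\<Sum>j<r. \<Sum>x<r ^ l. f (?q * r ^ Suc l + (j * r ^ l + x)) * \<omega> ^ (s * dot r (Suc l) e (j * r ^ l + x)))"
    unfolding pdft_def by (subst power_Suc, subst sum_lessThan_mult) simp
  also have "\<dots> = (\<Sum>j<r. \<Sum>x<r ^ l. f (?q * r ^ Suc l + (j * r ^ l + x)) * \<omega> ^ (s * dot r l e x) *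
      \<omega> ^ (s * (dig r l e * j)))"
    by (intro sum.cong refl) (simp only: d lessThan_iff distrib_left power_add mult.assoc)
  also have "\<dots> = (\<Sum>j<r. pdft r \<omega> s f l (e - dig r l e * r ^ l + j * r ^ l) * \<omega> ^ (s * (dig r l e * j)))"
    by (intro sum.cong refl) (simp only: j lessThan_iff sum_distrib_right)
  finally show ?thesis .
qed

lemma sum_product3:
  fixes a b c :: "nat \<Rightarrow> nat"
  shows "sum a S * sum b S * sum c S = (\<Sum>x\<in>S. \<Sum>y\<in>S. \<Sum>z\<in>S. a x * b y * c z)"
proof -
  have "sum a S * sum b S * C = (\<Sum>x\<in>S. \<Sum>y\<in>S. a x * b y * C)" for C
    by (subst sum_product) (simp only: sum_distrib_right)
  then have "sum a S * sum b S * sum c S = (\<Sum>x\<in>S. \<Sum>y\<in>S. a x * b y * sum c S)" .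
  also have "\<dots> = (\<Sum>x\<in>S. \<Sum>y\<in>S. \<Sum>z\<in>S. a x * b y * c z)" by (simp only: sum_distrib_left)
  finally show ?thesis .
qed

text \<open>A character sum over a product of groups is the product of the sums over the
  factors.\<close>

lemma sum_power_dig:
  fixes \<omega> :: nat
  assumes r: "0 < r"
  shows "(\<Sum>x<r ^ K. \<omega> ^ (\<Sum>i<K. dig r i x * s i)) = (\<Prod>i<K. \<Sum>c<r. \<omega> ^ (c * s i))"
proof (induction K)
  case (Suc K)
  have "(\<Sum>x<r ^ Suc K. \<omega> ^ (\<Sum>i<Suc K. dig r i x * s i)) =
      (\<Sum>c<r. \<Sum>y<r ^ K. \<omega> ^ (\<Sum>i<Suc K. dig r i (c * r ^ K + y) * s i))"
    by (subst power_Suc, subst sum_lessThan_mult) simp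
  also have "\<dots> = (\<Sum>c<r. \<Sum>y<r ^ K. \<omega> ^ (\<Sum>i<K. dig r i y * s i) * \<omega> ^ (c * s K))"
    using r by (intro sum.cong refl) (simp add: dig_low dig_top power_add)
  also have "\<dots> = (\<Sum>y<r ^ K. \<omega> ^ (\<Sum>i<K. dig r i y * s i)) * (\<Sum>c<r. \<omega> ^ (c * s K))"
    by (simp add: sum_product sum.swap[of _ "{..<r}"])
  finally show ?case using Suc by simp
qed simp

text \<open>Each exponent below \<open>2 ^ d\<close> has a unique binary expansion. The
  factorization exhibits divisors of a geometric sum where division by \<open>x - 1\<close> is
  impossible.\<close>

lemma sum_power_two_factor: "(\<Sum>j<2 ^ d. (x::nat) ^ j) = (\<Prod>l<d. 1 + x ^ (2 ^ l))"
proof (induction d)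
  case (Suc d)
  have "(\<Sum>j<2 ^ Suc d. x ^ j) = (\<Sum>c<2. \<Sum>y<2 ^ d. x ^ (c * 2 ^ d + y))"
    by (subst power_Suc, subst sum_lessThan_mult) simp
  also have "\<dots> = (\<Sum>y<2 ^ d. x ^ y) * (1 + x ^ (2 ^ d))"
  proof -
    have "(\<Sum>c<2. h c) = h 0 + h (1::nat)" for h :: "nat \<Rightarrow> nat" by (simp add: eval_nat_numeral)
    then show ?thesis by (simp add: power_add mult.commute[of "x ^ 2 ^ d"] sum_distrib_right[symmetric] distrib_left)
  qed
  finally show ?case using Suc by simp
qed simp

lemma Suc_dvd_odd_power: "odd k \<Longrightarrow> (a::nat) + 1 dvd a ^ k + 1"
proof -
  assume "odd k"
  have "a + 1 dvd a ^ (2 * m + 1) + 1" if "0 < a" for m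
  proof (induction m)
    case (Suc m)
    \<comment> \<open>Multiplication by a^2 raises the exponent by two, and the correction a^2 - 1
      is itself a multiple of a + 1. Positivity of \<open>a\<close> makes the natural subtraction
      exact.\<close>
    have "a ^ (2 * Suc m + 1) + 1 + (a + 1) * (a - 1) = a ^ 2 * (a ^ (2 * m + 1) + 1)"
      using that by (cases a) (auto simp: algebra_simps power2_eq_square)
    then show ?case using Suc by (metis dvd_add_left_iff dvd_mult dvd_triv_left)
  qed auto
  moreover have "a + 1 dvd a ^ (2 * m + 1) + 1" if "a = 0" for m using that by simp
  ultimately show ?thesis using \<open>odd k\<close> by (metis gr0I oddE)
qed

lemma two_power_odd: "0 < (n::nat) \<Longrightarrow> \<exists>v m. n = 2 ^ v * m \<and> odd m"
proof (induction n rule: less_induct)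
  case (less n)
  show ?case
  proof (cases "odd n")
    case False
    then obtain k where "n = 2 * k" by blast
    with less obtain v m where "k = 2 ^ v * m" "odd m" by (metis gr0I mult_0_right mult_2 less_add_same_cancel1)
    then show ?thesis using \<open>n = 2 * k\<close> by (intro exI[of _ "Suc v"] exI[of _ m]) auto
  next
    case True
    then show ?thesis by (intro exI[of _ 0] exI[of _ n]) simp
  qed
qed

text \<open>Modulo \<open>Q\<close> the power \<open>X ^ b\<close> is -1, so \<open>X\<close> is a
  root of unity whose \<open>r\<close>-th power is 1, where \<open>r = 2 * b\<close>.\<close>

locale root =
  fixes d X r b Q :: nat
  assumes d: "1 \<le> d" and r: "r = 2 ^ d" and b: "b = 2 ^ (d - 1)" and Q: "Q = X ^ b + 1" and X: "2 \<le> X"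
begin

lemma r2b: "r = 2 * b" using d r b by (metis Suc_pred' less_eq_Suc_le power_Suc One_nat_def)
lemma r_pos: "0 < r" using r by simp
lemma b_pos: "0 < b" using b by simp
lemma Q_gt: "2 < Q"
proof -
  have "X ^ 1 \<le> X ^ b" using X b_pos by (intro power_increasing) auto
  then show ?thesis using X Q by simp
qed

lemma X_power_r: "[X ^ r = 1] (mod Q)"
proof -
  have "X ^ r = (X ^ b - 1) * Q + 1"
    unfolding r2b Q using X by (simp add: algebra_simps power_mult mult.commute[of 2] power2_eq_square)
  then show ?thesis unfolding cong_def by (simp only: mod_mult_self3)
qed

lemma X_power_mod: "[X ^ (k mod r) = X ^ k] (mod Q)"
proof -
  have "X ^ k = (X ^ r) ^ (k div r) * X ^ (k mod r)"
    by (metis div_mult_mod_eq mult.commute power_add power_mult)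
  also have "[\<dots> = 1 ^ (k div r) * X ^ (k mod r)] (mod Q)"
    by (intro cong_mult cong_pow X_power_r cong_refl)
  finally show ?thesis by (simp add: cong_sym)
qed

text \<open>As \<open>Q\<close> may be composite, one cannot cancel \<open>X ^ s - 1\<close>. For
  \<open>s = 2 ^ v * m\<close> with \<open>m\<close> odd and \<open>v < d\<close>, one factor of the
  geometric sum is \<open>1 + (X ^ b) ^ m\<close>, which is divisible by \<open>Q\<close> since
  \<open>m\<close> is odd.\<close>

lemma orth: "[(\<Sum>c<r. X ^ (c * s)) = (if r dvd s then r else 0)] (mod Q)"
proof (cases "r dvd s")
  case True
  have "[(\<Sum>c<r. X ^ (c * s)) = (\<Sum>c<r. 1)] (mod Q)"
  proof (rule cong_sum)
    fix c
    have "c * s mod r = 0" using True by simp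
    then show "[X ^ (c * s) = 1] (mod Q)" using X_power_mod[of "c * s"] by (simp add: cong_sym)
  qed
  then show ?thesis using True by simp
next
  case False
  then have "0 < s" by (auto intro: gr0I)
  then obtain v m where vm: "s = 2 ^ v * m" "odd m" using two_power_odd by blast
  have v: "v < d"
  proof (rule ccontr)
    assume "\<not> v < d"
    then have "r dvd 2 ^ v" unfolding r by (simp add: le_imp_power_dvd)
    then show False using False vm by simp
  qed
  have "(X ^ s) ^ (2 ^ (d - 1 - v)) = (X ^ b) ^ m"
  proof -
    have "s * 2 ^ (d - 1 - v) = b * m"
      using v unfolding vm b by (simp add: power_add[symmetric] mult.commute mult.left_commute)
    then show ?thesis by (simp add: power_mult[symmetric])
  qed
  then have "Q dvd 1 + (X ^ s) ^ (2 ^ (d - 1 - v))"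
    using Suc_dvd_odd_power[OF vm(2), of "X ^ b"] unfolding Q by (simp add: add.commute)
  moreover have "d - 1 - v \<in> {..<d}" using d by auto
  ultimately have "Q dvd (\<Prod>l<d. 1 + (X ^ s) ^ (2 ^ l))" by (meson dvd_prod_eqI dvd_trans finite_lessThan dvd_prodI)
  then have "Q dvd (\<Sum>c<r. (X ^ s) ^ c)" unfolding r sum_power_two_factor .
  then show ?thesis using False by (simp add: power_mult[symmetric] mult.commute cong_0_iff)
qed

definition good :: "nat \<Rightarrow> nat \<Rightarrow> bool" where
  "good K x \<longleftrightarrow> (\<forall>i<K. dig r i x < b)"

text \<open>Digits range up to \<open>r - 1 = 2 * b - 1\<close> although the base is
  \<open>b\<close>. This redundancy is what allows the value of a sum of two good vectors to be the
  sum of their values without any carry.\<close>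

definition val :: "nat \<Rightarrow> nat \<Rightarrow> nat" where
  "val K x = (\<Sum>i<K. dig r i x * b ^ i)"

lemma dig_Suc: "dig r (Suc i) x = dig r i (x div r)"
  by (simp add: dig_def div_mult2_eq)

lemma good_add:
  assumes "good K x" "good K y" "x < r ^ K" "y < r ^ K"
  shows "x + y < r ^ K \<and> (\<forall>i<K. dig r i (x + y) = dig r i x + dig r i y)"
  using assms
proof (induction K arbitrary: x y)
  case (Suc K)
  have g: "good K (x div r)" "good K (y div r)"
    using Suc.prems(1,2) unfolding good_def by (auto simp: dig_Suc[symmetric])
  have l: "x div r < r ^ K" "y div r < r ^ K"
    using Suc.prems(3,4) by (simp_all add: less_mult_imp_div_less mult.commute)
  have "dig r 0 x < b" "dig r 0 y < b" using Suc.prems(1,2) unfolding good_def by auto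
  then have "x mod r < b" "y mod r < b" by (simp_all add: dig_def)
  then have m: "x mod r + y mod r < r" using r2b by linarith
  then have dv: "(x + y) div r = x div r + y div r" by (subst div_add1_eq) simp
  have IH: "x div r + y div r < r ^ K" "\<forall>i<K. dig r i (x div r + y div r) = dig r i (x div r) + dig r i (y div r)"
    using Suc.IH[OF g l] by auto
  have "x + y < r ^ Suc K"
    using IH(1) r_pos unfolding dv[symmetric] by (simp add: div_less_iff_less_mult mult.commute)
  moreover have "dig r i (x + y) = dig r i x + dig r i y" if "i < Suc K" for i
  proof (cases i)
    case 0
    then show ?thesis using m mod_add_eq[of x r y] by (simp add: dig_def)
  next
    case (Suc j)
    then show ?thesis using that IH(2) by (simp add: dig_Suc dv)
  qed
  ultimately show ?case by blast
qed auto

lemma dig_inject: "x < r ^ K \<Longrightarrow> y < r ^ K \<Longrightarrow> (\<forall>i<K. dig r i x = dig r i y) \<Longrightarrow> x = y"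
proof (induction K arbitrary: x y)
  case (Suc K)
  have l: "x div r < r ^ K" "y div r < r ^ K"
    using Suc.prems by (simp_all add: less_mult_imp_div_less mult.commute)
  have "\<forall>i<K. dig r i (x div r) = dig r i (y div r)" using Suc.prems(3) by (auto simp: dig_Suc[symmetric])
  from Suc.IH[OF l this] have "x div r = y div r" .
  moreover have "x mod r = y mod r" using Suc.prems(3)[rule_format, of 0] by (simp add: dig_def)
  ultimately have "x div r * r + x mod r = y div r * r + y mod r" by (simp only:)
  then show ?case by (simp only: div_mult_mod_eq)
qed simp

lemma val_add: "good K x \<Longrightarrow> good K y \<Longrightarrow> x < r ^ K \<Longrightarrow> y < r ^ K \<Longrightarrow> val K (x + y) = val K x + val K y"
  unfolding val_def sum.distrib[symmetric] using good_add[of K x y]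
  by (intro sum.cong refl) (simp add: distrib_right)

text \<open>Good vectors are the base \<open>b\<close> expansions of the numbers below
  \<open>b ^ K\<close>; the bijection is stated as an exchange of sums, the only form in which it is
  used.\<close>

lemma sum_good:
  fixes \<phi> :: "nat \<Rightarrow> nat"
  shows "(\<Sum>x<r ^ K. if good K x then \<phi> (val K x) else 0) = (\<Sum>v<b ^ K. \<phi> v)"
proof (induction K arbitrary: \<phi>)
  case 0
  then show ?case by (simp add: good_def val_def)
next
  case (Suc K)
  have g: "good (Suc K) (c * r ^ K + y) \<longleftrightarrow> c < b \<and> good K y" if "c < r" "y < r ^ K" for c y
    unfolding good_def using that r_pos by (auto simp: dig_low dig_top less_Suc_eq)
  have v: "val (Suc K) (c * r ^ K + y) = c * b ^ K + val K y" if "c < r" "y < r ^ K" for c y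
    unfolding val_def using that r_pos by (simp add: dig_low dig_top)
  have "(\<Sum>x<r ^ Suc K. if good (Suc K) x then \<phi> (val (Suc K) x) else 0) =
      (\<Sum>c<r. \<Sum>y<r ^ K. if c < b \<and> good K y then \<phi> (c * b ^ K + val K y) else 0)"
    by (subst power_Suc, subst sum_lessThan_mult) (intro sum.cong refl, simp add: g v)
  also have "\<dots> = (\<Sum>c<r. if c < b then (\<Sum>y<r ^ K. if good K y then \<phi> (c * b ^ K + val K y) else 0) else 0)"
    by (intro sum.cong refl) auto
  also have "\<dots> = (\<Sum>c<b. \<Sum>y<r ^ K. if good K y then \<phi> (c * b ^ K + val K y) else 0)"
    by (rule sum.mono_neutral_cong_right) (auto simp: r2b)
  also have "\<dots> = (\<Sum>c<b. \<Sum>v<b ^ K. \<phi> (c * b ^ K + v))"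
    by (rule sum.cong[OF refl]) (rule Suc.IH)
  also have "\<dots> = (\<Sum>v<b ^ Suc K. \<phi> v)"
    by (subst power_Suc, subst sum_lessThan_mult) simp
  finally show ?case .
qed

text \<open>Exponents are natural numbers, so \<open>r - 1\<close> takes the part of -1.\<close>

lemma dvd_digits:
  assumes "a < r" "a' < r" "c < r"
  shows "r dvd a + a' + (r - 1) * c \<longleftrightarrow> (a + a') mod r = c"
proof -
  have "[a + a' + (r - 1) * c + c = a + a'] (mod r)"
  proof -
    have "a + a' + (r - 1) * c + c = a + a' + r * c" using r_pos by (cases r) auto
    then show ?thesis unfolding cong_def by (simp only: mod_mult_self2)
  qed
  then have "[a + a' + (r - 1) * c = 0] (mod r) \<longleftrightarrow> [a + a' = 0 + c] (mod r)"
    by (metis cong_add_rcancel_nat cong_sym cong_trans)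
  then have "r dvd a + a' + (r - 1) * c \<longleftrightarrow> [a + a' = c] (mod r)" by (simp add: cong_0_iff)
  then show ?thesis using assms by (simp add: cong_def)
qed

text \<open>Orthogonality in each coordinate: summing a character of x + y - z over all frequencies
  gives \<open>r ^ K\<close> if x + y = z in (\<int>/r)^K, and 0 otherwise, modulo \<open>Q\<close>.
  Interchanging the sums leaves exactly the matching triples.\<close>

lemma dft_count:
  fixes f g :: "nat \<Rightarrow> nat"
  shows "[(\<Sum>\<chi><r ^ K. pdft r X 1 f K \<chi> * pdft r X 1 f K \<chi> * pdft r X (r - 1) g K \<chi>) =
    r ^ K * (\<Sum>x<r ^ K. \<Sum>y<r ^ K. \<Sum>z<r ^ K. if \<forall>i<K. (dig r i x + dig r i y) mod r = dig r i z
       then f x * f y * g z else 0)] (mod Q)"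
proof -
  let ?H = "r ^ K"
  let ?s = "\<lambda>x y z i. dig r i x + dig r i y + (r - 1) * dig r i z"
  have e: "dot r K \<chi> x + dot r K \<chi> y + (r - 1) * dot r K \<chi> z = (\<Sum>i<K. dig r i \<chi> * ?s x y z i)" for \<chi> x y z
    by (simp add: dot_def sum.distrib sum_distrib_left algebra_simps)
  have "(\<Sum>\<chi><?H. pdft r X 1 f K \<chi> * pdft r X 1 f K \<chi> * pdft r X (r - 1) g K \<chi>) =
      (\<Sum>\<chi><?H. \<Sum>x<?H. \<Sum>y<?H. \<Sum>z<?H. f x * f y * g z * X ^ (\<Sum>i<K. dig r i \<chi> * ?s x y z i))"
  proof (rule sum.cong[OF refl])
    fix \<chi> assume "\<chi> \<in> {..<?H}"
    then show "pdft r X 1 f K \<chi> * pdft r X 1 f K \<chi> * pdft r X (r - 1) g K \<chi> =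
      (\<Sum>x<?H. \<Sum>y<?H. \<Sum>z<?H. f x * f y * g z * X ^ (\<Sum>i<K. dig r i \<chi> * ?s x y z i))"
      unfolding e[symmetric] pdft_def sum_product3
      by (intro sum.cong refl) (simp add: power_add mult_ac)
  qed
  also have "\<dots> = (\<Sum>x<?H. \<Sum>y<?H. \<Sum>z<?H. \<Sum>\<chi><?H. f x * f y * g z * X ^ (\<Sum>i<K. dig r i \<chi> * ?s x y z i))"
    by (subst sum.swap, rule sum.cong[OF refl], subst sum.swap, rule sum.cong[OF refl], subst sum.swap) simp
  also have "\<dots> = (\<Sum>x<?H. \<Sum>y<?H. \<Sum>z<?H. f x * f y * g z * (\<Prod>i<K. \<Sum>c<r. X ^ (c * ?s x y z i)))"
    by (simp only: sum_distrib_left[symmetric] sum_power_dig[OF r_pos])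
  finally have 1: "(\<Sum>\<chi><?H. pdft r X 1 f K \<chi> * pdft r X 1 f K \<chi> * pdft r X (r - 1) g K \<chi>) =
    (\<Sum>x<?H. \<Sum>y<?H. \<Sum>z<?H. f x * f y * g z * (\<Prod>i<K. \<Sum>c<r. X ^ (c * ?s x y z i)))" .
  have 2: "[(\<Sum>x<?H. \<Sum>y<?H. \<Sum>z<?H. f x * f y * g z * (\<Prod>i<K. \<Sum>c<r. X ^ (c * ?s x y z i))) = (\<Sum>x<?H. \<Sum>y<?H. \<Sum>z<?H. f x * f y * g z * (\<Prod>i<K. if r dvd ?s x y z i then r else 0))] (mod Q)"
    by (intro cong_sum cong_mult cong_refl cong_prod orth)
  have 3: "(\<Sum>x<?H. \<Sum>y<?H. \<Sum>z<?H. f x * f y * g z * (\<Prod>i<K. if r dvd ?s x y z i then r else 0)) =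
      (\<Sum>x<?H. \<Sum>y<?H. \<Sum>z<?H. ?H * (if \<forall>i<K. (dig r i x + dig r i y) mod r = dig r i z
       then f x * f y * g z else 0))"
  proof (intro sum.cong refl)
    fix x y z
    have d: "r dvd ?s x y z i \<longleftrightarrow> (dig r i x + dig r i y) mod r = dig r i z" for i
      by (rule dvd_digits) (simp_all add: dig_less r_pos)
    have "(\<Prod>i<K. if r dvd ?s x y z i then r else 0) =
        (if \<forall>i<K. (dig r i x + dig r i y) mod r = dig r i z then ?H else 0)"
      unfolding d by (auto simp: prod_zero_iff)
    moreover have "t * a = h * (if P then t else 0)" if "a = (if P then h else 0)" for t a h :: nat and P
      using that by auto
    ultimately show "f x * f y * g z * (\<Prod>i<K. if r dvd ?s x y z i then r else 0) =
       ?H * (if \<forall>i<K. (dig r i x + dig r i y) mod r = dig r i z then f x * f y * g z else 0)"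
      by blast
  qed
  show ?thesis unfolding 1 using 2 unfolding 3 by (simp only: sum_distrib_left)
qed

text \<open>On good vectors the condition modulo \<open>r\<close> has the single solution z = x + y,
  and its value is the sum of the two values. So the group convolution computes an ordinary one,
  provided that \<psi> is placed on all vectors and not only on good ones.\<close>

lemma dft_conv:
  fixes \<phi> \<psi> :: "nat \<Rightarrow> nat" and K :: nat
  defines "f \<equiv> \<lambda>x. if good K x then \<phi> (val K x) else 0"
  shows "[(\<Sum>\<chi><r ^ K. pdft r X 1 f K \<chi> * pdft r X 1 f K \<chi> * pdft r X (r - 1) (\<lambda>x. \<psi> (val K x)) K \<chi>) =
    r ^ K * (\<Sum>u<b ^ K. \<Sum>v<b ^ K. \<phi> u * \<phi> v * \<psi> (u + v))] (mod Q)"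
proof -
  let ?H = "r ^ K"
  let ?c = "\<lambda>x y z. \<forall>i<K. (dig r i x + dig r i y) mod r = dig r i z"
  have "(\<Sum>x<?H. \<Sum>y<?H. \<Sum>z<?H. if ?c x y z then f x * f y * \<psi> (val K z) else 0) =
     (\<Sum>x<?H. \<Sum>y<?H. if good K x then (if good K y then \<phi> (val K x) * \<phi> (val K y) * \<psi> (val K x + val K y) else 0) else 0)"
  proof (intro sum.cong refl)
    fix x y assume xy: "x \<in> {..<?H}" "y \<in> {..<?H}"
    show "(\<Sum>z<?H. if ?c x y z then f x * f y * \<psi> (val K z) else 0) =
      (if good K x then (if good K y then \<phi> (val K x) * \<phi> (val K y) * \<psi> (val K x + val K y) else 0) else 0)"
    proof (cases "good K x \<and> good K y")
      case True
      note ga = good_add[of K x y]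
      have m: "(dig r i x + dig r i y) mod r = dig r i (x + y)" if "i < K" for i
        using ga True xy that by (metis dig_less lessThan_iff mod_less r_pos)
      have "?c x y z \<longleftrightarrow> z = x + y" if "z < ?H" for z
        using m dig_inject[of "x + y" K z] ga True xy that by (metis lessThan_iff)
      then have "(\<Sum>z<?H. if ?c x y z then f x * f y * \<psi> (val K z) else 0) =
          (\<Sum>z<?H. if z = x + y then f x * f y * \<psi> (val K z) else 0)"
        by (intro sum.cong refl) auto
      also have "\<dots> = f x * f y * \<psi> (val K (x + y))" using ga True xy by simp
      finally show ?thesis using True xy val_add[of K x y] by (simp add: f_def)
    next
      case False
      then have "f x * f y = 0" by (auto simp: f_def)
      then show ?thesis using False by auto
    qed
  qed
  also have "\<dots> = (\<Sum>x<?H. if good K x then (\<Sum>v<b ^ K. \<phi> (val K x) * \<phi> v * \<psi> (val K x + v)) else 0)"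
  proof (intro sum.cong refl)
    fix x
    show "(\<Sum>y<?H. if good K x then (if good K y then \<phi> (val K x) * \<phi> (val K y) * \<psi> (val K x + val K y) else 0) else 0) =
      (if good K x then (\<Sum>v<b ^ K. \<phi> (val K x) * \<phi> v * \<psi> (val K x + v)) else 0)"
      using sum_good[where K = K and \<phi> = "\<lambda>v. \<phi> (val K x) * \<phi> v * \<psi> (val K x + v)"] by simp
  qed
  also have "\<dots> = (\<Sum>u<b ^ K. \<Sum>v<b ^ K. \<phi> u * \<phi> v * \<psi> (u + v))"
    using sum_good[where K = K and \<phi> = "\<lambda>u. \<Sum>v<b ^ K. \<phi> u * \<phi> v * \<psi> (u + v)"] .
  finally show ?thesis using dft_count[where K = K and f = f and g = "\<lambda>x. \<psi> (val K x)"] by simp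
qed

end

section \<open>Divisors and false solutions\<close>

text \<open>Removing a prime power p^e from \<open>s\<close> divides the number of divisors by at
  most e + 1. For p at least \<open>B = 2 powr (1 / \<eta>)\<close> this is at most p^(e \<eta>);
  each of the boundedly many smaller primes costs one further factor \<open>c\<close>.\<close>

lemma divisor_bound:
  fixes \<eta> :: real
  assumes \<eta>: "0 < \<eta>"
  shows "\<exists>C\<ge>1. \<forall>s\<ge>1. real (card {d. d dvd s}) \<le> C * real s powr \<eta>"
proof -
  define B :: real where "B = 2 powr (1 / \<eta>)"
  \<comment> \<open>Chosen so that e + 1 is at most c (1 + \<eta> e ln 2), hence at most c 2^(\<eta>
    e) by the inequality 1 + x \<le> exp x.\<close>
  define c where "c = max 1 (1 / (\<eta> * ln 2))"
  have c1: "1 \<le> c" by (simp add: c_def)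
  have pe: "real p powr (\<eta> * real e) = real (p ^ e) powr \<eta>" if "p > 0" for p e :: nat
    using that by (simp add: powr_powr powr_realpow[symmetric] mult.commute)
  have small: "real e + 1 \<le> c * real (p ^ e) powr \<eta>" if "2 \<le> p" for p e :: nat
  proof -
    have "1 / (\<eta> * ln 2) \<le> c" by (simp add: c_def)
    then have "1 \<le> c * (\<eta> * ln 2)" using \<eta> by (simp add: divide_le_eq)
    then have "real e * 1 \<le> real e * (c * (\<eta> * ln 2))" by (intro mult_left_mono) auto
    then have "real e + 1 \<le> c * (1 + \<eta> * real e * ln 2)" using c1 by (simp add: algebra_simps)
    also have "\<dots> \<le> c * exp (\<eta> * real e * ln 2)"
      using c1 exp_ge_add_one_self[of "\<eta> * real e * ln 2"] by (intro mult_left_mono) auto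
    also have "exp (\<eta> * real e * ln 2) = 2 powr (\<eta> * real e)" by (simp add: powr_def)
    also have "c * 2 powr (\<eta> * real e) \<le> c * real p powr (\<eta> * real e)"
      using that \<eta> c1 by (intro mult_left_mono powr_mono2) auto
    finally show ?thesis using pe[of p e] that by simp
  qed
  have large: "real e + 1 \<le> real (p ^ e) powr \<eta>" if "2 \<le> p" "B \<le> real p" for p e :: nat
  proof -
    have "real e + 1 \<le> 2 ^ e" by (induction e) auto
    also have "\<dots> = (B powr \<eta>) ^ e" using \<eta> by (simp add: B_def powr_powr)
    also have "\<dots> \<le> (real p powr \<eta>) ^ e"
      using that \<eta> by (intro power_mono powr_mono2) (auto simp: B_def)
    also have "\<dots> = real (p ^ e) powr \<eta>"
      using that by (simp add: powr_power[symmetric] powr_realpow[symmetric] powr_powr mult.commute)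
    finally show ?thesis .
  qed
  define S where "S s = {p. prime p \<and> p dvd s \<and> real p < B}" for s :: nat
  define M where "M = nat \<lceil>B\<rceil>"
  have sub: "S s \<subseteq> {..<M}" for s by (auto simp: S_def M_def) linarith
  have fin: "finite (S s)" for s using sub finite_subset by blast
  have main: "s \<ge> 1 \<Longrightarrow> real (card {d. d dvd s}) \<le> c ^ card (S s) * real s powr \<eta>" for s
  proof (induction s rule: less_induct)
    case (less s)
    show ?case
    proof (cases "s = 1")
      case True
      then show ?thesis using c1 by (simp add: one_le_power)
    next
      case False
      then obtain p where p: "prime p" "p dvd s" using prime_factor_nat by blast
      then have p2: "2 \<le> p" using prime_ge_2_nat by blast
      define e where "e = multiplicity p s"
      obtain t where t: "s = p ^ e * t" "\<not> p dvd t"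
        using multiplicity_decompose'[of s p] less.prems p(1) unfolding e_def by (metis not_one_le_zero not_prime_unit)
      have e: "0 < e" using t p by (cases e) auto
      have t1: "1 \<le> t" using t less.prems by (cases t) auto
      have "1 < p ^ e" using e p2 by (intro one_less_power) auto
      then have ts: "t < s" using t1 t(1) by simp
      have divs: "{d. d dvd s} \<subseteq> (\<lambda>(i, u). p ^ i * u) ` ({..e} \<times> {u. u dvd t})"
      proof
        fix d assume "d \<in> {d. d dvd s}"
        then have "d dvd p ^ e * t" using t by simp
        then obtain x u where xu: "d = x * u" "x dvd p ^ e" "u dvd t" using division_decomp by blast
        then obtain i where "i \<le> e" "x = p ^ i" using divides_primepow_nat[OF p(1)] by blast
        with xu show "d \<in> (\<lambda>(i, u). p ^ i * u) ` ({..e} \<times> {u. u dvd t})" by auto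
      qed
      have ft: "finite {u. u dvd t}" using t1 by simp
      have "card {d. d dvd s} \<le> card ((\<lambda>(i, u). p ^ i * u) ` ({..e} \<times> {u. u dvd t}))"
        by (rule card_mono[OF _ divs]) (use ft in auto)
      also have "\<dots> \<le> card ({..e} \<times> {u. u dvd t})" by (rule card_image_le) (use ft in auto)
      finally have "card {d. d dvd s} \<le> (e + 1) * card {u. u dvd t}" by (simp add: card_cartesian_product)
      then have "real (card {d. d dvd s}) \<le> real ((e + 1) * card {u. u dvd t})"
        by (simp only: of_nat_le_iff)
      also have "\<dots> = (real e + 1) * real (card {u. u dvd t})"
        by (simp only: of_nat_mult of_nat_add of_nat_1)
      finally have "real (card {d. d dvd s}) \<le> (real e + 1) * real (card {u. u dvd t})" .
      also have "(real e + 1) * real (card {u. u dvd t}) \<le> (real e + 1) * (c ^ card (S t) * real t powr \<eta>)"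
        using less.IH[OF ts t1] by (intro mult_left_mono) auto
      also have "\<dots> \<le> (c ^ (card (S s) - card (S t)) * real (p ^ e) powr \<eta>) * (c ^ card (S t) * real t powr \<eta>)"
      proof (intro mult_right_mono)
        have St: "S t \<subseteq> S s" using t by (auto simp: S_def)
        show "real e + 1 \<le> c ^ (card (S s) - card (S t)) * real (p ^ e) powr \<eta>"
        \<comment> \<open>A small prime \<open>p\<close> divides \<open>s\<close> but not
          \<open>t\<close>, so the exponent of \<open>c\<close> drops by at least one, which pays
          for the constant in \<open>small\<close>.\<close>
        proof (cases "real p < B")
          case True
          then have "p \<in> S s - S t" using p t by (auto simp: S_def)
          then have "card (S t) < card (S s)" using St fin by (intro psubset_card_mono) auto
          then have "c ^ 1 \<le> c ^ (card (S s) - card (S t))" using c1 by (intro power_increasing) auto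
          then have "c * real (p ^ e) powr \<eta> \<le> c ^ (card (S s) - card (S t)) * real (p ^ e) powr \<eta>"
            by (intro mult_right_mono) auto
          then show ?thesis using small[OF p2, of e] by linarith
        next
          case False
          have "1 \<le> c ^ (card (S s) - card (S t))" using c1 by (simp add: one_le_power)
          then have "1 * real (p ^ e) powr \<eta> \<le> c ^ (card (S s) - card (S t)) * real (p ^ e) powr \<eta>"
            by (intro mult_right_mono) auto
          then show ?thesis using large[OF p2, of e] False by linarith
        qed
      qed (use c1 in auto)
      also have "\<dots> = c ^ card (S s) * real s powr \<eta>"
      proof -
        have "card (S t) \<le> card (S s)" using t fin by (intro card_mono) (auto simp: S_def)
        then have "c ^ (card (S s) - card (S t)) * c ^ card (S t) = c ^ card (S s)"
          by (simp add: power_add[symmetric])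
        moreover have "real (p ^ e) powr \<eta> * real t powr \<eta> = real s powr \<eta>"
          unfolding t(1) by (simp add: powr_mult)
        moreover have "(c ^ (card (S s) - card (S t)) * real (p ^ e) powr \<eta>) * (c ^ card (S t) * real t powr \<eta>)
            = (c ^ (card (S s) - card (S t)) * c ^ card (S t)) * (real (p ^ e) powr \<eta> * real t powr \<eta>)"
          by (simp only: mult_ac)
        ultimately show ?thesis by (simp only:)
      qed
      finally show ?thesis .
    qed
  qed
  have "real (card {d. d dvd s}) \<le> c ^ M * real s powr \<eta>" if "s \<ge> 1" for s
  proof -
    have "card (S s) \<le> M" using card_mono[OF _ sub, of s] by simp
    then have "c ^ card (S s) \<le> c ^ M" using c1 by (intro power_increasing) auto
    then show ?thesis using main[OF that] by (meson mult_right_mono order_trans powr_ge_zero)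
  qed
  then show ?thesis using c1 by (intro exI[of _ "c ^ M"]) (auto simp: one_le_power)
qed

section \<open>Congruent triples and products of factors\<close>

definition solutions :: "(nat \<Rightarrow> nat) \<Rightarrow> nat \<Rightarrow> nat \<Rightarrow> nat" where
  "solutions A n m = (\<Sum>i<n. \<Sum>j<n. \<Sum>l<n. of_bool ((A i + A j) mod m = A l mod m))"

definition false_sols :: "(nat \<Rightarrow> nat) \<Rightarrow> nat \<Rightarrow> nat \<Rightarrow> nat" where
  "false_sols A n m = (\<Sum>i<n. \<Sum>j<n. \<Sum>l<n. of_bool (A i + A j \<noteq> A l \<and> (A i + A j) mod m = A l mod m))"

definition true_sols :: "(nat \<Rightarrow> nat) \<Rightarrow> nat \<Rightarrow> nat" where
  "true_sols A n = (\<Sum>i<n. \<Sum>j<n. \<Sum>l<n. of_bool (A i + A j = A l))"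

text \<open>The second summand does not depend on the modulus. Minimizing the computable left side
  therefore minimizes the number of false solutions.\<close>

lemma solutions_split: "solutions A n m = false_sols A n m + true_sols A n"
  unfolding solutions_def false_sols_def true_sols_def sum.distrib[symmetric]
  by (intro sum.cong refl) auto

lemma solutions_le: "solutions A n m \<le> n ^ 3"
proof -
  have "solutions A n m \<le> (\<Sum>i<n. \<Sum>j<n. \<Sum>l<n. 1)"
    unfolding solutions_def by (intro sum_mono) auto
  then show ?thesis by (simp add: power3_eq_cube mult.assoc)
qed

lemma mod_eq_iff_dvd_diff: "(x::nat) mod m = y mod m \<longleftrightarrow> m dvd nat \<bar>int x - int y\<bar>"
  unfolding dvd_nat_abs_iff cong_iff_dvd_diff[symmetric] cong_int_iff by (simp add: cong_def)

text \<open>If \<open>m * e\<close> divides \<open>s\<close>, then \<open>e\<close> divides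
  \<open>s div m\<close>, a number between 1 and \<open>M\<close>. This is where the divisor bound
  enters, for arbitrary factors \<open>e\<close> and regardless of what they share with
  \<open>m\<close>.\<close>

lemma card_mult_dvd_le:
  fixes m s :: nat
  assumes "\<And>s. 1 \<le> s \<Longrightarrow> s \<le> M \<Longrightarrow> card {d. d dvd s} \<le> D" "1 \<le> s" "s \<le> M"
  shows "(\<Sum>e\<in>{1..Y}. of_bool (m * e dvd s)) \<le> D * (of_bool (m dvd s) :: nat)"
proof (cases "m dvd s")
  case True
  then obtain s' where s': "s = m * s'" by blast
  then have m: "m \<noteq> 0" "1 \<le> s'" using assms(2) by (auto intro!: Suc_leI gr0I)
  have "1 * s' \<le> m * s'" using m by (intro mult_le_mono1) auto
  then have "s' \<le> M" using s' assms(3) by linarith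
  have "(\<Sum>e\<in>{1..Y}. of_bool (m * e dvd s)) = (card {e \<in> {1..Y}. m * e dvd s} :: nat)"
    by (simp add: of_bool_def sum.If_cases Int_def)
  also have "{e \<in> {1..Y}. m * e dvd s} \<subseteq> {d. d dvd s'}" using s' m by auto
  then have "card {e \<in> {1..Y}. m * e dvd s} \<le> card {d. d dvd s'}" using m(2) by (intro card_mono) auto
  also have "\<dots> \<le> D" by (rule assms(1)) fact+
  finally show ?thesis using True by simp
next
  case False
  then have "\<not> m * e dvd s" for e using dvd_mult_left by blast
  then show ?thesis by simp
qed

lemma sum_false_sols:
  assumes D: "\<And>s. 1 \<le> s \<Longrightarrow> s \<le> M \<Longrightarrow> card {d. d dvd s} \<le> D" and A: "\<And>i. i < n \<Longrightarrow> A i + A i \<le> M"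
  shows "(\<Sum>e\<in>{1..Y}. false_sols A n (m * e)) \<le> D * false_sols A n m"
proof -
  have "(\<Sum>e\<in>{1..Y}. false_sols A n (m * e)) = (\<Sum>i<n. \<Sum>j<n. \<Sum>l<n. \<Sum>e\<in>{1..Y}.
      of_bool (A i + A j \<noteq> A l \<and> (A i + A j) mod (m * e) = A l mod (m * e)))"
    unfolding false_sols_def
    by (subst sum.swap, rule sum.cong[OF refl], subst sum.swap, rule sum.cong[OF refl], subst sum.swap) simp
  also have "\<dots> \<le> (\<Sum>i<n. \<Sum>j<n. \<Sum>l<n. D * of_bool (A i + A j \<noteq> A l \<and> (A i + A j) mod m = A l mod m))"
  proof (intro sum_mono)
    fix i j l assume ijl: "i \<in> {..<n}" "j \<in> {..<n}" "l \<in> {..<n}"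
    let ?s = "nat \<bar>int (A i + A j) - int (A l)\<bar>"
    show "(\<Sum>e\<in>{1..Y}. of_bool (A i + A j \<noteq> A l \<and> (A i + A j) mod (m * e) = A l mod (m * e)))
      \<le> D * of_bool (A i + A j \<noteq> A l \<and> (A i + A j) mod m = A l mod m)"
    proof (cases "A i + A j = A l")
      case False
      \<comment> \<open>The difference of a sum and an entry is at most twice the largest entry in
        absolute value.\<close>
      have "?s \<le> M" using A[of i] A[of j] A[of l] ijl by auto
      moreover have "1 \<le> ?s" using False by auto
      ultimately have "(\<Sum>e\<in>{1..Y}. of_bool (m * e dvd ?s)) \<le> D * (of_bool (m dvd ?s) :: nat)"
        by (intro card_mult_dvd_le[where M = M]) (auto intro: D)
      then show ?thesis using False by (simp only: mod_eq_iff_dvd_diff simp_thms)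
    qed simp
  qed
  also have "\<dots> = D * false_sols A n m" unfolding false_sols_def by (simp only: sum_distrib_left)
  finally show ?thesis .
qed

text \<open>The minimum over \<open>Y\<close> candidates is at most their average, which
  \<open>sum_false_sols\<close> bounds.\<close>

lemma argmin_false_sols:
  assumes D: "\<And>s. 1 \<le> s \<Longrightarrow> s \<le> M \<Longrightarrow> card {d. d dvd s} \<le> D" and A: "\<And>i. i < n \<Longrightarrow> A i + A i \<le> M"
    and min: "\<And>e. e \<in> {1..Y} \<Longrightarrow> solutions A n m' \<le> solutions A n (m * e)"
  shows "Y * false_sols A n m' \<le> D * false_sols A n m"
proof -
  have "Y * false_sols A n m' = (\<Sum>e\<in>{1..Y}. false_sols A n m')" by simp
  also have "\<dots> \<le> (\<Sum>e\<in>{1..Y}. false_sols A n (m * e))"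
    using min by (intro sum_mono) (simp add: solutions_split)
  also have "\<dots> \<le> D * false_sols A n m" by (rule sum_false_sols[where M = M]) (auto intro: D A)
  finally show ?thesis .
qed

definition bucket :: "(nat \<Rightarrow> nat) \<Rightarrow> nat \<Rightarrow> nat \<Rightarrow> nat \<Rightarrow> nat" where
  "bucket A n m x = (\<Sum>i<n. of_bool (A i mod m = x))"

lemma bucket_0 [simp]: "bucket A 0 m x = 0"
  by (simp add: bucket_def)

lemma bucket_Suc [simp]: "bucket A (Suc i) m x = bucket A i m x + of_bool (A i mod m = x)"
  by (simp add: bucket_def)

lemma sum_bucket:
  assumes "0 < m" "m \<le> B"
  shows "(\<Sum>u<B. bucket A n m u * \<phi> u) = (\<Sum>i<n. \<phi> (A i mod m))"
proof -
  have "(\<Sum>u<B. bucket A n m u * \<phi> u) = (\<Sum>i<n. \<Sum>u<B. of_bool (A i mod m = u) * \<phi> u)"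
    unfolding bucket_def sum_distrib_right by (rule sum.swap)
  also have "\<dots> = (\<Sum>i<n. \<phi> (A i mod m))"
  proof (rule sum.cong[OF refl])
    fix i
    have "A i mod m < B" using assms by (meson less_le_trans mod_less_divisor)
    then show "(\<Sum>u<B. of_bool (A i mod m = u) * \<phi> u) = \<phi> (A i mod m)"
      by (simp add: of_bool_def if_distrib[of "\<lambda>x. x * _"] sum.delta cong: if_cong)
  qed
  finally show ?thesis .
qed

text \<open>The reduction modulo \<open>m\<close> is hidden in the third factor, a function of u +
  v. An ordinary convolution of fixed size \<open>B\<close> thus serves every modulus up to
  \<open>B\<close>.\<close>

lemma solutions_bucket:
  assumes "0 < m" "m \<le> B"
  shows "(\<Sum>u<B. \<Sum>v<B. bucket A n m u * bucket A n m v * bucket A n m ((u + v) mod m)) = solutions A n m"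
proof -
  have "(\<Sum>u<B. \<Sum>v<B. bucket A n m u * bucket A n m v * bucket A n m ((u + v) mod m)) =
     (\<Sum>u<B. bucket A n m u * (\<Sum>v<B. bucket A n m v * bucket A n m ((u + v) mod m)))"
    by (simp add: sum_distrib_left mult.assoc)
  also have "\<dots> = (\<Sum>i<n. \<Sum>j<n. bucket A n m ((A i + A j) mod m))"
    by (simp add: sum_bucket[OF assms] mod_add_eq)
  also have "\<dots> = solutions A n m"
    unfolding solutions_def bucket_def by (intro sum.cong refl) auto
  finally show ?thesis .
qed

section \<open>Counting solutions modulo a number\<close>

definition hist :: com where
  "hist = For 20 (V 14) (Write 3 (V 20) (N 0)) ;;
     For 20 (V 1) (Assign 21 (Bin Mod (Arr 0 (V 20)) (V 13)) ;;
       Write 3 (V 21) (Bin Add (Arr 3 (V 21)) (N 1)))"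

text \<open>
  The transforms run over codes of vectors in \<open>{0..<r}\<^sup>K\<close>. Array 5 at such a vector is the bucket of
  its value in base \<open>b\<close>, and array 4 is restricted to vectors of digits below \<open>b\<close>. Since \<open>b\<close> is half of
  \<open>r\<close>, two of the latter can be added without carries and without wrap-around.
\<close>

definition digits :: "nat \<Rightarrow> nat \<Rightarrow> com" where
  "digits r b = For 27 (V 8)
      (Assign 28 (Bin Mod (V 25) (N r)) ;;
       If (Bin Less (V 28) (N b)) Skip (Assign 26 (N 0)) ;;
       Assign 23 (Bin Add (V 23) (Bin Mul (V 28) (V 24))) ;;
       Assign 24 (Bin Mul (V 24) (N b)) ;;
       Assign 25 (Bin Div (V 25) (N r)))"

definition embed :: "nat \<Rightarrow> nat \<Rightarrow> com" where
  "embed r b = For 22 (V 7)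
     (Assign 23 (N 0) ;; Assign 24 (N 1) ;; Assign 25 (V 22) ;; Assign 26 (N 1) ;;
      digits r b ;;
      Write 4 (V 22) (Bin Mul (V 26) (Arr 3 (V 23))) ;;
      Write 5 (V 22) (Arr 3 (Bin Mod (V 23) (V 13))))"

definition butterfly :: "nat \<Rightarrow> nat \<Rightarrow> nat \<Rightarrow> com" where
  "butterfly r a s = For 36 (N r)
     (Assign 35 (Bin Mod (Bin Add (V 35)
        (Bin Mul (Arr a (Bin Add (V 34) (Bin Mul (V 36) (V 30))))
          (Arr 7 (Bin Mod (Bin Mul (N s) (Bin Mul (V 33) (V 36))) (N r))))) (V 9)))"

text \<open>The result goes to array 6, because each input is still needed for \<open>r\<close>
  outputs; \<open>dft\<close> copies it back. Variable 30 holds the stride \<open>r ^ l\<close> of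
  the current axis.\<close>

definition axis :: "nat \<Rightarrow> nat \<Rightarrow> nat \<Rightarrow> com" where
  "axis r a s = For 32 (V 7)
     (Assign 33 (Bin Mod (Bin Div (V 32) (V 30)) (N r)) ;;
      Assign 34 (Bin Sub (V 32) (Bin Mul (V 33) (V 30))) ;;
      Assign 35 (N 0) ;; butterfly r a s ;; Write 6 (V 32) (V 35))"

definition dft :: "nat \<Rightarrow> nat \<Rightarrow> nat \<Rightarrow> com" where
  "dft r a s = Assign 30 (N 1) ;;
     For 31 (V 8) (axis r a s ;; For 32 (V 7) (Write a (V 32) (Arr 6 (V 32))) ;;
       Assign 30 (Bin Mul (V 30) (N r)))"

definition sumup :: com where
  "sumup = Assign 35 (N 0) ;;
     For 32 (V 7) (Assign 35 (Bin Mod (Bin Add (V 35)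
       (Bin Mul (Bin Mod (Bin Mul (Arr 4 (V 32)) (Arr 4 (V 32))) (V 9)) (Arr 5 (V 32)))) (V 9)))"

definition count :: "nat \<Rightarrow> nat \<Rightarrow> com" where
  "count r b = hist ;; embed r b ;; dft r 4 1 ;; dft r 5 (r - 1) ;; sumup"

text \<open>\<open>NN = b ^ K\<close> is the largest modulus and \<open>H = r ^ K\<close> the size
  of the transform. By \<open>H * n ^ 3 < Q\<close> the multiple H of the count is below
  \<open>Q\<close>, so it is its own residue and no inverse of \<open>H\<close> modulo
  \<open>Q\<close> is called for.\<close>

locale prog = ram w Z wd + root d X r b Q for w Z wd d X r b Q :: nat +
  fixes n :: nat and A :: "nat \<Rightarrow> nat" and Y K NN H :: nat
  assumes n1: "1 \<le> n" and nX: "n < X" and AZ: "\<And>i. i < n \<Longrightarrow> 4 * A i < Z"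
    and two_le_b: "2 \<le> b" and Y1: "1 \<le> Y" and NN: "NN = b ^ K" and H: "H = r ^ K"
    and HZ: "8 * H + 8 * NN + 8 * n + 8 * X + 8 * (r * r * r) < Z" and QZ: "4 * (Q * Q) < Z" and HQ: "H * n ^ 3 < Q"
begin

definition base :: "hstate \<Rightarrow> bool" where
  "base h \<longleftrightarrow> vars h 0 = Z \<and> vars h 1 = n \<and> vars h 5 = Y \<and> vars h 6 = 2 * NN \<and> vars h 7 = H \<and>
     vars h 8 = K \<and> vars h 9 = Q \<and> vars h 14 = NN \<and> (\<forall>i<n. arr h 0 i = A i) \<and>
     (\<forall>t<r. arr h 7 t = X ^ t mod Q)"

lemma base_frame:
  assumes "base h" "frame c h h'" "modv c \<inter> {0, 1, 5, 6, 7, 8, 9, 14} = {}" "moda c \<inter> {0, 7} = {}"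
  shows "base h'"
proof -
  have "v \<notin> modv c" if "v \<in> {0, 1, 5, 6, 7, 8, 9, 14}" for v using assms(3) that by blast
  moreover have "j \<notin> moda c" if "j \<in> {0, 7}" for j using assms(4) that by blast
  ultimately show ?thesis using assms(1,2) by (simp add: base_def frame_def)
qed

lemma baseD:
  assumes "base h"
  shows "vars h 0 = Z" "vars h (Suc 0) = n" "vars h 5 = Y" "vars h 6 = 2 * NN" "vars h 7 = H"
    "vars h 8 = K" "vars h 9 = Q" "vars h 14 = NN"
    "i < n \<Longrightarrow> arr h 0 i = A i" "t < r \<Longrightarrow> arr h 7 t = X ^ t mod Q"
  using assms by (auto simp: base_def)

lemma Zw: "x < Z \<Longrightarrow> x < 2 ^ w" using Z by linarith

lemma bounds:
  shows "1 < Z" "n < Z" "H < Z" "NN < Z" "K < Z" "Q < Z" "r < Z" "b < Z" "K < NN" "0 < NN" "0 < H" "2 * NN < Z"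
    "3 * NN < Z" "r * r * r < Z" "(1::nat) < 2 ^ w"
proof -
  define t where "t = r * r * r"
  have "8 * H + 8 * NN + 8 * n + 8 * X + 8 * t < Z" using HZ by (simp add: t_def)
  then show "1 < Z" "n < Z" "H < Z" "NN < Z" "2 * NN < Z" "3 * NN < Z" and tZ: "r * r * r < Z"
    unfolding t_def[symmetric] using n1 by - linarith+
  show "(1::nat) < 2 ^ w" using Zw[OF \<open>1 < Z\<close>] .
  have "1 * Q \<le> Q * Q" using Q_gt by (intro mult_le_mono1) auto
  then show "Q < Z" using QZ by linarith
  have "1 * r \<le> (r * r) * r" using r_pos by (intro mult_le_mono1) auto
  then show "r < Z" using tZ by linarith
  then show "b < Z" using r2b by linarith
  have "K < 2 ^ K" by (rule less_exp)
  also have "\<dots> \<le> b ^ K" using two_le_b by (intro power_mono) auto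
  finally show "K < NN" by (simp add: NN)
  then show "K < Z" "0 < NN" using \<open>NN < Z\<close> by - linarith+
  show "0 < H" using r_pos by (simp add: H)
qed

lemma index_less:
  "x < n \<Longrightarrow> x < Z" "x < NN \<Longrightarrow> x < Z" "x < H \<Longrightarrow> x < Z" "x < n \<Longrightarrow> x < 2 ^ w" "x < NN \<Longrightarrow> x < 2 ^ w" "x < H \<Longrightarrow> x < 2 ^ w"
  "x < Q \<Longrightarrow> x < 2 ^ w"
  using bounds(2-4,6) Zw by (meson less_trans)+

lemmas zw = bounds bounds(1-8,12-14)[THEN Zw] bounds(15)[simplified] index_less

lemma hist_spec:
  assumes h: "base h" "vars h 13 = m" and m: "1 \<le> m" "m \<le> NN"
  shows "wp hist (\<lambda>h'. (\<forall>x. x < NN \<longrightarrow> arr h' 3 x = bucket A n m x) \<and>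
    clk h' \<le> clk h + (NN * 18 + n * 33 + 16)) h"
  unfolding hist_def
proof (rule wp_Seq, rule wp_For[where n = NN and t = "\<lambda>_. 6" and J = "\<lambda>i h. \<forall>x<i. arr h 3 x = 0"])
  fix i h' assume i: "i < NN" "\<forall>x<i. arr h' 3 x = 0" "frame (For 20 (V 14) (Write 3 (V 20) (N 0))) h h'" "vars h' 20 = i"
  have b: "base h'" using base_frame[OF h(1) i(3)] by simp
  show "wp (Write 3 (V 20) (N 0)) (\<lambda>h''. (\<forall>x<Suc i. arr h'' 3 x = 0) \<and> clk h'' \<le> clk h' + 6) h'"
    by (rule wp_Write) (use i in \<open>simp_all add: baseD[OF b] less_Suc_eq zw less_trans[of i NN]\<close>)
next
  fix h1 assume h1: "\<forall>x<NN. arr h1 3 x = 0" "frame (For 20 (V 14) (Write 3 (V 20) (N 0))) h h1"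
    "clk h1 \<le> clk h + (\<Sum>i<NN. 6 + 12) + 8"
  have b1: "base h1" using base_frame[OF h(1) h1(2)] by simp
  have v: "vars h1 13 = m" using h1(2) h(2) by (simp add: frame_def)
  let ?c = "Assign 21 (Bin Mod (Arr 0 (V 20)) (V 13)) ;; Write 3 (V 21) (Bin Add (Arr 3 (V 21)) (N 1))"
  show "wp (For 20 (V 1) ?c) (\<lambda>h'. (\<forall>x. x < NN \<longrightarrow> arr h' 3 x = bucket A n m x) \<and>
      clk h' \<le> clk h + (NN * 18 + n * 33 + 16)) h1"
  proof (rule wp_For[where n = n and t = "\<lambda>_. 20" and J = "\<lambda>i h. \<forall>x<NN. arr h 3 x = bucket A i m x"])
    fix i h' assume i: "i < n" "\<forall>x<NN. arr h' 3 x = bucket A i m x" "frame (For 20 (V 1) ?c) h1 h'" "vars h' 20 = i"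
    have b: "base h'" using base_frame[OF b1 i(3)] by simp
    have v': "vars h' 13 = m" using i(3) v by (simp add: frame_def)
    have mN: "A i mod m < NN" using m by (meson less_le_trans mod_less_divisor zero_less_one)
    have bi: "bucket A i m x \<le> i" for x unfolding bucket_def
      using sum_mono[of "{..<i}" "\<lambda>i. of_bool (A i mod m = x)" "\<lambda>_. 1::nat"] by simp
    have "Suc (bucket A i m x) < 2 ^ w" for x using bi[of x] i(1) bounds(2)[THEN Zw] by linarith
    then show "wp ?c (\<lambda>h''. (\<forall>x<NN. arr h'' 3 x = bucket A (Suc i) m x) \<and> clk h'' \<le> clk h' + 20) h'"
      by (intro wp_Seq wp_Assign wp_Write)
        (simp_all add: baseD[OF b] i v' mN less_trans[OF mN] zw)
  next
    fix h' assume "\<forall>x<NN. arr h' 3 x = bucket A n m x" "clk h' \<le> clk h1 + (\<Sum>i<n. 20 + 12) + 8"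
    then show "(\<forall>x<NN. arr h' 3 x = bucket A n m x) \<and> clk h' \<le> clk h + (NN * 18 + n * 33 + 16)"
      using h1(3) by simp
  qed (simp_all add: baseD[OF b1] h1(1) zw)
qed (simp_all add: baseD[OF h(1)] zw)

lemma digits_spec:
  assumes h: "base h" and v: "vars h 23 = 0" "vars h 24 = 1" "vars h 25 = e" "vars h 26 = 1"
  shows "wp (digits r b) (\<lambda>h'. vars h' 23 = val K e \<and> vars h' 26 = of_bool (good K e) \<and> val K e \<le> 3 * NN \<and>
    clk h' \<le> clk h + (K * 50 + 8)) h"
proof -
  let ?J = "\<lambda>l h. vars h 23 = val l e \<and> vars h 24 = b ^ l \<and> vars h 25 = e div r ^ l \<and>
     vars h 26 = of_bool (good l e) \<and> val l e \<le> 3 * b ^ l"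
  let ?c = "Assign 28 (Bin Mod (V 25) (N r)) ;; If (Bin Less (V 28) (N b)) Skip (Assign 26 (N 0)) ;;
       Assign 23 (Bin Add (V 23) (Bin Mul (V 28) (V 24))) ;; Assign 24 (Bin Mul (V 24) (N b)) ;;
       Assign 25 (Bin Div (V 25) (N r))"
  show ?thesis unfolding digits_def
  proof (rule wp_For[where n = K and t = "\<lambda>_. 38" and J = ?J])
    fix l h' assume l: "l < K" "?J l h'" "frame (For 27 (V 8) ?c) h h'" "vars h' 27 = l"
    have b: "base h'" using base_frame[OF h l(3)] by simp
    let ?dg = "e div r ^ l mod r"
    have dg: "?dg < r" using r_pos by simp
    have pl: "b * b ^ l \<le> NN" unfolding NN using l(1) two_le_b by (metis Suc_leI b_pos power_Suc power_increasing One_nat_def)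
    have p0: "?dg * b ^ l \<le> (2 * b - 1) * b ^ l" using dg r2b by (intro mult_le_mono1) auto
    \<comment> \<open>Digits may reach \<open>2 * b - 1\<close>, so the value can exceed
      \<open>b ^ l\<close>. The bound \<open>3 * b ^ l\<close> is preserved because 2b - 1 + 3 \<le>
      3b for b \<ge> 2.\<close>
    have eq: "2 * b - 1 + 3 = 2 * b + 2" using two_le_b by simp
    have "(2 * b - 1) * b ^ l + 3 * b ^ l = (2 * b + 2) * b ^ l"
      unfolding eq[symmetric] by (rule add_mult_distrib[symmetric])
    also have "\<dots> \<le> (3 * b) * b ^ l" using two_le_b by (intro mult_le_mono1) auto
    finally have p1: "?dg * b ^ l + 3 * b ^ l \<le> 3 * (b * b ^ l)" using p0 by (auto simp only: mult.assoc)
    have vl: "val (Suc l) e = val l e + ?dg * b ^ l" by (simp add: val_def dig_def)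
    have gl: "good (Suc l) e \<longleftrightarrow> good l e \<and> ?dg < b" by (auto simp: good_def dig_def less_Suc_eq)
    have dv: "e div (r * r ^ l) = e div r ^ l div r" by (simp only: mult.commute[of r] div_mult2_eq)
    have o: "val l e + ?dg * b ^ l < 2 ^ w" "?dg * b ^ l < 2 ^ w" "b ^ l * b < 2 ^ w" "r < 2 ^ w" "b < 2 ^ w"
      "val (Suc l) e \<le> 3 * (b * b ^ l)"
      using l(2) p1 pl zw vl by (auto simp: mult.commute)
    show "wp ?c (\<lambda>h''. ?J (Suc l) h'' \<and> clk h'' \<le> clk h' + 38) h'"
      using l(2) o(1-3,6) 
      apply (intro wp_Seq wp_Assign wp_If wp_Skip)
      apply (simp_all add: baseD[OF b] zw vl gl dv mult.commute)
      done
  qed (use v in \<open>simp_all add: baseD[OF h] zw NN[symmetric] val_def good_def\<close>)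
qed


lemma mod_digits [simp]: "modv (digits r b) = {23, 24, 25, 26, 27, 28}" "moda (digits r b) = {}"
  by (auto simp: digits_def)

lemma base_cong:
  "base h \<Longrightarrow> (\<forall>v\<in>{0, 1, 5, 6, 7, 8, 9, 14}. vars h' v = vars h v) \<Longrightarrow> arr h' 0 = arr h 0 \<Longrightarrow>
    arr h' 7 = arr h 7 \<Longrightarrow> base h'"
  by (simp add: base_def)

lemma val_less: "good K e \<Longrightarrow> val K e < b ^ K"
proof (induction K)
  case (Suc K)
  then have "good K e" "dig r K e < b" by (auto simp: good_def)
  then have "val K e + dig r K e * b ^ K < b ^ K + (b - 1) * b ^ K"
    using Suc.IH by (intro add_less_le_mono mult_le_mono1) auto
  also have "\<dots> = b ^ Suc K" using b_pos by (cases b) auto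
  finally show ?case by (simp add: val_def)
qed (simp add: val_def)

lemma embed_spec:
  assumes h: "base h" "vars h 13 = m" "\<forall>x. x < NN \<longrightarrow> arr h 3 x = bucket A n m x" and m: "1 \<le> m" "m \<le> NN"
  shows "wp (embed r b) (\<lambda>h'. (\<forall>e. e < H \<longrightarrow>
      arr h' 4 e = (if good K e then bucket A n m (val K e) else 0) \<and>
      arr h' 5 e = bucket A n m (val K e mod m)) \<and>
    clk h' \<le> clk h + (H * (K * 50 + 100) + 8)) h"
proof -
  let ?c = "Assign 23 (N 0) ;; Assign 24 (N 1) ;; Assign 25 (V 22) ;; Assign 26 (N 1) ;;
      digits r b ;; Write 4 (V 22) (Bin Mul (V 26) (Arr 3 (V 23))) ;;
      Write 5 (V 22) (Arr 3 (Bin Mod (V 23) (V 13)))"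
  let ?J = "\<lambda>i h. \<forall>e<i. arr h 4 e = (if good K e then bucket A n m (val K e) else 0) \<and>
      arr h 5 e = bucket A n m (val K e mod m)"
  show ?thesis unfolding embed_def
  proof (rule wp_For[where n = H and t = "\<lambda>_. K * 50 + 80" and J = ?J])
    fix e h1 assume e: "e < H" "?J e h1" "frame (For 22 (V 7) ?c) h h1" "vars h1 22 = e"
    have b1: "base h1" using base_frame[OF h(1) e(3)] by simp
    have v1: "vars h1 13 = m" "arr h1 3 = arr h 3" using e(3) h(2) by (simp_all add: frame_def)
    define h2 where "h2 = h1\<lparr>vars := (vars h1)(23 := 0, 24 := 1, 25 := e, 26 := 1), clk := clk h1 + 8\<rparr>"
    have b2: "base h2" by (rule base_cong[OF b1]) (simp_all add: h2_def)
    have d: "wp (digits r b) (\<lambda>h'. vars h' 23 = val K e \<and> vars h' 26 = of_bool (good K e) \<and> val K e \<le> 3 * NN \<and>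
      clk h' \<le> clk h2 + (K * 50 + 8)) h2" by (rule digits_spec[OF b2]) (simp_all add: h2_def)
    have w: "wp (digits r b ;; Write 4 (V 22) (Bin Mul (V 26) (Arr 3 (V 23))) ;;
      Write 5 (V 22) (Arr 3 (Bin Mod (V 23) (V 13)))) (\<lambda>h'. ?J (Suc e) h' \<and> clk h' \<le> clk h1 + (K * 50 + 80)) h2"
    proof (rule wp_Seq, rule wp_mono[OF d], elim conjE)
      fix h3 assume h3: "frame (digits r b) h2 h3" "vars h3 23 = val K e" "vars h3 26 = of_bool (good K e)"
        "val K e \<le> 3 * NN" "clk h3 \<le> clk h2 + (K * 50 + 8)"
      have b3: "base h3" using base_frame[OF b2 h3(1)] by simp
      have v3: "vars h3 13 = m" "vars h3 22 = e" "arr h3 = arr h1"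
        using h3(1) v1 e(4) by (auto simp: frame_def h2_def)
      have vm: "val K e mod m < NN" using m by (meson less_le_trans mod_less_divisor zero_less_one)
      \<comment> \<open>For a vector that is not good the cell may lie beyond the buckets. Its
        address is still admissible, and the factor 0 in variable 26 discards what is read
        there.\<close>
      have vZ: "val K e < Z" using h3(4) zw(13) by linarith
      have bn: "bucket A n m x \<le> n" for x unfolding bucket_def
        using sum_mono[of "{..<n}" "\<lambda>i. of_bool (A i mod m = x)" "\<lambda>_. 1::nat"] by simp
      have g: "arr h 3 (val K e) = bucket A n m (val K e) \<and> bucket A n m (val K e) < 2 ^ w" if "good K e"
        using h(3) val_less[OF that] bn[of "val K e"] zw(17) by (simp add: NN)
      show "wp (Write 4 (V 22) (Bin Mul (V 26) (Arr 3 (V 23))) ;;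
        Write 5 (V 22) (Arr 3 (Bin Mod (V 23) (V 13)))) (\<lambda>h'. ?J (Suc e) h' \<and> clk h' \<le> clk h1 + (K * 50 + 80)) h3"
        using e(2) g h3(5)
        by (intro wp_Seq wp_Write)
          (simp_all add: baseD[OF b3] v3 v1 h3(2,3) vm vZ h(3) e(1) zw less_Suc_eq h2_def)
    qed
    show "wp ?c (\<lambda>h'. ?J (Suc e) h' \<and> clk h' \<le> clk h1 + (K * 50 + 80)) h1"
      by ((rule wp_Seq, rule wp_Assign, simp add: zw)+, rule wp_eq[OF w], rule hstate.equality)
        (simp_all add: h2_def e(4))
  next
    fix h' assume "?J H h'" "clk h' \<le> clk h + (\<Sum>i<H. K * 50 + 80 + 12) + 8"
    then show "(\<forall>e. e < H \<longrightarrow>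
      arr h' 4 e = (if good K e then bucket A n m (val K e) else 0) \<and>
      arr h' 5 e = bucket A n m (val K e mod m)) \<and>
      clk h' \<le> clk h + (H * (K * 50 + 100) + 8)" by (simp add: algebra_simps)
  qed (simp_all add: baseD[OF h(1)] zw)
qed

lemma butterfly_spec:
  assumes h: "base h" "vars h 35 = 0" "vars h 33 < r" and a: "a < 40" and s: "s < r"
    and idx: "\<And>j. j < r \<Longrightarrow> vars h 34 + j * vars h 30 < H"
    and g: "\<And>j. j < r \<Longrightarrow> arr h a (vars h 34 + j * vars h 30) = g j mod Q"
  shows "wp (butterfly r a s) (\<lambda>h'. vars h' 35 = (\<Sum>j<r. g j * X ^ (s * (vars h 33 * j))) mod Q \<and>
    clk h' \<le> clk h + (r * 60 + 8)) h"
proof -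
  let ?c = "Assign 35 (Bin Mod (Bin Add (V 35)
        (Bin Mul (Arr a (Bin Add (V 34) (Bin Mul (V 36) (V 30))))
          (Arr 7 (Bin Mod (Bin Mul (N s) (Bin Mul (V 33) (V 36))) (N r))))) (V 9))"
  let ?S = "\<lambda>i. \<Sum>j<i. g j * X ^ (s * (vars h 33 * j))"
  show ?thesis unfolding butterfly_def
  proof (rule wp_For[where n = r and t = "\<lambda>_. 40" and J = "\<lambda>i h'. vars h' 35 = ?S i mod Q"])
    fix j h1 assume j: "j < r" "vars h1 35 = ?S j mod Q" "frame (For 36 (N r) ?c) h h1" "vars h1 36 = j"
    have b1: "base h1" using base_frame[OF h(1) j(3)] by simp
    have v1: "vars h1 33 = vars h 33" "vars h1 34 = vars h 34" "vars h1 30 = vars h 30" "arr h1 = arr h"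
      using j(3) by (auto simp: frame_def)
    have p: "vars h 33 * j \<le> r * r" using h(3) j(1) by (intro mult_le_mono) auto
    have p2: "s * (vars h 33 * j) \<le> r * (r * r)" by (rule mult_le_mono[OF less_imp_le[OF s] p])
    have p3: "r * r \<le> r * (r * r)" using r_pos by simp
    have p4: "r * (r * r) < Z" using zw(14) by (simp add: mult.assoc)
    have o1: "vars h 33 * j < 2 ^ w" "s * (vars h 33 * j) < 2 ^ w"
      using p p2 p3 p4 by - (rule Zw, linarith)+
    let ?t = "s * (vars h 33 * j) mod r"
    have tr: "?t < r" "?t < Z" using r_pos zw(7) by (auto intro: less_trans[of _ r])
    have QQ: "0 < Q" "x mod Q < Q" for x using Q_gt by auto
    have "(g j mod Q) * (X ^ ?t mod Q) \<le> Q * Q" by (intro mult_le_mono less_imp_le QQ)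
    moreover have "?S j mod Q \<le> Q * Q" using QQ(2)[of "?S j"] QQ(1) by (meson le_square less_imp_le order_trans)
    ultimately have o2: "(g j mod Q) * (X ^ ?t mod Q) < 2 ^ w" "?S j mod Q + (g j mod Q) * (X ^ ?t mod Q) < 2 ^ w"
      using QZ QQ(1) by (auto intro!: Zw)
    have o3: "j * vars h 30 < 2 ^ w" "vars h 34 + j * vars h 30 < 2 ^ w" "vars h 34 + j * vars h 30 < Z"
      using idx[OF j(1)] zw(3) by (auto intro!: Zw)
    \<comment> \<open>The table holds only \<open>r\<close> powers; reducing the exponent modulo
      \<open>r\<close> is harmless since \<open>X ^ r\<close> is 1 modulo \<open>Q\<close>.\<close>
    have X: "X ^ ?t mod Q = X ^ (s * (vars h 33 * j)) mod Q" using X_power_mod by (simp add: cong_def)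
    have e: "(?S j mod Q + (g j mod Q) * (X ^ ?t mod Q)) mod Q = ?S (Suc j) mod Q"
    proof -
      have "[?S j mod Q + (g j mod Q) * (X ^ (s * (vars h 33 * j)) mod Q) = ?S (Suc j)] (mod Q)"
        unfolding sum.lessThan_Suc by (intro cong_add cong_mult) (simp_all add: cong_def)
      then show ?thesis unfolding X by (simp only: cong_def)
    qed
    show "wp ?c (\<lambda>h'. vars h' 35 = ?S (Suc j) mod Q \<and> clk h' \<le> clk h1 + 40) h1"
      using e o1 o2 o3 tr j(4) a s
      by (intro wp_Assign) (simp_all only: ok.simps eval.simps opok.simps opv.simps baseD(1,7)[OF b1] baseD(10)[OF h(1) tr(1)] v1 j(2) g[OF j(1)] zw simp_thms, simp_all add: zw mult.assoc less_trans[OF s zw(22)])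
  qed (simp_all add: h zw)
qed


lemma mod_butterfly [simp]: "modv (butterfly r a s) = {35, 36}" "moda (butterfly r a s) = {}"
  by (auto simp: butterfly_def)

lemma axis_index:
  assumes "e < r ^ K'" "l < K'" "j < r"
  shows "dig r l e * r ^ l \<le> e" "e - dig r l e * r ^ l + j * r ^ l < r ^ K'"
proof -
  let ?q = "e div r ^ Suc l" and ?y = "e mod r ^ l"
  have "e div r ^ l div r = ?q" by (simp add: power_Suc2 div_mult2_eq del: power_Suc)
  then have qd: "?q * r + dig r l e = e div r ^ l" unfolding dig_def by (metis div_mult_mod_eq)
  have e: "e = (?q * r + dig r l e) * r ^ l + ?y" unfolding qd by (rule div_mult_mod_eq[symmetric])
  then have e2: "e = ?q * r * r ^ l + ?y + dig r l e * r ^ l" by (simp only: add_mult_distrib add_ac)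
  then show "dig r l e * r ^ l \<le> e" by linarith
  have "e - dig r l e * r ^ l + j * r ^ l = ?q * r * r ^ l + ?y + j * r ^ l" using e2 by linarith
  also have "\<dots> < ?q * r * r ^ l + r ^ l + j * r ^ l" using r_pos by simp
  also have "\<dots> = (?q * r + Suc j) * r ^ l" by (simp add: add_mult_distrib)
  also have "\<dots> \<le> (?q * r + r) * r ^ l" using assms(3) by (intro mult_le_mono1) auto
  also have "\<dots> = Suc ?q * r ^ Suc l" by (simp add: add_mult_distrib)
  also have "\<dots> \<le> r ^ (K' - Suc l) * r ^ Suc l"
  proof (intro mult_le_mono1 Suc_leI)
    have "r ^ K' = r ^ (K' - Suc l) * r ^ Suc l" using assms(2) by (simp add: power_add[symmetric] del: power_Suc)
    then show "?q < r ^ (K' - Suc l)" using assms(1) by (simp add: less_mult_imp_div_less)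
  qed
  also have "\<dots> = r ^ K'" using assms(2) by (simp add: power_add[symmetric] del: power_Suc)
  finally show "e - dig r l e * r ^ l + j * r ^ l < r ^ K'" .
qed

lemma axis_spec:
  assumes h: "base h" "vars h 30 = r ^ l" "l < K" and a: "a < 40" "a \<notin> {0, 6, 7}" and s: "s < r"
    and g: "\<forall>e. e < H \<longrightarrow> arr h a e = pdft r X s f l e mod Q"
  shows "wp (axis r a s) (\<lambda>h'. (\<forall>e. e < H \<longrightarrow> arr h' 6 e = pdft r X s f (Suc l) e mod Q) \<and>
    clk h' \<le> clk h + (H * (r * 60 + 50) + 8)) h"
proof -
  let ?c = "Assign 33 (Bin Mod (Bin Div (V 32) (V 30)) (N r)) ;;
      Assign 34 (Bin Sub (V 32) (Bin Mul (V 33) (V 30))) ;;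
      Assign 35 (N 0) ;; butterfly r a s ;; Write 6 (V 32) (V 35)"
  let ?J = "\<lambda>i h. \<forall>e<i. arr h 6 e = pdft r X s f (Suc l) e mod Q"
  show ?thesis unfolding axis_def
  proof (rule wp_For[where n = H and t = "\<lambda>_. r * 60 + 38" and J = ?J])
    fix e h1 assume e: "e < H" "?J e h1" "frame (For 32 (V 7) ?c) h h1" "vars h1 32 = e"
    have b1: "base h1" using base_frame[OF h(1) e(3)] by simp
    have v1: "vars h1 30 = r ^ l" "arr h1 a = arr h a" using e(3) h(2) a by (simp_all add: frame_def)
    let ?dg = "dig r l e"
    have eH: "e < r ^ K" using e(1) by (simp add: H)
    note ix = axis_index[OF eH h(3)]
    have ix1: "?dg * r ^ l \<le> e" using ix(1)[of 0] r_pos by simp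
    have dgr: "?dg < r" by (rule dig_less[OF r_pos])
    define h2 where "h2 = h1\<lparr>vars := (vars h1)(33 := ?dg, 34 := e - ?dg * r ^ l, 35 := 0), clk := clk h1 + 14\<rparr>"
    have b2: "base h2" by (rule base_cong[OF b1]) (simp_all add: h2_def)
    have d: "wp (butterfly r a s) (\<lambda>h'. vars h' 35 = (\<Sum>j<r. pdft r X s f l (e - ?dg * r ^ l + j * r ^ l) * X ^ (s * (vars h2 33 * j))) mod Q \<and>
      clk h' \<le> clk h2 + (r * 60 + 8)) h2"
    proof (rule butterfly_spec[OF b2 _ _ a(1) s])
      fix j assume j: "j < r"
      have "e - ?dg * r ^ l + j * r ^ l < H" using ix(2)[OF j] by (simp add: H)
      then show "vars h2 34 + j * vars h2 30 < H"
        "arr h2 a (vars h2 34 + j * vars h2 30) = pdft r X s f l (e - ?dg * r ^ l + j * r ^ l) mod Q"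
        using g v1 by (simp_all add: h2_def)
    qed (simp_all add: h2_def dgr)
    have w: "wp (butterfly r a s ;; Write 6 (V 32) (V 35)) (\<lambda>h'. ?J (Suc e) h' \<and> clk h' \<le> clk h1 + (r * 60 + 38)) h2"
    proof (rule wp_Seq, rule wp_mono[OF d], elim conjE)
      fix h3 assume h3: "frame (butterfly r a s) h2 h3"
        "vars h3 35 = (\<Sum>j<r. pdft r X s f l (e - ?dg * r ^ l + j * r ^ l) * X ^ (s * (vars h2 33 * j))) mod Q"
        "clk h3 \<le> clk h2 + (r * 60 + 8)"
      have b3: "base h3" using base_frame[OF b2 h3(1)] by simp
      have v3: "vars h3 32 = e" "arr h3 = arr h1"
        using h3(1) e(4) by (auto simp: frame_def h2_def)
      have p: "vars h3 35 = pdft r X s f (Suc l) e mod Q"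
        unfolding h3(2) pdft_Suc[OF r_pos] by (simp add: h2_def)
      show "wp (Write 6 (V 32) (V 35)) (\<lambda>h'. ?J (Suc e) h' \<and> clk h' \<le> clk h1 + (r * 60 + 38)) h3"
        using e(2) h3(3)
        by (intro wp_Write) (simp_all add: baseD[OF b3] v3 p e(1) zw less_Suc_eq h2_def)
    qed
    have o: "?dg * r ^ l < 2 ^ w" "e < 2 ^ w" using ix1 index_less(6)[OF e(1)] by auto
    have dd: "e div r ^ l mod r = ?dg" by (simp add: dig_def)
    show "wp ?c (\<lambda>h'. ?J (Suc e) h' \<and> clk h' \<le> clk h1 + (r * 60 + 38)) h1"
      by ((rule wp_Seq, rule wp_Assign, simp add: zw e(4) v1 dd o ix1)+, rule wp_eq[OF w], rule hstate.equality)
        (simp_all add: h2_def e(4) v1 dd)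
  next
    fix h' assume "?J H h'" "clk h' \<le> clk h + (\<Sum>i<H. r * 60 + 38 + 12) + 8"
    then show "(\<forall>e. e < H \<longrightarrow> arr h' 6 e = pdft r X s f (Suc l) e mod Q) \<and>
      clk h' \<le> clk h + (H * (r * 60 + 50) + 8)" by (simp add: algebra_simps)
  qed (simp_all add: baseD[OF h(1)] zw)
qed

lemma mod_axis [simp]: "modv (axis r a s) = {32, 33, 34, 35, 36}" "moda (axis r a s) = {6}"
  by (auto simp: axis_def)

lemma copy_spec:
  assumes h: "base h" and a: "a < 40" "a \<notin> {0, 6, 7}"
  shows "wp (For 32 (V 7) (Write a (V 32) (Arr 6 (V 32)))) (\<lambda>h'. (\<forall>e. e < H \<longrightarrow> arr h' a e = arr h 6 e) \<and>
    clk h' \<le> clk h + (H * 22 + 8)) h"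
proof (rule wp_For[where n = H and t = "\<lambda>_. 10" and J = "\<lambda>i h'. \<forall>e<i. arr h' a e = arr h 6 e"])
  fix e h1 assume e: "e < H" "\<forall>e'<e. arr h1 a e' = arr h 6 e'"
    "frame (For 32 (V 7) (Write a (V 32) (Arr 6 (V 32)))) h h1" "vars h1 32 = e"
  have b1: "base h1" using base_frame[OF h(1) e(3)] a by simp
  have v1: "arr h1 6 = arr h 6" using e(3) a by (simp add: frame_def)
  show "wp (Write a (V 32) (Arr 6 (V 32))) (\<lambda>h''. (\<forall>e'<Suc e. arr h'' a e' = arr h 6 e') \<and> clk h'' \<le> clk h1 + 10) h1"
    by (rule wp_Write) (use e(2) a in \<open>simp_all add: baseD[OF b1] e(1,4) v1 zw less_Suc_eq\<close>)
qed (simp_all add: baseD[OF h(1)] zw)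

lemma dft_spec:
  assumes h: "base h" and a: "a < 40" "a \<notin> {0, 6, 7}" and s: "s < r"
    and f: "\<forall>e. e < H \<longrightarrow> arr h a e = f e mod Q"
  shows "wp (dft r a s) (\<lambda>h'. (\<forall>e. e < H \<longrightarrow> arr h' a e = pdft r X s f K e mod Q) \<and>
    clk h' \<le> clk h + (K * (H * (r * 60 + 72) + 40) + 12)) h"
proof -
  let ?cp = "For 32 (V 7) (Write a (V 32) (Arr 6 (V 32)))"
  let ?c = "axis r a s ;; ?cp ;; Assign 30 (Bin Mul (V 30) (N r))"
  let ?J = "\<lambda>l h. vars h 30 = r ^ l \<and> (\<forall>e. e < H \<longrightarrow> arr h a e = pdft r X s f l e mod Q)"
  let ?t = "H * (r * 60 + 72) + 28"
  define h0 where "h0 = h\<lparr>vars := (vars h)(30 := 1), clk := clk h + 2\<rparr>"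
  have b0: "base h0" by (rule base_cong[OF h(1)]) (simp_all add: h0_def)
  have "wp (For 31 (V 8) ?c) (\<lambda>h'. (\<forall>e. e < H \<longrightarrow> arr h' a e = pdft r X s f K e mod Q) \<and>
    clk h' \<le> clk h + (K * (H * (r * 60 + 72) + 40) + 12)) h0"
  proof (rule wp_For[where n = K and t = "\<lambda>_. ?t" and J = ?J])
    fix l h1 assume l: "l < K" "?J l h1" "frame (For 31 (V 8) ?c) h0 h1" "vars h1 31 = l"
    have b1: "base h1" using base_frame[OF b0 l(3)] a by simp
    from l(2) have l30: "vars h1 30 = r ^ l" and lg: "\<forall>e. e < H \<longrightarrow> arr h1 a e = pdft r X s f l e mod Q" by auto
    show "wp ?c (\<lambda>h'. ?J (Suc l) h' \<and> clk h' \<le> clk h1 + ?t) h1"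
    proof (rule wp_Seq, rule wp_mono[OF axis_spec[OF b1 l30 l(1) a s lg]], elim conjE)
      fix h2 assume h2: "frame (axis r a s) h1 h2" "clk h2 \<le> clk h1 + (H * (r * 60 + 50) + 8)"
        "\<forall>e. e < H \<longrightarrow> arr h2 6 e = pdft r X s f (Suc l) e mod Q"
      have b2: "base h2" using base_frame[OF b1 h2(1)] by simp
      have v2: "vars h2 30 = r ^ l" using h2(1) l(2) by (simp add: frame_def)
      show "wp (?cp ;; Assign 30 (Bin Mul (V 30) (N r))) (\<lambda>h'. ?J (Suc l) h' \<and> clk h' \<le> clk h1 + ?t) h2"
      proof (rule wp_Seq, rule wp_mono[OF copy_spec[OF b2 a]], elim conjE)
        fix h3 assume h3: "frame ?cp h2 h3" "clk h3 \<le> clk h2 + (H * 22 + 8)" "\<forall>e. e < H \<longrightarrow> arr h3 a e = arr h2 6 e"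
        have v3: "vars h3 30 = r ^ l" using h3(1) v2 by (simp add: frame_def)
        have "r ^ Suc l \<le> r ^ K" using l(1) r_pos by (intro power_increasing) auto
        then have "r ^ l * r < 2 ^ w" using zw(18) H by (simp add: mult.commute)
        then show "wp (Assign 30 (Bin Mul (V 30) (N r))) (\<lambda>h'. ?J (Suc l) h' \<and> clk h' \<le> clk h1 + ?t) h3"
          using h2(2,3) h3(2,3) by (intro wp_Assign) (simp_all add: v3 zw algebra_simps)
      qed
    qed
  next
    fix h' assume "?J K h'" "clk h' \<le> clk h0 + (\<Sum>i<K. ?t + 12) + 8"
    then show "(\<forall>e. e < H \<longrightarrow> arr h' a e = pdft r X s f K e mod Q) \<and>
      clk h' \<le> clk h + (K * (H * (r * 60 + 72) + 40) + 12)" by (simp add: h0_def algebra_simps)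
  qed (use f in \<open>simp_all add: baseD[OF h] zw h0_def\<close>)
  then show ?thesis unfolding dft_def
    by (intro wp_Seq[OF wp_Assign]) (simp_all add: zw h0_def)
qed

lemma mod_dft [simp]: "modv (dft r a s) = {30, 31, 32, 33, 34, 35, 36}" "moda (dft r a s) = {6, a}"
  by (auto simp: dft_def)

lemma sumup_spec:
  assumes h: "base h"
    and f: "\<forall>e. e < H \<longrightarrow> arr h 4 e = F e mod Q" and g: "\<forall>e. e < H \<longrightarrow> arr h 5 e = G e mod Q"
  shows "wp sumup (\<lambda>h'. vars h' 35 = (\<Sum>e<H. F e * F e * G e) mod Q \<and> clk h' \<le> clk h + (H * 50 + 10)) h"
proof -
  let ?c = "Assign 35 (Bin Mod (Bin Add (V 35)
       (Bin Mul (Bin Mod (Bin Mul (Arr 4 (V 32)) (Arr 4 (V 32))) (V 9)) (Arr 5 (V 32)))) (V 9))"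
  let ?S = "\<lambda>i. \<Sum>e<i. F e * F e * G e"
  define h0 where "h0 = h\<lparr>vars := (vars h)(35 := 0), clk := clk h + 2\<rparr>"
  have b0: "base h0" by (rule base_cong[OF h(1)]) (simp_all add: h0_def)
  have "wp (For 32 (V 7) ?c) (\<lambda>h'. vars h' 35 = (\<Sum>e<H. F e * F e * G e) mod Q \<and> clk h' \<le> clk h + (H * 50 + 10)) h0"
  proof (rule wp_For[where n = H and t = "\<lambda>_. 38" and J = "\<lambda>i h'. vars h' 35 = ?S i mod Q"])
    fix e h1 assume e: "e < H" "vars h1 35 = ?S e mod Q" "frame (For 32 (V 7) ?c) h0 h1" "vars h1 32 = e"
    have b1: "base h1" using base_frame[OF b0 e(3)] by simp
    have v1: "arr h1 = arr h" using e(3) by (auto simp: frame_def h0_def)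
    have QQ: "0 < Q" "x mod Q < Q" for x using Q_gt by auto
    have p: "(F e mod Q) * (F e mod Q) mod Q * (G e mod Q) \<le> Q * Q" "(F e mod Q) * (F e mod Q) \<le> Q * Q"
      by (intro mult_le_mono less_imp_le QQ)+
    moreover have "?S e mod Q \<le> Q * Q" using QQ(2)[of "?S e"] QQ(1) by (meson le_square less_imp_le order_trans)
    ultimately have o: "(F e mod Q) * (F e mod Q) < 2 ^ w" "(F e mod Q) * (F e mod Q) mod Q * (G e mod Q) < 2 ^ w"
      "?S e mod Q + (F e mod Q) * (F e mod Q) mod Q * (G e mod Q) < 2 ^ w"
      using QZ QQ(1) by (auto intro!: Zw simp del: mod_mult_left_eq mod_mult_right_eq)
    have s: "(?S e mod Q + (F e mod Q) * (F e mod Q) mod Q * (G e mod Q)) mod Q = ?S (Suc e) mod Q"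
    proof -
      have "[?S e mod Q + (F e mod Q) * (F e mod Q) mod Q * (G e mod Q) = ?S (Suc e)] (mod Q)"
        unfolding sum.lessThan_Suc by (intro cong_add cong_mult) (simp_all add: cong_def mod_simps)
      then show ?thesis by (simp only: cong_def)
    qed
    have a: "arr h 4 e = F e mod Q" "arr h 5 e = G e mod Q" using f g e(1) by auto
    show "wp ?c (\<lambda>h'. vars h' 35 = ?S (Suc e) mod Q \<and> clk h' \<le> clk h1 + 38) h1"
      using s o
      by (intro wp_Assign) (simp_all only: ok.simps eval.simps opok.simps opv.simps baseD(1,7)[OF b1] v1 e(2,4) a zw simp_thms, simp_all add: zw e(1))
  next
    fix h' assume "vars h' 35 = ?S H mod Q" "clk h' \<le> clk h0 + (\<Sum>i<H. 38 + 12) + 8"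
    then show "vars h' 35 = ?S H mod Q \<and> clk h' \<le> clk h + (H * 50 + 10)" by (simp add: h0_def)
  qed (simp_all add: baseD[OF h] zw h0_def)
  then show ?thesis unfolding sumup_def
    by (intro wp_Seq[OF wp_Assign]) (simp_all add: zw h0_def)
qed

lemma mod_hist [simp]: "modv hist = {20, 21}" "moda hist = {3}"
  by (auto simp: hist_def)
lemma mod_embed [simp]: "modv (embed r b) = {22, 23, 24, 25, 26, 27, 28}" "moda (embed r b) = {4, 5}"
  by (auto simp: embed_def)
lemma mod_sumup [simp]: "modv sumup = {32, 35}" "moda sumup = {}"
  by (auto simp: sumup_def)
lemma mod_count [simp]: "modv (count r b) = {20, 21, 22, 23, 24, 25, 26, 27, 28, 30, 31, 32, 33, 34, 35, 36}"
  "moda (count r b) = {3, 4, 5, 6}"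
  by (auto simp: count_def)

text \<open>The convolution identity is only a congruence modulo \<open>Q\<close>; it becomes an
  equality because the count is at most \<open>n ^ 3\<close>.\<close>

lemma solutions_mod_Q:
  assumes "1 \<le> m" "m \<le> NN"
  shows "(\<Sum>e<H. pdft r X 1 (\<lambda>e. if good K e then bucket A n m (val K e) else 0) K e *
      pdft r X 1 (\<lambda>e. if good K e then bucket A n m (val K e) else 0) K e *
      pdft r X (r - 1) (\<lambda>e. bucket A n m (val K e mod m)) K e) mod Q = H * solutions A n m"
proof -
  have s: "(\<Sum>u<NN. \<Sum>v<NN. bucket A n m u * bucket A n m v * bucket A n m ((u + v) mod m)) = solutions A n m"
    by (rule solutions_bucket) (use assms in auto)
  have "H * solutions A n m < Q"
    using HQ mult_le_mono2[OF solutions_le[of A n m], of H] by linarith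
  then show ?thesis
    using dft_conv[of K "bucket A n m" "\<lambda>x. bucket A n m (x mod m)"]
    unfolding cong_def H[symmetric] NN[symmetric] s by simp
qed

definition count_time :: nat where
  "count_time = (NN * 18 + n * 33 + 16) + (H * (K * 50 + 100) + 8) +
     2 * (K * (H * (r * 60 + 72) + 40) + 12) + (H * 50 + 10)"

lemma count_spec:
  assumes h: "base h" "vars h 13 = m" and m: "1 \<le> m" "m \<le> NN"
  shows "wp (count r b) (\<lambda>h'. vars h' 35 = H * solutions A n m \<and> clk h' \<le> clk h + count_time) h"
proof -
  let ?f = "\<lambda>e. if good K e then bucket A n m (val K e) else 0"
  let ?g = "\<lambda>e. bucket A n m (val K e mod m)"
  let ?Q = "\<lambda>h'. vars h' 35 = H * solutions A n m \<and> clk h' \<le> clk h + count_time"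
  have bQ: "bucket A n m x < Q" for x
  proof -
    have "bucket A n m x \<le> n" unfolding bucket_def
      using sum_mono[of "{..<n}" "\<lambda>i. of_bool (A i mod m = x)" "\<lambda>_. 1::nat"] by simp
    also have "n \<le> H * n ^ 3" using n1 zw(11) by (simp add: power3_eq_cube)
    finally show ?thesis using HQ by linarith
  qed
  show ?thesis unfolding count_def
  proof (rule wp_Seq, rule wp_mono[OF hist_spec[OF h m]], elim conjE)
    fix h1 assume h1: "frame hist h h1" "\<forall>x. x < NN \<longrightarrow> arr h1 3 x = bucket A n m x"
      "clk h1 \<le> clk h + (NN * 18 + n * 33 + 16)"
    have b1: "base h1" using base_frame[OF h(1) h1(1)] by simp
    have v1: "vars h1 13 = m" using h1(1) h(2) by (simp add: frame_def)
    show "wp (embed r b ;; dft r 4 1 ;; dft r 5 (r - 1) ;; sumup) ?Q h1"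
    proof (rule wp_Seq, rule wp_mono[OF embed_spec[OF b1 v1 h1(2) m]], elim conjE)
      fix h2 assume h2: "frame (embed r b) h1 h2" "clk h2 \<le> clk h1 + (H * (K * 50 + 100) + 8)"
        "\<forall>e. e < H \<longrightarrow> arr h2 4 e = ?f e \<and> arr h2 5 e = ?g e"
      have b2: "base h2" using base_frame[OF b1 h2(1)] by simp
      have f2: "\<forall>e. e < H \<longrightarrow> arr h2 4 e = ?f e mod Q" using h2(3) bQ Q_gt by simp
      have g2: "\<forall>e. e < H \<longrightarrow> arr h2 5 e = ?g e mod Q" using h2(3) bQ by simp
      have r1: "1 < r" "r - 1 < r" using r2b two_le_b by linarith+
      have a4: "4 < (40::nat)" "4 \<notin> {0, 6, 7 :: nat}" and a5: "5 < (40::nat)" "5 \<notin> {0, 6, 7 :: nat}" by auto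
      show "wp (dft r 4 1 ;; dft r 5 (r - 1) ;; sumup) ?Q h2"
      proof (rule wp_Seq, rule wp_mono[OF dft_spec[OF b2 a4 r1(1) f2]], elim conjE)
        fix h3 assume h3: "frame (dft r 4 1) h2 h3" "clk h3 \<le> clk h2 + (K * (H * (r * 60 + 72) + 40) + 12)"
          "\<forall>e. e < H \<longrightarrow> arr h3 4 e = pdft r X 1 ?f K e mod Q"
        have b3: "base h3" using base_frame[OF b2 h3(1)] by simp
        have g3: "\<forall>e. e < H \<longrightarrow> arr h3 5 e = ?g e mod Q" using g2 h3(1) by (simp add: frame_def)
        show "wp (dft r 5 (r - 1) ;; sumup) ?Q h3"
        proof (rule wp_Seq, rule wp_mono[OF dft_spec[OF b3 a5 r1(2) g3]], elim conjE)
          fix h4 assume h4: "frame (dft r 5 (r - 1)) h3 h4" "clk h4 \<le> clk h3 + (K * (H * (r * 60 + 72) + 40) + 12)"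
            "\<forall>e. e < H \<longrightarrow> arr h4 5 e = pdft r X (r - 1) ?g K e mod Q"
          have b4: "base h4" using base_frame[OF b3 h4(1)] by simp
          have f4: "\<forall>e. e < H \<longrightarrow> arr h4 4 e = pdft r X 1 ?f K e mod Q" using h3(3) h4(1) by (simp add: frame_def)
          show "wp sumup ?Q h4"
            by (rule wp_mono[OF sumup_spec[OF b4 f4 h4(3)]])
              (use h4(2) h3(2) h2(2) h1(3) solutions_mod_Q[OF m] in \<open>simp add: count_time_def\<close>)
        qed
      qed
    qed
  qed
qed

end

section \<open>Choosing the modulus\<close>

text \<open>Candidates are the counter plus 1. The first one is always accepted, so the running
  minimum needs no infinite initial value. Minima are compared on the counts multiplied by
  \<open>H\<close>.\<close>

definition try_factor :: "nat \<Rightarrow> nat \<Rightarrow> com" where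
  "try_factor r b = Assign 13 (Bin Mul (V 12) (Bin Add (V 42) (N 1))) ;; count r b ;;
       If (Bin Add (Bin Eq (V 42) (N 0)) (Bin Less (V 35) (V 41)))
         (Assign 41 (V 35) ;; Assign 43 (Bin Add (V 42) (N 1))) Skip"

definition pick :: "nat \<Rightarrow> nat \<Rightarrow> nat \<Rightarrow> com" where
  "pick r b k = Assign 12 (N 1) ;;
     For 40 (N k) (For 42 (V 5) (try_factor r b) ;; Assign 12 (Bin Mul (V 12) (V 43)))"

lemma mod_try [simp]: "modv (try_factor r b) = {13, 41, 43} \<union> modv (count r b)" "moda (try_factor r b) = moda (count r b)"
  by (auto simp: try_factor_def)

lemma mod_pick [simp]: "modv (pick r b k) = {12, 13, 40, 41, 42, 43} \<union> modv (count r b)"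
  "moda (pick r b k) = moda (count r b)"
  by (auto simp: pick_def)

context prog begin

lemma try_spec:
  assumes h: "base h" "vars h 12 = m" "vars h 42 = i" and m: "1 \<le> m" "m * Y \<le> NN" and i: "i < Y"
    and J: "i = 0 \<or> vars h 41 = H * solutions A n (m * vars h 43) \<and> vars h 43 \<in> {1..i} \<and>
      (\<forall>e\<in>{1..i}. solutions A n (m * vars h 43) \<le> solutions A n (m * e))"
  shows "wp (try_factor r b) (\<lambda>h'. (vars h' 41 = H * solutions A n (m * vars h' 43) \<and> vars h' 43 \<in> {1..Suc i} \<and>
      (\<forall>e\<in>{1..Suc i}. solutions A n (m * vars h' 43) \<le> solutions A n (m * e))) \<and>
      clk h' \<le> clk h + (count_time + 30)) h"
proof -
  define h1 where "h1 = h\<lparr>vars := (vars h)(13 := m * Suc i), clk := clk h + 6\<rparr>"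
  have b1: "base h1" by (rule base_cong[OF h(1)]) (simp_all add: h1_def)
  have "m * Suc i \<le> m * Y" using i by (intro mult_le_mono2) auto
  then have mi: "1 \<le> m * Suc i" "m * Suc i \<le> NN" using m by auto
  have "1 * Y \<le> m * Y" using m(1) by (intro mult_le_mono1)
  then have iN: "i < NN" "Suc i \<le> NN" using i m(2) by linarith+
  have o: "Suc i < 2 ^ w" "m * Suc i < 2 ^ w" using iN(2) mi(2) zw(19) by linarith+
  let ?Q = "\<lambda>h'. (vars h' 41 = H * solutions A n (m * vars h' 43) \<and> vars h' 43 \<in> {1..Suc i} \<and>
      (\<forall>e\<in>{1..Suc i}. solutions A n (m * vars h' 43) \<le> solutions A n (m * e))) \<and>
      clk h' \<le> clk h + (count_time + 30)"
  let ?I = "If (Bin Add (Bin Eq (V 42) (N 0)) (Bin Less (V 35) (V 41)))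
         (Assign 41 (V 35) ;; Assign 43 (Bin Add (V 42) (N 1))) Skip"
  have v1: "vars h1 13 = m * Suc i" by (simp add: h1_def)
  have two: "(2::nat) < 2 ^ w" using Zw[of 2] r2b two_le_b zw(7) by linarith
  have w: "wp (count r b ;; ?I) ?Q h1"
  proof (rule wp_Seq, rule wp_mono[OF count_spec[OF b1 v1 mi]], elim conjE)
    fix h2 assume h2: "frame (count r b) h1 h2" "vars h2 35 = H * solutions A n (m * Suc i)"
      "clk h2 \<le> clk h1 + count_time"
    have v2: "vars h2 42 = i" "vars h2 41 = vars h 41" "vars h2 43 = vars h 43"
      using h2(1) h(3) by (simp_all add: frame_def h1_def)
    have H0: "0 < H" using zw(11) .
    show "wp ?I ?Q h2"
    proof (rule wp_If)
      show "ok (Bin Add (Bin Eq (V 42) (N 0)) (Bin Less (V 35) (V 41))) h2"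
        using two by (simp add: of_bool_def)
    next
      assume c: "eval (Bin Add (Bin Eq (V 42) (N 0)) (Bin Less (V 35) (V 41))) h2 \<noteq> 0"
      have le: "solutions A n (m * Suc i) \<le> solutions A n (m * e)" if "e \<in> {1..Suc i}" for e
      proof (cases "e = Suc i")
        case False
        then have e: "e \<in> {1..i}" using that by auto
        then have "i \<noteq> 0" by auto
        then have "H * solutions A n (m * Suc i) < H * solutions A n (m * vars h 43)" using c J by (simp add: v2 h2(2))
        then show ?thesis using J \<open>i \<noteq> 0\<close> e H0 by (meson le_trans less_imp_le nat_mult_less_cancel1)
      qed auto
      then show "wp (Assign 41 (V 35) ;; Assign 43 (Bin Add (V 42) (N 1))) ?Q
          (tick (cost (Bin Add (Bin Eq (V 42) (N 0)) (Bin Less (V 35) (V 41))) + 1) h2)"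
        using h2(3) by (intro wp_Seq wp_Assign) (simp_all add: v2 h2(2) o zw h1_def)
    next
      assume c: "eval (Bin Add (Bin Eq (V 42) (N 0)) (Bin Less (V 35) (V 41))) h2 = 0"
      then have "i \<noteq> 0" "H * solutions A n (m * vars h 43) \<le> H * solutions A n (m * Suc i)"
        using J by (auto simp: v2 h2(2) split: if_splits)
      then have "solutions A n (m * vars h 43) \<le> solutions A n (m * Suc i)" using H0 by simp
      then show "wp Skip ?Q (tick (cost (Bin Add (Bin Eq (V 42) (N 0)) (Bin Less (V 35) (V 41))) + 3) h2)"
        using h2(3) J \<open>i \<noteq> 0\<close> by (intro wp_Skip) (auto simp: v2 h1_def le_Suc_eq)
    qed
  qed
  show ?thesis unfolding try_factor_def
    by (rule wp_Seq, rule wp_Assign) (simp add: o[simplified] h zw, rule wp_eq[OF w], rule hstate.equality, simp_all add: h h1_def)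
qed

text \<open>Each stage gains a factor \<open>Y\<close> and loses a factor \<open>D\<close> by
  \<open>argmin_false_sols\<close>; the induction starts at modulus 1 with at most
  \<open>n ^ 3\<close> false solutions.\<close>

lemma pick_spec:
  assumes h: "base h" and NNk: "NN = Y ^ k" and kw: "k < 2 ^ w"
    and D: "\<And>s. 1 \<le> s \<Longrightarrow> s \<le> M \<Longrightarrow> card {d. d dvd s} \<le> D" and A: "\<And>i. i < n \<Longrightarrow> A i + A i \<le> M"
  shows "wp (pick r b k) (\<lambda>h'. (1 \<le> vars h' 12 \<and> vars h' 12 \<le> NN \<and>
      Y ^ k * false_sols A n (vars h' 12) \<le> D ^ k * n ^ 3) \<and>
      clk h' \<le> clk h + (k * (Y * (count_time + 50) + 40) + 20)) h"
proof -
  define h0 where "h0 = h\<lparr>vars := (vars h)(12 := 1), clk := clk h + 2\<rparr>"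
  have b0: "base h0" by (rule base_cong[OF h]) (simp_all add: h0_def)
  let ?J = "\<lambda>i h'. 1 \<le> vars h' 12 \<and> vars h' 12 \<le> Y ^ i \<and>
      Y ^ i * false_sols A n (vars h' 12) \<le> D ^ i * n ^ 3"
  let ?c = "For 42 (V 5) (try_factor r b) ;; Assign 12 (Bin Mul (V 12) (V 43))"
  let ?t = "Y * (42 + count_time) + 12"
  have F1: "false_sols A n 1 \<le> n ^ 3" using solutions_le[of A n 1] by (simp add: solutions_split)
  have "wp (For 40 (N k) ?c) (\<lambda>h'. (1 \<le> vars h' 12 \<and> vars h' 12 \<le> NN \<and>
      Y ^ k * false_sols A n (vars h' 12) \<le> D ^ k * n ^ 3) \<and>
      clk h' \<le> clk h + (k * (Y * (count_time + 50) + 40) + 20)) h0"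
  proof (rule wp_For[where n = k and t = "\<lambda>_. ?t" and J = ?J])
    fix i h1 assume i: "i < k" "?J i h1" "frame (For 40 (N k) ?c) h0 h1" "vars h1 40 = i"
    have b1: "base h1" using base_frame[OF b0 i(3)] by simp
    define m where "m = vars h1 12"
    have m: "1 \<le> m" "m \<le> Y ^ i" using i(2) by (auto simp: m_def)
    have "m * Y \<le> Y ^ Suc i" using m(2) by (simp add: mult.commute)
    also have "\<dots> \<le> Y ^ k" using i(1) Y1 by (intro power_increasing) auto
    finally have mY: "m * Y \<le> NN" by (simp add: NNk)
    let ?best = "\<lambda>j h'. vars h' 41 = H * solutions A n (m * vars h' 43) \<and> vars h' 43 \<in> {1..j} \<and>
      (\<forall>e\<in>{1..j}. solutions A n (m * vars h' 43) \<le> solutions A n (m * e))"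
    have Yw: "Y < 2 ^ w"
      using mult_le_mono1[OF m(1), of Y] mY zw(19) by linarith
    show "wp ?c (\<lambda>h'. ?J (Suc i) h' \<and> clk h' \<le> clk h1 + ?t) h1"
    proof (rule wp_Seq, rule wp_For[where n = Y and t = "\<lambda>_. count_time + 30" and J = "\<lambda>j h'. j = 0 \<or> ?best j h'"])
      fix j h2 assume j: "j < Y" "j = 0 \<or> ?best j h2" "frame (For 42 (V 5) (try_factor r b)) h1 h2" "vars h2 42 = j"
      have b2: "base h2" using base_frame[OF b1 j(3)] by simp
      have v2: "vars h2 12 = m" using j(3) by (simp add: frame_def m_def)
      show "wp (try_factor r b) (\<lambda>h'. (Suc j = 0 \<or> ?best (Suc j) h') \<and> clk h' \<le> clk h2 + (count_time + 30)) h2"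
        by (rule wp_mono[OF try_spec[OF b2 v2 j(4) m(1) mY j(1) j(2)]]) blast
    next
      fix h2 assume h2: "Y = 0 \<or> ?best Y h2" "frame (For 42 (V 5) (try_factor r b)) h1 h2"
        "clk h2 \<le> clk h1 + (\<Sum>i<Y. count_time + 30 + 12) + 8"
      have v2: "vars h2 12 = m" using h2(2) by (simp add: frame_def m_def)
      let ?d = "vars h2 43"
      have d: "?d \<in> {1..Y}" "\<forall>e\<in>{1..Y}. solutions A n (m * ?d) \<le> solutions A n (m * e)" using h2(1) Y1 by auto
      have mdY: "m * ?d \<le> m * Y" using d(1) by (intro mult_le_mono2) auto
      have "m * Y \<le> Y * Y ^ i" using mult_le_mono1[OF m(2), of Y] by (simp only: mult.commute)
      then have md: "m * ?d \<le> Y * Y ^ i" "m * ?d < 2 ^ w" using mdY mY zw(19) by linarith+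
      have md1: "1 \<le> m * ?d" using d(1) m(1) by simp
      have "Y * false_sols A n (m * ?d) \<le> D * false_sols A n m"
        by (rule argmin_false_sols[where M = M]) (use d(2) in \<open>auto intro: D A\<close>)
      then have "Y ^ i * (Y * false_sols A n (m * ?d)) \<le> Y ^ i * (D * false_sols A n m)" by (rule mult_le_mono2)
      also have "\<dots> = D * (Y ^ i * false_sols A n m)" by (simp only: mult_ac)
      also have "\<dots> \<le> D * (D ^ i * n ^ 3)" using i(2) by (intro mult_le_mono2) (simp add: m_def)
      finally have F: "Y * Y ^ i * false_sols A n (m * ?d) \<le> D * D ^ i * n ^ 3" by (simp only: mult_ac)
      show "wp (Assign 12 (Bin Mul (V 12) (V 43))) (\<lambda>h'. ?J (Suc i) h' \<and> clk h' \<le> clk h1 + ?t) h2"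
        using h2(3) md md1 F by (intro wp_Assign) (simp_all add: v2)
    qed (simp_all add: baseD[OF b1] Yw)
  next
    fix h' assume "?J k h'" "clk h' \<le> clk h0 + (\<Sum>i<k. ?t + 12) + 8"
    then show "(1 \<le> vars h' 12 \<and> vars h' 12 \<le> NN \<and> Y ^ k * false_sols A n (vars h' 12) \<le> D ^ k * n ^ 3) \<and>
      clk h' \<le> clk h + (k * (Y * (count_time + 50) + 40) + 20)"
      by (simp add: h0_def NNk algebra_simps)
  qed (use F1 kw in \<open>simp_all add: h0_def\<close>)
  then show ?thesis unfolding pick_def
    by (intro wp_Seq[OF wp_Assign]) (simp_all add: zw h0_def)
qed

end

section \<open>Buckets and queries\<close>

text \<open>The head of the list of bucket \<open>x\<close> after \<open>q\<close> insertions, in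
  the encoding by index plus 1. The link stored with an index \<open>p\<close> is the head at the
  moment before \<open>p\<close> was inserted.\<close>

fun lastin :: "(nat \<Rightarrow> nat) \<Rightarrow> nat \<Rightarrow> nat \<Rightarrow> nat \<Rightarrow> nat" where
  "lastin A m x 0 = 0"
| "lastin A m x (Suc q) = (if A q mod m = x then Suc q else lastin A m x q)"

lemma lastin_props:
  "lastin A m x q \<le> q \<and> (0 < lastin A m x q \<longrightarrow> A (lastin A m x q - 1) mod m = x) \<and>
   bucket A (lastin A m x q) m x = bucket A q m x \<and> (\<forall>j. lastin A m x q \<le> j \<and> j < q \<longrightarrow> A j mod m \<noteq> x)"
  by (induction q) (auto simp: less_Suc_eq)

text \<open>Following a link from \<open>p\<close> to \<open>p'\<close> skips only indices outside
  the bucket, so the search for a partner \<open>R\<close> extends downwards by \<open>p\<close>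
  alone.\<close>

lemma ex_from_lastin:
  assumes "p' \<le> p" "p < n" "\<And>j. p' \<le> j \<Longrightarrow> j < p \<Longrightarrow> \<not> R j"
  shows "(\<exists>j<n. p' \<le> j \<and> R j) \<longleftrightarrow> (\<exists>j<n. Suc p \<le> j \<and> R j) \<or> R p"
proof
  assume "\<exists>j<n. p' \<le> j \<and> R j"
  then obtain j where j: "j < n" "p' \<le> j" "R j" by blast
  then have "\<not> j < p" using assms(3) by blast
  then show "(\<exists>j<n. Suc p \<le> j \<and> R j) \<or> R p" using j by (cases "j = p") auto
next
  assume "(\<exists>j<n. Suc p \<le> j \<and> R j) \<or> R p"
  then show "\<exists>j<n. p' \<le> j \<and> R j" using assms(1,2) by (meson Suc_leD le_trans)
qed

text \<open>
  The buckets are linked lists in arrays 8 (heads) and 9 (tails), whose entries are indices plus 1,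
  with 0 for the end.
\<close>

definition build :: com where
  "build = Assign 13 (V 12) ;; hist ;;
     For 20 (V 1) (Assign 21 (Bin Mod (Arr 0 (V 20)) (V 13)) ;;
       Write 1 (V 21) (N 1) ;; Write 1 (Bin Add (V 21) (V 6)) (N 1) ;;
       Write 9 (Bin Add (V 20) (N 1)) (Arr 8 (V 21)) ;;
       Write 8 (V 21) (Bin Add (V 20) (N 1)))"

definition scan_inner :: com where
  "scan_inner = For 63 (V 60)
      (If (Bin Eq (Bin Add (Arr 0 (Bin Sub (V 58) (N 1))) (Arr 0 (Bin Sub (V 62) (N 1)))) (V 52))
         (Assign 50 (N 1)) Skip ;;
       Assign 62 (Arr 9 (V 62)))"

definition scan :: com where
  "scan = Assign 58 (Arr 8 (V 56)) ;; Assign 59 (Arr 3 (V 56)) ;; Assign 60 (Arr 3 (V 57)) ;;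
     For 61 (V 59) (Assign 62 (Arr 8 (V 57)) ;; scan_inner ;; Assign 58 (Arr 9 (V 58)))"

lemma mod_build [simp]: "modv build = {13, 20, 21}" "moda build = {1, 3, 8, 9}"
  by (auto simp: build_def hist_def)
lemma mod_scan_inner [simp]: "modv scan_inner = {50, 62, 63}" "moda scan_inner = {}"
  by (auto simp: scan_inner_def)
lemma mod_scan [simp]: "modv scan = {50, 58, 59, 60, 61, 62, 63}" "moda scan = {}"
  by (auto simp: scan_def)

context prog begin

text \<open>Residues are below \<open>NN\<close>, but the index of the second query reaches
  \<open>2 * m + 1\<close>. Doubling the length keeps it in the permitted range of queries.\<close>

definition bits :: "nat \<Rightarrow> nat list" where
  "bits m = map (\<lambda>x. of_bool (\<exists>i<n. A i mod m = x)) [0..<2 * NN]"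

definition qinv :: "nat \<Rightarrow> hstate \<Rightarrow> bool" where
  "qinv m h \<longleftrightarrow> base h \<and> vars h 10 = 2 ^ wd - 1 \<and> vars h 12 = m \<and>
     (\<forall>x. x < NN \<longrightarrow> arr h 3 x = bucket A n m x) \<and> (\<forall>x. x < NN \<longrightarrow> arr h 8 x = lastin A m x n) \<and>
     (\<forall>p. p < n \<longrightarrow> arr h 9 (Suc p) = lastin A m (A p mod m) p)"

lemma qinv_frame:
  assumes "qinv m h" "frame c h h'" "modv c \<inter> {0, 1, 5, 6, 7, 8, 9, 14, 10, 12} = {}" "moda c \<inter> {0, 7, 3, 8, 9} = {}"
  shows "qinv m h'"
proof -
  have "v \<notin> modv c" if "v \<in> {0, 1, 5, 6, 7, 8, 9, 14, 10, 12}" for v using assms(3) that by blast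
  moreover have "j \<notin> moda c" if "j \<in> {0, 7, 3, 8, 9}" for j using assms(4) that by blast
  ultimately show ?thesis using assms(1,2) by (simp add: qinv_def base_def frame_def)
qed

lemma qinv_cong:
  "qinv m h \<Longrightarrow> (\<forall>v\<in>{0, 1, 5, 6, 7, 8, 9, 14, 10, 12}. vars h' v = vars h v) \<Longrightarrow>
    (\<forall>j\<in>{0, 7, 3, 8, 9}. arr h' j = arr h j) \<Longrightarrow> qinv m h'"
  by (simp add: qinv_def base_def)

lemma qinvD:
  assumes "qinv m h"
  shows "base h" "vars h 10 = 2 ^ wd - 1" "vars h 12 = m" "x < NN \<Longrightarrow> arr h 3 x = bucket A n m x"
    "x < NN \<Longrightarrow> arr h 8 x = lastin A m x n" "p < n \<Longrightarrow> arr h 9 (Suc p) = lastin A m (A p mod m) p"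
  using assms by (auto simp: qinv_def)

lemma bucket_le: "bucket A i m x \<le> i"
  unfolding bucket_def using sum_mono[of "{..<i}" "\<lambda>i. of_bool (A i mod m = x)" "\<lambda>_. 1::nat"] by simp

lemma build_spec:
  assumes h: "base h" "vars h 10 = 2 ^ wd - 1" "vars h 12 = m" and m: "1 \<le> m" "m \<le> NN"
    and z: "arr h 1 = (\<lambda>_. 0)" "arr h 8 = (\<lambda>_. 0)"
  shows "wp build (\<lambda>h'. (qinv m h' \<and> arr h' 1 = mem_of (bits m @ bits m)) \<and> clk h' \<le> clk h + (NN * 18 + n * 110 + 40)) h"
proof -
  let ?c = "Assign 21 (Bin Mod (Arr 0 (V 20)) (V 13)) ;;
       Write 1 (V 21) (N 1) ;; Write 1 (Bin Add (V 21) (V 6)) (N 1) ;;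
       Write 9 (Bin Add (V 20) (N 1)) (Arr 8 (V 21)) ;;
       Write 8 (V 21) (Bin Add (V 20) (N 1))"
  let ?Q = "\<lambda>h'. (qinv m h' \<and> arr h' 1 = mem_of (bits m @ bits m)) \<and> clk h' \<le> clk h + (NN * 18 + n * 110 + 40)"
  let ?J = "\<lambda>i h. (\<forall>x. arr h 1 x = of_bool (\<exists>j<i. x = A j mod m \<or> x = A j mod m + 2 * NN)) \<and>
    (\<forall>x. arr h 8 x = lastin A m x i) \<and> (\<forall>p. p < i \<longrightarrow> arr h 9 (Suc p) = lastin A m (A p mod m) p)"
  define h0 where "h0 = h\<lparr>vars := (vars h)(13 := m), clk := clk h + 2\<rparr>"
  have b0: "base h0" by (rule base_cong[OF h(1)]) (simp_all add: h0_def)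
  have v0: "vars h0 13 = m" by (simp add: h0_def)
  have mN: "A i mod m < NN" for i using m by (meson less_le_trans mod_less_divisor zero_less_one)
  have w: "wp (hist ;; For 20 (V 1) ?c) ?Q h0"
  proof (rule wp_Seq, rule wp_mono[OF hist_spec[OF b0 v0 m]], elim conjE)
    fix h1 assume h1: "frame hist h0 h1" "\<forall>x. x < NN \<longrightarrow> arr h1 3 x = bucket A n m x"
      "clk h1 \<le> clk h0 + (NN * 18 + n * 33 + 16)"
    have b1: "base h1" using base_frame[OF b0 h1(1)] by simp
    have v1: "vars h1 10 = 2 ^ wd - 1" "vars h1 12 = m" "vars h1 13 = m" "arr h1 1 = (\<lambda>_. 0)" "arr h1 8 = (\<lambda>_. 0)"
      using h1(1) h z by (simp_all add: frame_def h0_def)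
    show "wp (For 20 (V 1) ?c) ?Q h1"
    proof (rule wp_For[where n = n and t = "\<lambda>_. 60" and J = ?J])
      fix i h2 assume i: "i < n" "?J i h2" "frame (For 20 (V 1) ?c) h1 h2" "vars h2 20 = i"
      have b2: "base h2" using base_frame[OF b1 i(3)] by simp
      have v2: "vars h2 13 = m" using i(3) v1 by (simp add: frame_def)
      let ?x = "A i mod m"
      have x: "?x < NN" "?x < Z" "?x < 2 ^ w" using mN[of i] zw by auto
      have x2: "?x + 2 * NN < Z" using mN[of i] zw(13) by linarith
      note x2w = Zw[OF x2]
      have si: "Suc i < Z" "Suc i < 2 ^ w" using i(1) zw(2,17) by linarith+
      show "wp ?c (\<lambda>h'. ?J (Suc i) h' \<and> clk h' \<le> clk h2 + 60) h2"
        by (intro wp_Seq wp_Assign wp_Write)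
          (simp_all add: baseD[OF b2] v2 i(1,4) x x2 x2w si zw, use i(2) x in \<open>auto simp: less_Suc_eq of_bool_def\<close>)
    next
      fix h2 assume h2: "?J n h2" "frame (For 20 (V 1) ?c) h1 h2" "clk h2 \<le> clk h1 + (\<Sum>i<n. 60 + 12) + 8"
      have b2: "base h2" using base_frame[OF b1 h2(2)] by simp
      have q: "qinv m h2" using h2(1,2) v1 h1(2) b2 by (simp add: qinv_def frame_def)
      have "arr h2 1 x = mem_of (bits m @ bits m) x" for x
      proof -
        have "A j mod m < 2 * NN" for j using mN[of j] by linarith
        then have "(\<exists>j<n. x = A j mod m \<or> x = A j mod m + 2 * NN) \<longleftrightarrow>
          x < 4 * NN \<and> (\<exists>j<n. A j mod m = (if x < 2 * NN then x else x - 2 * NN))"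
          by (auto split: if_splits)
        then show ?thesis using h2(1) by (auto simp: mem_of_def bits_def nth_append)
      qed
      then show "?Q h2" using q h2(3) h1(3) by (auto simp: h0_def)
    qed (use v1 zw in \<open>simp_all add: baseD[OF b1]\<close>)
  qed
  show ?thesis unfolding build_def
    by (rule wp_Seq, rule wp_Assign) (simp, rule wp_eq[OF w], rule hstate.equality, simp_all add: h h0_def)
qed

lemma scan_inner_spec:
  assumes q: "qinv m h" and v: "vars h 52 = c" "vars h 58 = Suc a" "a < n" "vars h 60 = bucket A n m y"
    "vars h 62 = lastin A m y n" "vars h 50 = of_bool F0"
  shows "wp scan_inner (\<lambda>h'. vars h' 50 = of_bool (F0 \<or> (\<exists>j<n. A j mod m = y \<and> A a + A j = c)) \<and>
     clk h' \<le> clk h + (bucket A n m y * 60 + 8)) h"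
proof -
  let ?e = "Bin Eq (Bin Add (Arr 0 (Bin Sub (V 58) (N 1))) (Arr 0 (Bin Sub (V 62) (N 1)))) (V 52)"
  let ?c = "If ?e (Assign 50 (N 1)) Skip ;; Assign 62 (Arr 9 (V 62))"
  let ?F = "\<lambda>p. of_bool (F0 \<or> (\<exists>j<n. p \<le> j \<and> A j mod m = y \<and> A a + A j = c)) :: nat"
  \<comment> \<open>The bucket members below the pointer are those still to be visited. Once their
    number is 0 the pointer must be 0 too, since a positive pointer designates a member just below
    itself.\<close>
  let ?J = "\<lambda>t h. vars h 62 \<le> n \<and> bucket A (vars h 62) m y + t = bucket A n m y \<and>
     (0 < vars h 62 \<longrightarrow> A (vars h 62 - 1) mod m = y) \<and> vars h 50 = ?F (vars h 62)"
  have bn: "bucket A n m y < 2 ^ w" using bucket_le[of n m y] zw(17) by linarith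
  show ?thesis unfolding scan_inner_def
  proof (rule wp_For[where n = "bucket A n m y" and t = "\<lambda>_. 40" and J = ?J])
    fix t h1 assume t: "t < bucket A n m y" "?J t h1" "frame (For 63 (V 60) ?c) h h1" "vars h1 63 = t"
    have q1: "qinv m h1" using qinv_frame[OF q t(3)] by simp
    note b1 = qinvD(1)[OF q1]
    have v1: "vars h1 52 = c" "vars h1 58 = Suc a" using t(3) v by (simp_all add: frame_def)
    have "vars h1 62 \<noteq> 0" using t(1,2) by (intro notI) simp
    then obtain p where p: "vars h1 62 = Suc p" by (cases "vars h1 62") auto
    have pn: "p < n" and py: "A p mod m = y" using t(2) p by auto
    let ?p' = "lastin A m y p"
    note lp = lastin_props[of A m y p]
    have As: "A a + A p < 2 ^ w" using AZ[OF v(3)] AZ[OF pn] by (intro Zw) linarith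
    have sp: "Suc p < 2 ^ w" "Suc p < Z" "Suc a < 2 ^ w" using pn v(3) zw(2,17) by linarith+
    have F': "?F ?p' = of_bool (?F (Suc p) = 1 \<or> A a + A p = c)"
    proof -
      have "(\<exists>j<n. ?p' \<le> j \<and> A j mod m = y \<and> A a + A j = c) \<longleftrightarrow>
         (\<exists>j<n. Suc p \<le> j \<and> A j mod m = y \<and> A a + A j = c) \<or> A a + A p = c"
        using ex_from_lastin[where p' = ?p' and p = p and n = n and R = "\<lambda>j. A j mod m = y \<and> A a + A j = c"] lp pn py by auto
      then show ?thesis by auto
    qed
    have bs: "bucket A ?p' m y + Suc t = bucket A n m y" using lp t(2) p py by simp
    have n9: "arr h1 9 (Suc p) = ?p'" using qinvD(6)[OF q1 pn] py by simp
    have Fp: "vars h1 50 = ?F (Suc p)" using t(2) p by simp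
    have g: "?p' \<le> n \<and> (0 < ?p' \<longrightarrow> A (?p' - Suc 0) mod m = y)" using lp pn by auto
    show "wp ?c (\<lambda>h'. ?J (Suc t) h' \<and> clk h' \<le> clk h1 + 40) h1"
    proof (rule wp_Seq, rule wp_If)
      show "ok ?e h1" using sp As by (simp add: baseD[OF b1] v1 p pn v(3) zw)
    next
      assume "eval ?e h1 \<noteq> 0"
      then have e: "A a + A p = c" by (simp add: baseD[OF b1] v1 p pn v(3) split: if_splits)
      then have "?F ?p' = 1" unfolding F' by simp
      then show "wp (Assign 50 (N 1)) (wp (Assign 62 (Arr 9 (V 62))) (\<lambda>h'. ?J (Suc t) h' \<and> clk h' \<le> clk h1 + 40)) (tick (cost ?e + 1) h1)"
        by (intro wp_Assign) (simp_all add: baseD[OF b1] p n9 g bs[simplified] sp zw)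
    next
      assume "eval ?e h1 = 0"
      then have e: "A a + A p \<noteq> c" by (simp add: baseD[OF b1] v1 p pn v(3) split: if_splits)
      then have "?F ?p' = ?F (Suc p)" unfolding F' by (simp add: of_bool_def)
      then have "?F (Suc p) = ?F ?p'" ..
      then show "wp Skip (wp (Assign 62 (Arr 9 (V 62))) (\<lambda>h'. ?J (Suc t) h' \<and> clk h' \<le> clk h1 + 40)) (tick (cost ?e + 3) h1)"
        unfolding wp_def[of Skip] using Fp
        by (intro exI[of _ "tick (cost ?e + 3) h1"] conjI exec.Skip wp_Assign) (simp_all add: baseD[OF b1] p n9 g bs[simplified] sp zw)
    qed
  next
    fix h' assume J: "?J (bucket A n m y) h'" and clk: "clk h' \<le> clk h + (\<Sum>i<bucket A n m y. 40 + 12) + 8"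
    have "vars h' 62 = 0"
    proof (rule ccontr)
      assume "vars h' 62 \<noteq> 0"
      then obtain p where "vars h' 62 = Suc p" by (cases "vars h' 62") auto
      then show False using J by auto
    qed
    then show "vars h' 50 = of_bool (F0 \<or> (\<exists>j<n. A j mod m = y \<and> A a + A j = c)) \<and>
     clk h' \<le> clk h + (bucket A n m y * 60 + 8)" using J clk by simp
  next
    note lp = lastin_props[of A m y n]
    have "(\<exists>j<n. lastin A m y n \<le> j \<and> A j mod m = y \<and> A a + A j = c) \<longleftrightarrow> False" using lp by blast
    then show "?J 0 h" using lp v by auto
  qed (simp_all add: v bn)
qed

lemma scan_spec:
  assumes q: "qinv m h" and v: "vars h 52 = c" "vars h 56 = x" "vars h 57 = y" "x < NN" "y < NN" "vars h 50 = of_bool F0"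
  shows "wp scan (\<lambda>h'. vars h' 50 = of_bool (F0 \<or> (\<exists>i<n. \<exists>j<n. A i mod m = x \<and> A j mod m = y \<and> A i + A j = c)) \<and>
     clk h' \<le> clk h + (bucket A n m x * (bucket A n m y * 60 + 60) + 40)) h"
proof -
  note b = qinvD(1)[OF q]
  let ?c = "Assign 62 (Arr 8 (V 57)) ;; scan_inner ;; Assign 58 (Arr 9 (V 58))"
  let ?P = "\<lambda>i. A i mod m = x \<and> (\<exists>j<n. A j mod m = y \<and> A i + A j = c)"
  let ?F = "\<lambda>p. of_bool (F0 \<or> (\<exists>i<n. p \<le> i \<and> ?P i)) :: nat"
  let ?J = "\<lambda>t h. vars h 58 \<le> n \<and> bucket A (vars h 58) m x + t = bucket A n m x \<and>
     (0 < vars h 58 \<longrightarrow> A (vars h 58 - 1) mod m = x) \<and> vars h 50 = ?F (vars h 58)"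
  let ?Q = "\<lambda>h'. vars h' 50 = of_bool (F0 \<or> (\<exists>i<n. \<exists>j<n. A i mod m = x \<and> A j mod m = y \<and> A i + A j = c)) \<and>
     clk h' \<le> clk h + (bucket A n m x * (bucket A n m y * 60 + 60) + 40)"
  let ?t = "bucket A n m y * 60 + 30"
  define h0 where "h0 = h\<lparr>vars := (vars h)(58 := lastin A m x n, 59 := bucket A n m x, 60 := bucket A n m y), clk := clk h + 18\<rparr>"
  have q0: "qinv m h0" by (rule qinv_cong[OF q]) (simp_all add: h0_def)
  have bn: "bucket A n m z < 2 ^ w" for z using bucket_le[of n m z] zw(17) by linarith
  have w: "wp (For 61 (V 59) ?c) ?Q h0"
  proof (rule wp_For[where n = "bucket A n m x" and t = "\<lambda>_. ?t" and J = ?J])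
    fix t h1 assume t: "t < bucket A n m x" "?J t h1" "frame (For 61 (V 59) ?c) h0 h1" "vars h1 61 = t"
    have q1: "qinv m h1" using qinv_frame[OF q0 t(3)] by simp
    note b1 = qinvD(1)[OF q1]
    have v1: "vars h1 52 = c" "vars h1 57 = y" "vars h1 60 = bucket A n m y"
      using t(3) v by (simp_all add: frame_def h0_def)
    have "vars h1 58 \<noteq> 0" using t(1,2) by (intro notI) simp
    then obtain p where p: "vars h1 58 = Suc p" by (cases "vars h1 58") auto
    have pn: "p < n" and px: "A p mod m = x" using t(2) p by auto
    let ?p' = "lastin A m x p"
    note lp = lastin_props[of A m x p]
    have sp: "Suc p < 2 ^ w" "Suc p < Z" using pn zw(2,17) by linarith+
    define h2 where "h2 = h1\<lparr>vars := (vars h1)(62 := lastin A m y n), clk := clk h1 + 6\<rparr>"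
    have q2: "qinv m h2" by (rule qinv_cong[OF q1]) (simp_all add: h2_def)
    have F': "?F ?p' = of_bool ((F0 \<or> (\<exists>i<n. Suc p \<le> i \<and> ?P i)) \<or> (\<exists>j<n. A j mod m = y \<and> A p + A j = c))"
    proof -
      have "(\<exists>i<n. ?p' \<le> i \<and> ?P i) \<longleftrightarrow> (\<exists>i<n. Suc p \<le> i \<and> ?P i) \<or> ?P p"
        by (rule ex_from_lastin) (use lp pn in auto)
      then show ?thesis using px by auto
    qed
    have bs: "bucket A ?p' m x + Suc t = bucket A n m x" using lp t(2) p px by simp
    have g: "?p' \<le> n \<and> (0 < ?p' \<longrightarrow> A (?p' - Suc 0) mod m = x)" using lp pn by auto
    have v2: "vars h2 52 = c" "vars h2 58 = Suc p" "vars h2 60 = bucket A n m y" "vars h2 62 = lastin A m y n"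
      "vars h2 50 = of_bool (F0 \<or> (\<exists>i<n. Suc p \<le> i \<and> ?P i))"
      using v1 p t(2) by (simp_all add: h2_def)
    have w2: "wp (scan_inner ;; Assign 58 (Arr 9 (V 58))) (\<lambda>h'. ?J (Suc t) h' \<and> clk h' \<le> clk h1 + ?t) h2"
    proof (rule wp_Seq, rule wp_mono[OF scan_inner_spec[OF q2 v2(1,2) pn v2(3-5)]], elim conjE)
      fix h3 assume h3: "frame scan_inner h2 h3" "clk h3 \<le> clk h2 + (bucket A n m y * 60 + 8)"
        "vars h3 50 = of_bool ((F0 \<or> (\<exists>i<n. Suc p \<le> i \<and> ?P i)) \<or> (\<exists>j<n. A j mod m = y \<and> A p + A j = c))"
      have q3: "qinv m h3" using qinv_frame[OF q2 h3(1)] by simp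
      have v3: "vars h3 58 = Suc p" using h3(1) v2(2) by (simp add: frame_def)
      have n9: "arr h3 9 (Suc p) = ?p'" using qinvD(6)[OF q3 pn] px by simp
      have f3: "vars h3 50 = ?F ?p'" using h3(3) F' by simp
      show "wp (Assign 58 (Arr 9 (V 58))) (\<lambda>h'. ?J (Suc t) h' \<and> clk h' \<le> clk h1 + ?t) h3"
        using f3 h3(2) by (intro wp_Assign) (simp_all add: baseD[OF qinvD(1)[OF q3]] v3 n9 g bs[simplified] sp zw h2_def)
    qed
    have o: "y < Z" using v(5) zw by auto
    show "wp ?c (\<lambda>h'. ?J (Suc t) h' \<and> clk h' \<le> clk h1 + ?t) h1"
      by (rule wp_Seq, rule wp_Assign) (simp add: o v1 baseD[OF b1] zw, rule wp_eq[OF w2], rule hstate.equality,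
        simp_all add: h2_def v1 qinvD(5)[OF q1 v(5)])
  next
    fix h' assume J: "?J (bucket A n m x) h'" and clk: "clk h' \<le> clk h0 + (\<Sum>i<bucket A n m x. ?t + 12) + 8"
    have "vars h' 58 = 0"
    proof (rule ccontr)
      assume "vars h' 58 \<noteq> 0"
      then obtain p where "vars h' 58 = Suc p" by (cases "vars h' 58") auto
      then show False using J by auto
    qed
    moreover have "(\<exists>i<n. ?P i) \<longleftrightarrow> (\<exists>i<n. \<exists>j<n. A i mod m = x \<and> A j mod m = y \<and> A i + A j = c)" by blast
    moreover have "clk h' \<le> clk h + (bucket A n m x * (bucket A n m y * 60 + 60) + 40)"
      using clk by (simp add: h0_def algebra_simps)
    ultimately show "?Q h'" using J by simp
  next
    note lp = lastin_props[of A m x n]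
    have "(\<exists>i<n. lastin A m x n \<le> i \<and> ?P i) \<longleftrightarrow> False" using lp by blast
    then show "?J 0 h0" using lp v by (auto simp: h0_def)
  qed (simp_all add: h0_def bn)
  have o: "x < Z" "y < Z" using v(4,5) zw by auto
  show ?thesis unfolding scan_def
    by ((rule wp_Seq, rule wp_Assign, simp add: zw o v baseD[OF b])+, rule wp_eq[OF w], rule hstate.equality)
      (simp_all add: h0_def v qinvD(4,5)[OF q])
qed

end

text \<open>Variable 11 is the length of the output, two entries for each witness. Witnesses are
  indexed from 1 and residues from 0, hence the subtractions.\<close>

definition ask :: "program \<Rightarrow> com" where
  "ask Qry = Call Qry 53 ;; Assign 54 (Bin Div (V 11) (N 2)) ;;
     For 55 (V 54) (Assign 56 (Bin Sub (Arr 2 (Bin Mul (N 2) (V 55))) (N 1)) ;;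
       Assign 57 (Bin Sub (Arr 2 (Bin Add (Bin Mul (N 2) (V 55)) (N 1))) (N 1)) ;; scan)"

text \<open>Two residues whose sum is congruent to \<open>c\<close> add up to \<open>c mod m\<close>
  or to \<open>c mod m + m\<close>. Either case is one query, and the 2 comes from the shift by one
  of both indices.\<close>

definition ask_both :: "program \<Rightarrow> com" where
  "ask_both Qry = Assign 52 (Arr 0 (V 51)) ;; Assign 53 (Bin Add (Bin Mod (V 52) (V 12)) (N 2)) ;; ask Qry ;;
       Assign 53 (Bin Add (V 53) (V 12)) ;; ask Qry"

definition search :: "program \<Rightarrow> com" where
  "search Qry = Assign 50 (N 0) ;; For 51 (V 1) (If (V 50) Skip (ask_both Qry)) ;; Out (V 50)"

lemma mod_ask [simp]: "modv (ask Qry) = {11, 50, 54, 55, 56, 57, 58, 59, 60, 61, 62, 63}" "moda (ask Qry) = {1, 2}"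
  by (auto simp: ask_def)
lemma mod_ask_both [simp]: "modv (ask_both Qry) = {11, 50, 52, 53, 54, 55, 56, 57, 58, 59, 60, 61, 62, 63}"
  "moda (ask_both Qry) = {1, 2}"
  by (auto simp: ask_both_def)

text \<open>Each pair of input indices lies in the product of buckets of at most one witness, and
  each witness has nonempty buckets. Both the number of witnesses and the work of scanning their
  buckets are thus charged to the \<open>R\<close> pairs of indices.\<close>

lemma witnesses_sum:
  assumes X: "\<forall>x<N'. X ! x = of_bool (\<exists>i<n. A i mod m = x)" and m: "0 < m" "m \<le> N'"
    and W: "W = witnesses N' X X k"
  defines "R \<equiv> (\<Sum>i<n. \<Sum>j<n. of_bool (A i mod m + A j mod m + 2 = k) :: nat)"
  shows "finite W" "(\<Sum>(x, y)\<in>W. bucket A n m (x - 1) * bucket A n m (y - 1)) \<le> R" "card W \<le> R" "card W \<le> N'"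
    "\<And>x y. (x, y) \<in> W \<Longrightarrow> 1 \<le> bucket A n m (x - 1) \<and> 1 \<le> bucket A n m (y - 1) \<and> 1 \<le> x \<and> 1 \<le> y \<and> x - 1 < m \<and> y - 1 < m"
    "(\<exists>(x, y)\<in>W. \<exists>i<n. \<exists>j<n. A i mod m = x - 1 \<and> A j mod m = y - 1 \<and> A i + A j = c) \<longleftrightarrow>
     (\<exists>i<n. \<exists>j<n. A i mod m + A j mod m + 2 = k \<and> A i + A j = c)"
proof -
  have "W \<subseteq> {1..N'} \<times> {1..N'}" by (auto simp: W witnesses_def)
  then show fin: "finite W" by (rule finite_subset) auto
  have X': "X ! x = 1 \<longleftrightarrow> (\<exists>i<n. A i mod m = x)" if "x < N'" for x using X that by simp
  have mem: "(x, y) \<in> W \<longleftrightarrow> 1 \<le> x \<and> x \<le> N' \<and> 1 \<le> y \<and> y \<le> N' \<and> x + y = k \<and>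
      (\<exists>i<n. A i mod m = x - 1) \<and> (\<exists>i<n. A i mod m = y - 1)" for x y
    using X'[of "x - 1"] X'[of "y - 1"] by (auto simp: W witnesses_def)
  have pos: "1 \<le> bucket A n m x" if "\<exists>i<n. A i mod m = x" for x
  proof -
    from that obtain i where "i < n" "A i mod m = x" by blast
    then have "of_bool (A i mod m = x) \<le> bucket A n m x"
      unfolding bucket_def by (intro member_le_sum) auto
    then show ?thesis using \<open>A i mod m = x\<close> by simp
  qed
  show el: "1 \<le> bucket A n m (x - 1) \<and> 1 \<le> bucket A n m (y - 1) \<and> 1 \<le> x \<and> 1 \<le> y \<and> x - 1 < m \<and> y - 1 < m"
    if "(x, y) \<in> W" for x y
    using that pos[of "x - 1"] pos[of "y - 1"] m(1) unfolding mem by (metis mod_less_divisor)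
  have "(\<Sum>(x, y)\<in>W. bucket A n m (x - 1) * bucket A n m (y - 1)) =
     (\<Sum>w\<in>W. \<Sum>i<n. \<Sum>j<n. of_bool (A i mod m = fst w - 1) * of_bool (A j mod m = snd w - 1))"
    by (intro sum.cong refl) (simp only: case_prod_beta bucket_def sum_product)
  also have "\<dots> = (\<Sum>i<n. \<Sum>j<n. \<Sum>w\<in>W. of_bool (A i mod m = fst w - 1) * of_bool (A j mod m = snd w - 1))"
    by (subst sum.swap, rule sum.cong[OF refl], rule sum.swap)
  also have "\<dots> \<le> R" unfolding R_def
  proof (intro sum_mono)
    fix i j
    let ?S = "{w \<in> W. A i mod m = fst w - 1 \<and> A j mod m = snd w - 1}"
    have "(\<Sum>w\<in>W. of_bool (A i mod m = fst w - 1) * of_bool (A j mod m = snd w - 1)) = (card ?S :: nat)"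
      using fin by (simp only: of_bool_conj[symmetric]) (simp add: of_bool_def sum.If_cases Int_def)
    also have "\<dots> \<le> of_bool (A i mod m + A j mod m + 2 = k)"
    proof (cases "?S = {}")
      case False
      have sub: "?S \<subseteq> {(A i mod m + 1, A j mod m + 1)}" using mem by auto
      then have "card ?S \<le> 1" using card_mono[OF _ sub] by simp
      moreover have "A i mod m + A j mod m + 2 = k" using False mem by auto
      ultimately show ?thesis by simp
    next
      case True
      have "card ?S = 0" unfolding True by simp
      then show ?thesis by simp
    qed
    finally show "(\<Sum>w\<in>W. of_bool (A i mod m = fst w - 1) * of_bool (A j mod m = snd w - 1))
      \<le> (of_bool (A i mod m + A j mod m + 2 = k) :: nat)" .
  qed
  finally show le: "(\<Sum>(x, y)\<in>W. bucket A n m (x - 1) * bucket A n m (y - 1)) \<le> R" .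
  have "card W = (\<Sum>w\<in>W. 1)" by simp
  also have "\<dots> \<le> (\<Sum>(x, y)\<in>W. bucket A n m (x - 1) * bucket A n m (y - 1))"
    using el by (intro sum_mono) (auto simp: Suc_le_eq)
  finally show "card W \<le> R" using le by linarith
  \<comment> \<open>The second component is determined by the fixed sum \<open>k\<close>. The
    resulting bound limits the length of the output of a query.\<close>
  have "inj_on fst W" using mem by (auto simp: inj_on_def)
  moreover have "fst ` W \<subseteq> {1..N'}" using mem by auto
  ultimately have "card W \<le> card {1..N'}" by (intro card_inj_on_le) auto
  then show "card W \<le> N'" by simp
  show "(\<exists>(x, y)\<in>W. \<exists>i<n. \<exists>j<n. A i mod m = x - 1 \<and> A j mod m = y - 1 \<and> A i + A j = c) \<longleftrightarrow>
     (\<exists>i<n. \<exists>j<n. A i mod m + A j mod m + 2 = k \<and> A i + A j = c)"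
  proof
    assume "\<exists>(x, y)\<in>W. \<exists>i<n. \<exists>j<n. A i mod m = x - 1 \<and> A j mod m = y - 1 \<and> A i + A j = c"
    then obtain x y i j where xy: "(x, y) \<in> W" "i < n" "j < n" "A i mod m = x - 1" "A j mod m = y - 1" "A i + A j = c"
      by blast
    then have "1 \<le> x" "1 \<le> y" "x + y = k" using mem by simp_all
    then have "A i mod m + A j mod m + 2 = k" unfolding xy(4,5) by linarith
    then show "\<exists>i<n. \<exists>j<n. A i mod m + A j mod m + 2 = k \<and> A i + A j = c" using xy by blast
  next
    assume "\<exists>i<n. \<exists>j<n. A i mod m + A j mod m + 2 = k \<and> A i + A j = c"
    then obtain i j where ij: "i < n" "j < n" "A i mod m + A j mod m + 2 = k" "A i + A j = c" by blast
    have "A i mod m < N'" "A j mod m < N'" using m by (meson less_le_trans mod_less_divisor)+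
    then have "(A i mod m + 1, A j mod m + 1) \<in> W" unfolding mem using ij by auto
    then show "\<exists>(x, y)\<in>W. \<exists>i<n. \<exists>j<n. A i mod m = x - 1 \<and> A j mod m = y - 1 \<and> A i + A j = c"
      using ij by (intro bexI[of _ "(A i mod m + 1, A j mod m + 1)"]) auto
  qed
qed

lemma nth_concat_pairs:
  assumes "p < length ws"
  shows "concat (map (\<lambda>(i, j). [i, j]) ws) ! (2 * p) = fst (ws ! p)"
    "concat (map (\<lambda>(i, j). [i, j]) ws) ! (2 * p + 1) = snd (ws ! p)"
  using assms
proof (induction ws arbitrary: p)
  case (Cons w ws)
  { case 1 then show ?case using Cons.IH(1)[of "p - 1"] by (cases p) (auto simp: case_prod_beta) }
  { case 2 then show ?case using Cons.IH(2)[of "p - 1"] by (cases p) (auto simp: case_prod_beta) }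
qed auto

lemma length_concat_pairs: "length (concat (map (\<lambda>(i, j). [i, j]) ws)) = 2 * length ws"
  by (induction ws) (auto simp: case_prod_beta)

context ram begin

lemma bnd_halts:
  assumes "halts_within wd P (start a M) t s" "a < 2 ^ wd" "\<forall>i. M i < 2 ^ wd"
  shows "\<forall>i. mem s i < 2 ^ wd"
proof -
  have "bnd (start a M)" using assms(2,3) wd(1) by (auto simp: bnd_def start_def)
  from bnd_steps[OF this, where P = P and t = t] show ?thesis using assms(1) by (auto simp: halts_within_def bnd_def)
qed

end

text \<open>The data structure at the single size \<open>2 * NN\<close>, with the same vector on
  both sides. By \<open>wdN\<close> the query indices and the length of every answer, at most
  \<open>4 * NN\<close>, are below \<open>2 ^ wd\<close>.\<close>

locale prog_ds = prog w Z wd d X r b Q n A Y K NN H for w Z wd d X r b Q n :: nat and A :: "nat \<Rightarrow> nat" and Y K NN H :: nat +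
  fixes Pre Qry :: program and pn qn :: nat
  assumes wdN: "8 * NN < 2 ^ wd"
    and A_inj: "inj_on A {..<n}"
    and ds_pre: "\<And>B. bit_vector (2 * NN) B \<Longrightarrow>
      \<exists>t s. halts_within wd Pre (start (2 * NN) (mem_of (B @ B))) t s \<and> t \<le> pn"
    and ds_qry: "\<And>B M k. bit_vector (2 * NN) B \<Longrightarrow> ds_memory wd Pre Qry (2 * NN) B B M \<Longrightarrow> k \<in> {1..2 * (2 * NN)} \<Longrightarrow>
      \<exists>t s ws. halts_within wd Qry (start k M) t s \<and> distinct ws \<and> set ws = witnesses (2 * NN) B B k \<and>
        out s = concat (map (\<lambda>(i, j). [i, j]) ws) \<and> t \<le> qn * (1 + card (witnesses (2 * NN) B B k))"
begin

definition pairs :: "nat \<Rightarrow> nat \<Rightarrow> nat" where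
  "pairs m k = (\<Sum>i<n. \<Sum>j<n. of_bool (A i mod m + A j mod m + 2 = k))"

text \<open>A query may rewrite the memory, so only reachability by preprocessing and queries is
  maintained. The bound on the cells is the precondition of the next simulated call.\<close>

definition dsinv :: "nat \<Rightarrow> hstate \<Rightarrow> bool" where
  "dsinv m h \<longleftrightarrow> ds_memory wd Pre Qry (2 * NN) (bits m) (bits m) (arr h 1) \<and> (\<forall>i. arr h 1 i < 2 ^ wd)"

lemma bits_vector: "bit_vector (2 * NN) (bits m)"
  by (auto simp: bit_vector_def bits_def)

lemma bits_nth: "\<forall>x<2 * NN. bits m ! x = of_bool (\<exists>i<n. A i mod m = x)"
  by (simp add: bits_def)

lemma ask_spec:
  assumes q: "qinv m h" and m: "1 \<le> m" "m \<le> NN" and v: "vars h 52 = c" "vars h 53 = k" "vars h 50 = of_bool F0"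
    and k: "k \<in> {1..2 * (2 * NN)}" and ds: "dsinv m h"
  shows "wp (ask Qry) (\<lambda>h'. vars h' 50 = of_bool (F0 \<or> (\<exists>i<n. \<exists>j<n. A i mod m + A j mod m + 2 = k \<and> A i + A j = c)) \<and>
     dsinv m h' \<and> clk h' \<le> clk h + (num_regs Qry + 5 * (qn * (1 + pairs m k)) + 350 * pairs m k + 30)) h"
proof -
  obtain t s ws where ts: "halts_within wd Qry (start k (arr h 1)) t s" "distinct ws"
    "set ws = witnesses (2 * NN) (bits m) (bits m) k" "out s = concat (map (\<lambda>(i, j). [i, j]) ws)"
    "t \<le> qn * (1 + card (witnesses (2 * NN) (bits m) (bits m) k))"
  proof -
    have "ds_memory wd Pre Qry (2 * NN) (bits m) (bits m) (arr h 1)" using ds by (simp add: dsinv_def)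
    from ds_qry[OF bits_vector this k] show ?thesis using that by blast
  qed
  have m2: "0 < m" "m \<le> 2 * NN" using m by auto
  note W = witnesses_sum[OF bits_nth[of m] m2 ts(3), folded pairs_def]
  have cw: "card (witnesses (2 * NN) (bits m) (bits m) k) \<le> pairs m k" using W(3) unfolding ts(3) .
  have lw: "length ws \<le> 2 * NN" using W(4) distinct_card[OF ts(2)] by simp
  have lo: "length (out s) = 2 * length ws" unfolding ts(4) by (rule length_concat_pairs)
  have loZ: "length (out s) < Z" "length (out s) < 2 ^ w" "length ws < 2 ^ w"
    using lo lw wdN wd(2) Z by linarith+
  define h1 where "h1 = h\<lparr>vars := (vars h)(11 := length (out s)),
      arr := (arr h)(1 := mem s, 2 := (\<lambda>i. if i < length (out s) then out s ! i else arr h 2 i)),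
      clk := clk h + (num_regs Qry + 2 + 5 * t)\<rparr>"
  have q1: "qinv m h1" by (rule qinv_cong[OF q]) (simp_all add: h1_def)
  have b: "\<forall>i. mem s i < 2 ^ wd" by (rule bnd_halts[OF ts(1)]) (use k wdN ds in \<open>auto simp: dsinv_def\<close>)
  have ds1: "dsinv m h1" unfolding dsinv_def using b ds ds_memory.query[OF _ k ts(1)] by (simp add: h1_def dsinv_def)
  let ?c = "Assign 56 (Bin Sub (Arr 2 (Bin Mul (N 2) (V 55))) (N 1)) ;;
       Assign 57 (Bin Sub (Arr 2 (Bin Add (Bin Mul (N 2) (V 55)) (N 1))) (N 1)) ;; scan"
  let ?P = "\<lambda>(x, y). \<exists>i<n. \<exists>j<n. A i mod m = x - 1 \<and> A j mod m = y - 1 \<and> A i + A j = c"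
  let ?J = "\<lambda>p h. vars h 50 = of_bool (F0 \<or> (\<exists>w\<in>set (take p ws). ?P w))"
  let ?B = "\<lambda>(x, y). bucket A n m (x - 1) * bucket A n m (y - 1)"
  \<comment> \<open>Reading a witness and scanning its buckets, of sizes x and y, costs at most 60xy
    + 60x + 62. Both sizes are at least 1, so this is below 250xy.\<close>
  let ?t = "\<lambda>p. 250 * ?B (ws ! p)"
  let ?Q = "\<lambda>h'. vars h' 50 = of_bool (F0 \<or> (\<exists>i<n. \<exists>j<n. A i mod m + A j mod m + 2 = k \<and> A i + A j = c)) \<and>
     dsinv m h' \<and> clk h' \<le> clk h + (num_regs Qry + 5 * (qn * (1 + pairs m k)) + 350 * pairs m k + 30)"
  define h2 where "h2 = h1\<lparr>vars := (vars h1)(54 := length ws), clk := clk h1 + 4\<rparr>"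
  have q2: "qinv m h2" by (rule qinv_cong[OF q1]) (simp_all add: h2_def)
  have w2: "wp (For 55 (V 54) ?c) ?Q h2"
  proof (rule wp_For[where n = "length ws" and t = ?t and J = ?J])
    fix p h3 assume p: "p < length ws" "?J p h3" "frame (For 55 (V 54) ?c) h2 h3" "vars h3 55 = p"
    have q3: "qinv m h3" using qinv_frame[OF q2 p(3)] by simp
    note b3 = qinvD(1)[OF q3]
    obtain x y where xy: "ws ! p = (x, y)" by (cases "ws ! p")
    have xyW: "(x, y) \<in> set ws" using p(1) xy by (metis nth_mem)
    note el = W(5)[OF xyW]
    have v3: "vars h3 52 = c" "arr h3 2 (2 * p) = x" "arr h3 2 (Suc (2 * p)) = y"
      using p(1,3) v xy lo nth_concat_pairs[OF p(1)] by (simp_all add: frame_def h2_def h1_def ts(4)[symmetric])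
    define h4 where "h4 = h3\<lparr>vars := (vars h3)(56 := x - 1, 57 := y - 1), clk := clk h3 + 22\<rparr>"
    have q4: "qinv m h4" by (rule qinv_cong[OF q3]) (simp_all add: h4_def)
    have pw: "2 * p < Z" "Suc (2 * p) < Z" "2 * p < 2 ^ w" "Suc (2 * p) < 2 ^ w" "(2::nat) < 2 ^ w"
      using p(1) loZ lo zw(7) r2b two_le_b by (auto intro!: Zw)
    have xw: "x < 2 ^ w" "y < 2 ^ w" using el m zw(19) by linarith+
    have xN: "x - 1 < NN" "y - 1 < NN" using el m(2) by linarith+
    have v4: "vars h4 52 = c" "vars h4 56 = x - 1" "vars h4 57 = y - 1" "x - 1 < NN" "y - 1 < NN"
      "vars h4 50 = of_bool (F0 \<or> (\<exists>w\<in>set (take p ws). ?P w))"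
      using v3 xN p(2) by (simp_all add: h4_def)
    have w4: "wp scan (\<lambda>h'. ?J (Suc p) h' \<and> clk h' \<le> clk h3 + ?t p) h4"
    proof (rule wp_mono[OF scan_spec[OF q4 v4]], elim conjE, intro conjI)
      fix h5 assume h5: "vars h5 50 = of_bool ((F0 \<or> (\<exists>w\<in>set (take p ws). ?P w)) \<or>
          (\<exists>i<n. \<exists>j<n. A i mod m = x - 1 \<and> A j mod m = y - 1 \<and> A i + A j = c))"
        "clk h5 \<le> clk h4 + (bucket A n m (x - 1) * (bucket A n m (y - 1) * 60 + 60) + 40)"
      have "set (take (Suc p) ws) = insert (x, y) (set (take p ws))"
        using p(1) xy by (simp add: take_Suc_conv_app_nth)
      then show "?J (Suc p) h5" using h5(1) by (simp add: disj_commute disj_left_commute)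
      let ?bx = "bucket A n m (x - 1)" and ?by = "bucket A n m (y - 1)"
      have s1: "?bx \<le> ?bx * ?by" using mult_le_mono2[of 1 ?by ?bx] el by (simp only: mult_1_right)
      have s2: "1 \<le> ?bx * ?by" using el by simp
      have s3: "?bx * (?by * 60 + 60) = 60 * (?bx * ?by) + 60 * ?bx" by (simp add: algebra_simps)
      have s4: "?t p = 250 * (?bx * ?by)" by (simp add: xy)
      have s5: "clk h4 = clk h3 + 22" by (simp add: h4_def)
      show "clk h5 \<le> clk h3 + ?t p" using h5(2) s1 s2 unfolding s3 s4 s5 by linarith
    qed
    show "wp ?c (\<lambda>h'. ?J (Suc p) h' \<and> clk h' \<le> clk h3 + ?t p) h3"
      by ((rule wp_Seq, rule wp_Assign, simp add: zw pw p(4) v3 el el[simplified] xw baseD[OF b3])+, rule wp_eq[OF w4], rule hstate.equality)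
        (simp_all add: h4_def v3 p(4))
  next
    fix h' assume J: "?J (length ws) h'" and f: "frame (For 55 (V 54) ?c) h2 h'"
      and clk: "clk h' \<le> clk h2 + (\<Sum>i<length ws. ?t i + 12) + 8"
    have len: "length ws \<le> pairs m k" using W(3) distinct_card[OF ts(2)] by simp
    have "(\<Sum>i<length ws. ?B (ws ! i)) = sum_list (map ?B ws)"
      by (simp only: sum_list_sum_nth length_map lessThan_atLeast0) (intro sum.cong refl, simp)
    also have "\<dots> = (\<Sum>w\<in>set ws. ?B w)" using ts(2) by (rule sum_list_distinct_conv_sum_set)
    also have "\<dots> \<le> pairs m k" using W(2) by simp
    finally have "(\<Sum>i<length ws. ?B (ws ! i)) \<le> pairs m k" .
    moreover have "(\<Sum>i<length ws. ?t i + 12) = 250 * (\<Sum>i<length ws. ?B (ws ! i)) + 12 * length ws"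
      by (simp add: sum.distrib sum_distrib_left)
    moreover have "5 * t \<le> 5 * (qn * (1 + pairs m k))"
      using ts(5) mult_le_mono2[OF add_le_mono[OF le_refl cw], of qn 1] by linarith
    ultimately have "clk h' \<le> clk h + (num_regs Qry + 5 * (qn * (1 + pairs m k)) + 350 * pairs m k + 30)"
      using clk len by (simp add: h2_def h1_def)
    moreover have "dsinv m h'" using ds1 f by (simp add: dsinv_def frame_def h2_def)
    moreover have "(\<exists>w\<in>set (take (length ws) ws). ?P w) \<longleftrightarrow> (\<exists>i<n. \<exists>j<n. A i mod m + A j mod m + 2 = k \<and> A i + A j = c)"
      using W(6)[where c = c] by (simp only: take_all[OF order_refl])
    ultimately show "?Q h'" using J by simp
  qed (use v in \<open>simp_all add: h2_def h1_def loZ\<close>)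
  have w1: "wp (Assign 54 (Bin Div (V 11) (N 2)) ;; For 55 (V 54) ?c) ?Q h1"
    by (rule wp_Seq, rule wp_Assign) (use loZ zw(7) r2b two_le_b in \<open>simp add: Zw\<close>, rule wp_eq[OF w2], rule hstate.equality,
      simp_all add: h2_def h1_def lo)
  show ?thesis unfolding ask_def
  proof (rule wp_Seq, rule wp_Call)
    show "halts_within wd Qry (start (vars h 53) (arr h 1)) t s" using ts(1) v by simp
    show "wp (Assign 54 (Bin Div (V 11) (N 2)) ;; For 55 (V 54) ?c) ?Q (h\<lparr>vars := (vars h)(11 := length (out s)),
      arr := (arr h)(1 := mem s, 2 := (\<lambda>i. if i < length (out s) then out s ! i else arr h 2 i)),
      clk := clk h + (num_regs Qry + 2 + 5 * t)\<rparr>)" using w1 unfolding h1_def .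
  qed (use q ds k wdN v loZ in \<open>auto simp: qinvD baseD dsinv_def\<close>)
qed

definition sol :: "nat \<Rightarrow> bool" where
  "sol l \<longleftrightarrow> (\<exists>i<n. \<exists>j<n. A i + A j = A l)"

definition hits :: "nat \<Rightarrow> nat \<Rightarrow> nat" where
  "hits m l = (\<Sum>i<n. \<Sum>j<n. of_bool ((A i + A j) mod m = A l mod m))"

text \<open>The sum of two residues is below 2m and wraps around at most once, which is why two
  queries per number suffice.\<close>

lemma mod_add_cases:
  assumes "0 < (m::nat)"
  shows "(x + y) mod m = z mod m \<longleftrightarrow> x mod m + y mod m = z mod m \<or> x mod m + y mod m = z mod m + m"
proof -
  have l: "x mod m < m" "y mod m < m" "z mod m < m" using assms by auto
  have e: "(x + y) mod m = (x mod m + y mod m) mod m" by (simp add: mod_add_eq)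
  show ?thesis
  proof (cases "x mod m + y mod m < m")
    case True
    then show ?thesis unfolding e by auto
  next
    case False
    then obtain t where t: "x mod m + y mod m = m + t" by (metis le_iff_add not_less)
    then have "t < m" using l by linarith
    moreover have "m + t \<noteq> z mod m" using l by linarith
    ultimately show ?thesis unfolding e t by auto
  qed
qed

lemma pairs_hits:
  assumes "0 < m"
  shows "pairs m (A l mod m + 2) + pairs m (A l mod m + 2 + m) \<le> hits m l"
  unfolding pairs_def hits_def sum.distrib[symmetric]
  by (intro sum_mono) (use assms in \<open>auto simp: mod_add_cases[OF assms]\<close>)

lemma pairs_sol:
  assumes "0 < m"
  shows "(\<exists>i<n. \<exists>j<n. A i mod m + A j mod m + 2 = A l mod m + 2 \<and> A i + A j = A l) \<or>
    (\<exists>i<n. \<exists>j<n. A i mod m + A j mod m + 2 = A l mod m + 2 + m \<and> A i + A j = A l) \<longleftrightarrow> sol l"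
proof -
  have "A i mod m + A j mod m = A l mod m \<or> A i mod m + A j mod m = A l mod m + m" if "A i + A j = A l" for i j
    using mod_add_cases[OF assms, of "A i" "A j" "A l"] that by simp
  then have c: "A i mod m + A j mod m + 2 = A l mod m + 2 \<or> A i mod m + A j mod m + 2 = A l mod m + 2 + m"
    if "A i + A j = A l" for i j using that by fastforce
  show ?thesis
  proof
    assume "sol l"
    then obtain i j where ij: "i < n" "j < n" "A i + A j = A l" by (auto simp: sol_def)
    then show "(\<exists>i<n. \<exists>j<n. A i mod m + A j mod m + 2 = A l mod m + 2 \<and> A i + A j = A l) \<or>
      (\<exists>i<n. \<exists>j<n. A i mod m + A j mod m + 2 = A l mod m + 2 + m \<and> A i + A j = A l)"
      using c[OF ij(3)] by blast
  qed (unfold sol_def, blast)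
qed

lemma ask_both_spec:
  assumes q: "qinv m h" and m: "1 \<le> m" "m \<le> NN" and v: "vars h 51 = l" "l < n" "vars h 50 = 0" and ds: "dsinv m h"
  shows "wp (ask_both Qry) (\<lambda>h'. (vars h' 50 = of_bool (sol l) \<and> dsinv m h') \<and>
    clk h' \<le> clk h + (2 * num_regs Qry + (5 * qn + 350) * (2 + hits m l))) h"
proof -
  note b = qinvD(1)[OF q]
  let ?k = "A l mod m + 2"
  let ?Q = "\<lambda>h'. (vars h' 50 = of_bool (sol l) \<and> dsinv m h') \<and>
    clk h' \<le> clk h + (2 * num_regs Qry + (5 * qn + 350) * (2 + hits m l))"
  let ?S = "\<lambda>k. \<exists>i<n. \<exists>j<n. A i mod m + A j mod m + 2 = k \<and> A i + A j = A l"
  have lm: "A l mod m < m" using m by simp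
  have "?k \<le> 2 * (2 * NN)" "?k + m \<le> 2 * (2 * NN)" using lm m by linarith+
  then have km: "?k \<in> {1..2 * (2 * NN)}" "?k + m \<in> {1..2 * (2 * NN)}" by simp_all
  have kZ: "?k < Z" "?k + m < Z" "2 < Z" "l < Z" using lm m zw(13) v(2) zw(2) wdN wd(2) by linarith+
  note ko = kZ(4) kZ(1-3)[THEN Zw]
  define h1 where "h1 = h\<lparr>vars := (vars h)(52 := A l, 53 := ?k), clk := clk h + 12\<rparr>"
  have q1: "qinv m h1" by (rule qinv_cong[OF q]) (simp_all add: h1_def)
  have v1: "vars h1 52 = A l" "vars h1 53 = ?k" "vars h1 50 = of_bool False" "dsinv m h1"
    using v ds by (simp_all add: h1_def dsinv_def)
  let ?r = "Assign 53 (Bin Add (V 53) (V 12)) ;; ask Qry"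
  have w1: "wp (ask Qry ;; ?r) ?Q h1"
  proof (rule wp_Seq, rule wp_mono[OF ask_spec[OF q1 m v1(1-3) km(1) v1(4)]], elim conjE)
    fix h2 assume h2: "frame (ask Qry) h1 h2" "vars h2 50 = of_bool (False \<or> ?S ?k)" "dsinv m h2"
      "clk h2 \<le> clk h1 + (num_regs Qry + 5 * (qn * (1 + pairs m ?k)) + 350 * pairs m ?k + 30)"
    have q2: "qinv m h2" using qinv_frame[OF q1 h2(1)] by simp
    define h3 where "h3 = h2\<lparr>vars := (vars h2)(53 := ?k + m), clk := clk h2 + 4\<rparr>"
    have q3: "qinv m h3" by (rule qinv_cong[OF q2]) (simp_all add: h3_def)
    have v2: "vars h2 53 = ?k" "vars h2 52 = A l" using h2(1) v1 by (simp_all add: frame_def)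
    have v3: "vars h3 52 = A l" "vars h3 53 = ?k + m" "vars h3 50 = of_bool (False \<or> ?S ?k)" "dsinv m h3"
      using v2 h2 by (simp_all add: h3_def dsinv_def)
    have w3: "wp (ask Qry) ?Q h3"
    proof (rule wp_mono[OF ask_spec[OF q3 m v3(1-3) km(2) v3(4)]], elim conjE)
      fix h4 assume h4: "vars h4 50 = of_bool ((False \<or> ?S ?k) \<or> ?S (?k + m))" "dsinv m h4"
        "clk h4 \<le> clk h3 + (num_regs Qry + 5 * (qn * (1 + pairs m (?k + m))) + 350 * pairs m (?k + m) + 30)"
      let ?p = "pairs m ?k" and ?p' = "pairs m (?k + m)"
      have ph: "?p + ?p' \<le> hits m l" using pairs_hits[of m l] m by simp
      have "qn * (1 + ?p) + qn * (1 + ?p') = qn * (2 + (?p + ?p'))" by (simp add: algebra_simps)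
      also have "\<dots> \<le> qn * (2 + hits m l)" using ph by (intro mult_le_mono2) auto
      finally have "clk h4 \<le> clk h + (2 * num_regs Qry + 5 * (qn * (2 + hits m l)) + 350 * (2 + hits m l))"
        using h4(3) h2(4) ph by (simp add: h3_def h1_def)
      then have "clk h4 \<le> clk h + (2 * num_regs Qry + (5 * qn + 350) * (2 + hits m l))" by (simp add: add_mult_distrib mult.assoc)
      moreover have "((False \<or> ?S ?k) \<or> ?S (?k + m)) \<longleftrightarrow> sol l" using pairs_sol[of m l] m by simp
      ultimately show "?Q h4" using h4(1,2) by simp
    qed
    show "wp ?r ?Q h2"
      by (rule wp_Seq, rule wp_Assign) (use ko in \<open>simp add: v2 qinvD(3)[OF q2]\<close>, rule wp_eq[OF w3], rule hstate.equality,
        simp_all add: h3_def v2 qinvD(3)[OF q2])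
  qed
  show ?thesis unfolding ask_both_def
    by ((rule wp_Seq, rule wp_Assign, simp add: zw ko[simplified] v baseD[OF b] qinvD(3)[OF q])+, rule wp_eq[OF w1], rule hstate.equality)
      (simp_all add: h1_def v baseD[OF b] qinvD(3)[OF q])
qed

text \<open>Up to the first solved \<open>l\<close>, all false pairs together are at most
  \<open>false_sols A n m\<close>. True pairs occur only at that \<open>l\<close> itself, and there
  are at most \<open>n\<close> of them because distinct entries leave one \<open>j\<close> for each
  \<open>i\<close>.\<close>

lemma sum_hits:
  "(\<Sum>l<n. if \<exists>l'<l. sol l' then 0 else hits m l) \<le> false_sols A n m + n"
proof -
  let ?f = "\<lambda>l. \<Sum>i<n. \<Sum>j<n. of_bool (A i + A j \<noteq> A l \<and> (A i + A j) mod m = A l mod m) :: nat"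
  let ?t = "\<lambda>l. \<Sum>i<n. \<Sum>j<n. of_bool (A i + A j = A l) :: nat"
  have ht: "hits m l = ?f l + ?t l" for l
    unfolding hits_def sum.distrib[symmetric] by (intro sum.cong refl) auto
  have tn: "?t l \<le> n" for l
  proof -
    have "(\<Sum>j<n. of_bool (A i + A j = A l)) \<le> (1::nat)" for i
    proof -
      have "(\<Sum>j<n. of_bool (A i + A j = A l)) = (card {j. j < n \<and> A i + A j = A l} :: nat)"
        by (simp add: of_bool_def sum.If_cases Int_def)
      also have "\<dots> \<le> 1"
      proof (rule card_le_Suc0_iff_eq[THEN iffD2, simplified One_nat_def[symmetric]])
        show "\<forall>a\<in>{j. j < n \<and> A i + A j = A l}. \<forall>b\<in>{j. j < n \<and> A i + A j = A l}. a = b"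
          using A_inj by (auto simp: inj_on_def)
      qed simp
      finally show ?thesis .
    qed
    then have "?t l \<le> (\<Sum>i<n. 1)" by (intro sum_mono)
    then show ?thesis by simp
  qed
  have t0: "?t l = 0" if "\<not> sol l" for l using that by (auto simp: sol_def)
  \<comment> \<open>Stated for every prefix: the bound is 0 until the first solution, jumps to
    \<open>n\<close> there, and stays because all later terms vanish.\<close>
  have "(\<Sum>l<N'. if \<exists>l'<l. sol l' then 0 else ?t l) \<le> (if \<exists>l<N'. sol l then n else 0)" for N'
  proof (induction N')
    case (Suc N')
    show ?case
    proof (cases "\<exists>l<N'. sol l")
      case True
      then show ?thesis using Suc by (auto simp: less_Suc_eq)
    next
      case False
      then have "(\<Sum>l<N'. if \<exists>l'<l. sol l' then 0 else ?t l) = 0"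
      proof (intro sum.neutral ballI)
        fix l assume "l \<in> {..<N'}"
        then have "\<not> sol l" using False by blast
        then have z: "?t l = 0" by (rule t0)
        show "(if \<exists>l'<l. sol l' then 0 else ?t l) = 0" unfolding z by simp
      qed
      then show ?thesis using False tn[of N'] t0[of N'] by (auto simp: less_Suc_eq)
    qed
  qed simp
  from this[of n] have "(\<Sum>l<n. if \<exists>l'<l. sol l' then 0 else ?t l) \<le> n" by (auto split: if_splits)
  moreover have "(\<Sum>l<n. ?f l) = false_sols A n m" unfolding false_sols_def
    by (subst sum.swap, rule sum.cong[OF refl], rule sum.swap)
  moreover have "(\<Sum>l<n. if \<exists>l'<l. sol l' then 0 else hits m l) \<le>
      (\<Sum>l<n. ?f l + (if \<exists>l'<l. sol l' then 0 else ?t l))"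
    by (intro sum_mono) (auto simp: ht)
  ultimately show ?thesis by (simp add: sum.distrib)
qed

lemma search_spec:
  assumes q: "qinv m h" and m: "1 \<le> m" "m \<le> NN" and ds: "dsinv m h" and o: "outs h = []"
  shows "wp (search Qry) (\<lambda>h'. outs h' = [of_bool (\<exists>l<n. sol l)] \<and>
    clk h' \<le> clk h + (n * (2 * num_regs Qry + 20) + (5 * qn + 350) * (3 * n + false_sols A n m) + 20)) h"
proof -
  let ?c = "If (V 50) Skip (ask_both Qry)"
  let ?J = "\<lambda>i h. vars h 50 = of_bool (\<exists>l<i. sol l) \<and> dsinv m h"
  let ?t = "\<lambda>i. if \<exists>l<i. sol l then 4 else 2 * num_regs Qry + (5 * qn + 350) * (2 + hits m i) + 4"
  let ?Q = "\<lambda>h'. outs h' = [of_bool (\<exists>l<n. sol l)] \<and>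
    clk h' \<le> clk h + (n * (2 * num_regs Qry + 20) + (5 * qn + 350) * (3 * n + false_sols A n m) + 20)"
  define h0 where "h0 = h\<lparr>vars := (vars h)(50 := 0), clk := clk h + 2\<rparr>"
  have q0: "qinv m h0" by (rule qinv_cong[OF q]) (simp_all add: h0_def)
  have sil: "silent (For 51 (V 1) ?c)" by (simp add: ask_both_def ask_def scan_def scan_inner_def)
  have w0: "wp (For 51 (V 1) ?c ;; Out (V 50)) ?Q h0"
  proof (rule wp_Seq, rule wp_For[where n = n and t = ?t and J = ?J])
    fix i h1 assume i: "i < n" "?J i h1" "frame (For 51 (V 1) ?c) h0 h1" "vars h1 51 = i"
    have q1: "qinv m h1" using qinv_frame[OF q0 i(3)] by simp
    show "wp ?c (\<lambda>h'. ?J (Suc i) h' \<and> clk h' \<le> clk h1 + ?t i) h1"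
    proof (rule wp_If)
      show "ok (V 50) h1" by simp
    next
      assume "eval (V 50) h1 \<noteq> 0"
      then show "wp Skip (\<lambda>h'. ?J (Suc i) h' \<and> clk h' \<le> clk h1 + ?t i) (tick (cost (V 50) + 1) h1)"
        using i(2) by (intro wp_Skip) (auto simp: less_Suc_eq dsinv_def)
    next
      assume "eval (V 50) h1 = 0"
      then have e: "vars h1 50 = 0" "\<not> (\<exists>l<i. sol l)" using i(2) by auto
      have q2: "qinv m (tick (cost (V 50) + 3) h1)" by (rule qinv_cong[OF q1]) simp_all
      show "wp (ask_both Qry) (\<lambda>h'. ?J (Suc i) h' \<and> clk h' \<le> clk h1 + ?t i) (tick (cost (V 50) + 3) h1)"
        by (rule wp_mono[OF ask_both_spec[OF q2 m, of i]]) (use i e in \<open>auto simp: dsinv_def less_Suc_eq\<close>)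
    qed
  next
    fix h1 assume h1: "?J n h1" "frame (For 51 (V 1) ?c) h0 h1" "clk h1 \<le> clk h0 + (\<Sum>i<n. ?t i + 12) + 8"
    have o1: "outs h1 = []" using h1(2) sil o by (simp add: frame_def h0_def)
    let ?G = "5 * qn + 350"
    have "(\<Sum>i<n. ?t i + 12) \<le> (\<Sum>i<n. (2 * num_regs Qry + 16 + ?G * 2) + ?G * (if \<exists>l<i. sol l then 0 else hits m i))"
      by (intro sum_mono) (auto simp: add_mult_distrib2)
    also have "\<dots> = n * (2 * num_regs Qry + 16 + ?G * 2) + ?G * (\<Sum>i<n. if \<exists>l<i. sol l then 0 else hits m i)"
      by (simp only: sum.distrib sum_constant card_lessThan sum_distrib_left of_nat_id distrib_left)
    also have "\<dots> \<le> n * (2 * num_regs Qry + 16 + ?G * 2) + ?G * (false_sols A n m + n)"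
      by (intro add_left_mono mult_le_mono2 sum_hits)
    also have "\<dots> = n * (2 * num_regs Qry + 16) + ?G * (3 * n + false_sols A n m)"
      by (simp add: algebra_simps)
    also have "\<dots> \<le> n * (2 * num_regs Qry + 20) + ?G * (3 * n + false_sols A n m)"
      by (intro add_right_mono mult_le_mono2) auto
    finally show "wp (Out (V 50)) ?Q h1"
      using h1(1,3) o1 by (intro wp_Out) (auto simp: h0_def)
  qed (use ds zw in \<open>simp_all add: h0_def dsinv_def baseD[OF qinvD(1)[OF q]]\<close>)
  show ?thesis unfolding search_def
    by (rule wp_Seq, rule wp_Assign) (simp, rule wp_eq[OF w0], rule hstate.equality, simp_all add: h0_def)
qed

end

section \<open>The complete program\<close>

definition power_com :: "nat \<Rightarrow> exp \<Rightarrow> exp \<Rightarrow> com" where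
  "power_com v x e = Assign v (N 1) ;; For 24 e (Assign v (Bin Mul (V v) x))"

text \<open>The loop runs \<open>n\<close> rounds although doubling stops after logarithmically
  many; linear time is affordable. The resulting power of two exceeds \<open>n\<close> and becomes
  the root of unity \<open>X\<close>.\<close>

definition log_com :: com where
  "log_com = Assign 1 (V 0) ;; Assign 2 (N 1) ;; Assign 3 (N 0) ;;
     For 20 (V 1) (If (Bin Less (V 1) (V 2)) Skip
       (Assign 2 (Bin Mul (V 2) (N 2)) ;; Assign 3 (Bin Add (V 3) (N 1))))"

lemma mod_power [simp]: "modv (power_com v x e) = {v, 24}" "moda (power_com v x e) = {}" "silent (power_com v x e)"
  by (auto simp: power_com_def)
lemma mod_log [simp]: "modv log_com = {1, 2, 3, 20}" "moda log_com = {}" "silent log_com"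
  by (auto simp: log_com_def)

definition table_com :: "nat \<Rightarrow> com" where
  "table_com r = Assign 23 (N 1) ;;
     For 20 (N r) (Write 7 (V 20) (V 23) ;; Assign 23 (Bin Mod (Bin Mul (V 23) (V 2)) (V 9)))"

lemma mod_table [simp]: "modv (table_com r) = {20, 23}" "moda (table_com r) = {7}" "silent (table_com r)"
  by (auto simp: table_com_def)

text \<open>On entry variable 0 still holds the argument \<open>n\<close>; it becomes
  \<open>Z\<close> before the first access to an array. The size \<open>2 * Y ^ k\<close> of the
  data structure is \<open>2 ^ (u * k + 1)\<close>, of binary length \<open>u * k + 2\<close>, so
  variable 10 receives the mask of \<open>kd * (u * k + 2)\<close> bits.\<close>

definition params_com :: "nat \<Rightarrow> nat \<Rightarrow> nat \<Rightarrow> nat \<Rightarrow> nat \<Rightarrow> com" where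
  "params_com d kp B zc kd = Assign 4 (Bin Div (V 3) (N B)) ;; power_com 5 (N 2) (V 4) ;;
     power_com 14 (V 5) (N ((d - 1) * kp)) ;; Assign 6 (Bin Mul (N 2) (V 14)) ;;
     power_com 7 (V 5) (N (d * kp)) ;; Assign 8 (Bin Mul (V 4) (N kp)) ;;
     power_com 9 (V 2) (N (2 ^ (d - 1))) ;; Assign 9 (Bin Add (V 9) (N 1)) ;;
     power_com 0 (V 2) (N zc) ;;
     Assign 22 (Bin Mul (N kd) (Bin Add (Bin Mul (V 4) (N ((d - 1) * kp))) (N 2))) ;;
     power_com 10 (N 2) (V 22) ;; Assign 10 (Bin Sub (V 10) (N 1))"

definition preamble :: "nat \<Rightarrow> nat \<Rightarrow> nat \<Rightarrow> nat \<Rightarrow> nat \<Rightarrow> com" where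
  "preamble d kp B zc kd = log_com ;; params_com d kp B zc kd ;; table_com (2 ^ d)"

context ram begin

lemma power_spec:
  assumes x: "atom x {v, 24}" "ok x h" "eval x h = a" "1 \<le> a" and e: "atom e {v, 24}" "eval e h = k"
    and v: "v \<noteq> 24" and o: "a ^ k < 2 ^ w" "k < 2 ^ w"
  shows "wp (power_com v x e) (\<lambda>h'. vars h' v = a ^ k \<and> clk h' \<le> clk h + (k * 16 + 10)) h"
proof -
  define h0 where "h0 = h\<lparr>vars := (vars h)(v := 1), clk := clk h + 2\<rparr>"
  let ?c = "Assign v (Bin Mul (V v) x)"
  have cx: "cost x = 1" using x(1) by (cases x) auto
  have w1: "(1::nat) < 2 ^ w" using wd(1) wd_le_w by (intro one_less_power) auto
  have "wp (For 24 e ?c) (\<lambda>h'. vars h' v = a ^ k \<and> clk h' \<le> clk h + (k * 16 + 10)) h0"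
  proof (rule wp_For[where n = k and t = "\<lambda>_. 4" and J = "\<lambda>i h. vars h v = a ^ i"])
    fix i h1 assume i: "i < k" "vars h1 v = a ^ i" "frame (For 24 e ?c) h0 h1" "vars h1 24 = i"
    have ex: "eval x h1 = a" "ok x h1" using x i(3) by (cases x; auto simp: frame_def h0_def)+
    have "a ^ Suc i \<le> a ^ k" using i(1) x(4) by (intro power_increasing) auto
    then have "a ^ i * a < 2 ^ w" using o by (simp add: mult.commute)
    then show "wp ?c (\<lambda>h'. vars h' v = a ^ Suc i \<and> clk h' \<le> clk h1 + 4) h1"
      using i(2) ex cx by (intro wp_Assign) (simp_all add: mult.commute)
  next
    show "eval e h0 = k" using e by (cases e) (auto simp: h0_def)
    show "atom e (insert 24 (modv ?c))" using e(1) by (cases e) auto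
  qed (use v o in \<open>simp_all add: h0_def\<close>)
  then show ?thesis unfolding power_com_def
    by (intro wp_Seq[OF wp_Assign]) (use w1 in \<open>simp_all add: h0_def\<close>)
qed

lemma log_spec:
  assumes h: "vars h 0 = n" "1 \<le> n" and o: "4 * n < 2 ^ w"
  shows "wp log_com (\<lambda>h'. (vars h' 1 = n \<and> vars h' 2 = 2 ^ floorlog 2 n \<and> vars h' 3 = floorlog 2 n) \<and>
     clk h' \<le> clk h + (n * 30 + 20)) h"
proof -
  define h0 where "h0 = h\<lparr>vars := (vars h)(1 := n, 2 := 1, 3 := 0), clk := clk h + 6\<rparr>"
  let ?c = "If (Bin Less (V 1) (V 2)) Skip (Assign 2 (Bin Mul (V 2) (N 2)) ;; Assign 3 (Bin Add (V 3) (N 1)))"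
  let ?J = "\<lambda>i h. vars h 2 = 2 ^ vars h 3 \<and> (vars h 3 \<noteq> 0 \<longrightarrow> 2 ^ (vars h 3 - 1) \<le> n) \<and> (n < vars h 2 \<or> vars h 3 = i)"
  have o': "(1::nat) < 2 ^ w" "(2::nat) < 2 ^ w" using o h(2) by linarith+
  have w0: "wp (For 20 (V 1) ?c) (\<lambda>h'. (vars h' 1 = n \<and> vars h' 2 = 2 ^ floorlog 2 n \<and> vars h' 3 = floorlog 2 n) \<and>
     clk h' \<le> clk h + (n * 30 + 20)) h0"
  proof (rule wp_For[where n = n and t = "\<lambda>_. 18" and J = ?J])
    fix i h1 assume i: "i < n" "?J i h1" "frame (For 20 (V 1) ?c) h0 h1" "vars h1 20 = i"
    have v1: "vars h1 1 = n" using i(3) by (simp add: frame_def h0_def)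
    show "wp ?c (\<lambda>h'. ?J (Suc i) h' \<and> clk h' \<le> clk h1 + 18) h1"
    proof (rule wp_If)
      show "ok (Bin Less (V 1) (V 2)) h1" by simp
    next
      assume "eval (Bin Less (V 1) (V 2)) h1 \<noteq> 0"
      then have "n < vars h1 2" using v1 by (simp split: if_splits)
      then show "wp Skip (\<lambda>h'. ?J (Suc i) h' \<and> clk h' \<le> clk h1 + 18) (tick (cost (Bin Less (V 1) (V 2)) + 1) h1)"
        using i(2) by (intro wp_Skip) simp
    next
      assume "eval (Bin Less (V 1) (V 2)) h1 = 0"
      then have le: "2 ^ vars h1 3 \<le> n" "vars h1 3 = i" using i(2) v1 by (auto split: if_splits)
      have "Suc i < 2 ^ w" "(2::nat) ^ i * 2 < 2 ^ w" using le i(1) o by auto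
      then show "wp (Assign 2 (Bin Mul (V 2) (N 2)) ;; Assign 3 (Bin Add (V 3) (N 1)))
        (\<lambda>h'. ?J (Suc i) h' \<and> clk h' \<le> clk h1 + 18) (tick (cost (Bin Less (V 1) (V 2)) + 3) h1)"
        using i(2) le o' by (intro wp_Seq wp_Assign) (simp_all add: o'[simplified])
    qed
  next
    fix h' assume J: "?J n h'" and f: "frame (For 20 (V 1) ?c) h0 h'" and clk: "clk h' \<le> clk h0 + (\<Sum>i<n. 18 + 12) + 8"
    \<comment> \<open>If doubling never stopped, it happened \<open>n\<close> times, and
      \<open>2 ^ n\<close> exceeds \<open>n\<close>.\<close>
    have n2: "n < 2 ^ vars h' 3" using J less_exp[of n] by auto
    then have "vars h' 3 \<noteq> 0" using h(2) by (intro notI) auto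
    then have "vars h' 3 = floorlog 2 n"
      using floorlog_leI[of n 2 "vars h' 3"] floorlog_ge_SucI[of 2 "vars h' 3 - 1" n] J n2 h(2) by auto
    then show "(vars h' 1 = n \<and> vars h' 2 = 2 ^ floorlog 2 n \<and> vars h' 3 = floorlog 2 n) \<and>
     clk h' \<le> clk h + (n * 30 + 20)" using J f clk by (simp add: frame_def h0_def)
  qed (use o h in \<open>simp_all add: h0_def\<close>)
  show ?thesis unfolding log_com_def
    by ((rule wp_Seq, rule wp_Assign, simp add: o' o'[simplified])+, rule wp_eq[OF w0], rule hstate.equality)
      (simp_all add: h0_def h)
qed

lemma table_spec:
  assumes h: "vars h 0 = Z" "vars h 2 = X" "vars h 9 = Q" and Q: "1 < Q" "X < Q" "Q * Q < 2 ^ w" and r: "r < Z"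
  shows "wp (table_com r) (\<lambda>h'. (\<forall>t<r. arr h' 7 t = X ^ t mod Q) \<and> clk h' \<le> clk h + (r * 30 + 10)) h"
proof -
  define h0 where "h0 = h\<lparr>vars := (vars h)(23 := 1), clk := clk h + 2\<rparr>"
  let ?c = "Write 7 (V 20) (V 23) ;; Assign 23 (Bin Mod (Bin Mul (V 23) (V 2)) (V 9))"
  have o: "(1::nat) < 2 ^ w" "r < 2 ^ w" using Z r by linarith+
  have "wp (For 20 (N r) ?c) (\<lambda>h'. (\<forall>t<r. arr h' 7 t = X ^ t mod Q) \<and> clk h' \<le> clk h + (r * 30 + 10)) h0"
  proof (rule wp_For[where n = r and t = "\<lambda>_. 18" and J = "\<lambda>i h. vars h 23 = X ^ i mod Q \<and> (\<forall>t<i. arr h 7 t = X ^ t mod Q)"])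
    fix i h1 assume i: "i < r" "vars h1 23 = X ^ i mod Q \<and> (\<forall>t<i. arr h1 7 t = X ^ t mod Q)"
      "frame (For 20 (N r) ?c) h0 h1" "vars h1 20 = i"
    have v1: "vars h1 0 = Z" "vars h1 2 = X" "vars h1 9 = Q" using i(3) h by (simp_all add: frame_def h0_def)
    have "X ^ i mod Q * X \<le> Q * Q" using Q by (intro mult_le_mono) (auto intro: less_imp_le)
    then have o2: "X ^ i mod Q * X < 2 ^ w" using Q by linarith
    have e: "(X ^ i mod Q * X) mod Q = X ^ Suc i mod Q" by (simp only: mod_mult_left_eq power_Suc2)
    then have e': "X * (X ^ i mod Q) mod Q = X * X ^ i mod Q" by (simp add: mult.commute)
    show "wp ?c (\<lambda>h'. (vars h' 23 = X ^ Suc i mod Q \<and> (\<forall>t<Suc i. arr h' 7 t = X ^ t mod Q)) \<and> clk h' \<le> clk h1 + 18) h1"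
      using i o2 r by (intro wp_Seq wp_Write wp_Assign) (simp_all add: v1 less_Suc_eq e e')
  qed (use o Q in \<open>simp_all add: h0_def\<close>)
  then show ?thesis unfolding table_com_def
    by (intro wp_Seq[OF wp_Assign]) (use o in \<open>simp_all add: h0_def\<close>)
qed


lemma params_spec:
  assumes h: "vars h 1 = n" "vars h 2 = X" "vars h 3 = L"
    and u: "u = L div B" and k: "k = (d - 1) * kp" and X: "2 \<le> X"
    and Y: "YY = 2 ^ u" and b: "bb = 2 ^ (d - 1)" and W: "WW = 2 ^ (kd * (u * k + 2))"
    and o: "B < 2 ^ w" "u < 2 ^ w" "YY ^ k < 2 ^ w" "2 * YY ^ k < 2 ^ w" "k < 2 ^ w" "YY ^ (d * kp) < 2 ^ w"
      "d * kp < 2 ^ w" "u * kp < 2 ^ w" "kp < 2 ^ w" "X ^ (bb) + 1 < 2 ^ w" "bb < 2 ^ w" "X ^ zc < 2 ^ w"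
      "zc < 2 ^ w" "u * k < 2 ^ w" "u * k + 2 < 2 ^ w" "kd * (u * k + 2) < 2 ^ w" "kd < 2 ^ w" "WW < 2 ^ w"
      "YY < 2 ^ w"
  shows "wp (params_com d kp B zc kd) (\<lambda>h'. (vars h' 0 = X ^ zc \<and> vars h' 1 = n \<and> vars h' 2 = X \<and> vars h' 5 = YY \<and>
     vars h' 6 = 2 * YY ^ k \<and> vars h' 7 = YY ^ (d * kp) \<and> vars h' 8 = u * kp \<and> vars h' 9 = X ^ (bb) + 1 \<and>
     vars h' 14 = YY ^ k \<and> vars h' 10 = WW - 1) \<and>
     clk h' \<le> clk h + 16 * (u + k + d * kp + bb + zc + kd * (u * k + 2)) + 120) h"
    (is "wp _ ?Q h")
proof -
  have Wlt: "2 ^ (kd * (u * k + 2)) < (2::nat) ^ w" "2 ^ u < (2::nat) ^ w" using o Y W by simp_all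
  have W1: "Suc 0 \<le> WW" by (simp add: W)
  have w2: "(1::nat) < 2 ^ w" "(2::nat) < 2 ^ w" using o(15) by linarith+
  have Y1: "1 \<le> YY" by (simp add: Y)
  have X1: "1 \<le> X" using X by simp
  have Xb: "X ^ (bb) < 2 ^ w" using o(10) by linarith
  show ?thesis unfolding params_com_def k[symmetric] b[symmetric]
  proof (rule wp_Seq, rule wp_Assign)
    let ?h1 = "h\<lparr>vars := (vars h)(4 := eval (Bin Div (V 3) (N B)) h), clk := clk h + (cost (Bin Div (V 3) (N B)) + 1)\<rparr>"
    show "wp (power_com 5 (N 2) (V 4) ;; power_com 14 (V 5) (N k) ;; Assign 6 (Bin Mul (N 2) (V 14)) ;;
     power_com 7 (V 5) (N (d * kp)) ;; Assign 8 (Bin Mul (V 4) (N kp)) ;;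
     power_com 9 (V 2) (N (bb)) ;; Assign 9 (Bin Add (V 9) (N 1)) ;;
     power_com 0 (V 2) (N zc) ;; Assign 22 (Bin Mul (N kd) (Bin Add (Bin Mul (V 4) (N k)) (N 2))) ;;
     power_com 10 (N 2) (V 22) ;; Assign 10 (Bin Sub (V 10) (N 1))) ?Q ?h1"
    proof (rule wp_Seq, rule wp_mono[OF power_spec[where a = 2 and k = u]], goal_cases)
      case (10 h2)
      have a2: "vars h2 1 = n" "vars h2 2 = X" "vars h2 4 = u" "vars h2 5 = YY" "clk h2 \<le> clk h + u * 16 + 14"
        using 10 h u by (simp_all add: frame_def Y)
      show ?case
      proof (rule wp_Seq, rule wp_mono[OF power_spec[where a = YY and k = k]], goal_cases)
        case (10 h3)
        have a3: "vars h3 1 = n" "vars h3 2 = X" "vars h3 4 = u" "vars h3 5 = YY" "vars h3 14 = YY ^ k"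
          "clk h3 \<le> clk h + u * 16 + k * 16 + 24"
          using 10 a2 by (simp_all add: frame_def)
        show ?case
        proof (rule wp_Seq, rule wp_Assign, simp add: w2 w2[simplified] o o[simplified] a3, rule wp_Seq, rule wp_mono[OF power_spec[where a = YY and k = "d * kp"]], goal_cases)
          case (10 h4)
          have a4: "vars h4 1 = n" "vars h4 2 = X" "vars h4 4 = u" "vars h4 5 = YY" "vars h4 14 = YY ^ k"
            "vars h4 6 = 2 * YY ^ k" "vars h4 7 = YY ^ (d * kp)"
            "clk h4 \<le> clk h + u * 16 + k * 16 + d * kp * 16 + 38"
            using 10 a3 by (simp_all add: frame_def)
          show ?case
          proof (rule wp_Seq, rule wp_Assign, simp add: w2 w2[simplified] o o[simplified] a4, rule wp_Seq, rule wp_mono[OF power_spec[where a = X and k = "bb"]], goal_cases)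
            case (10 h5)
            have a5: "vars h5 1 = n" "vars h5 2 = X" "vars h5 4 = u" "vars h5 5 = YY" "vars h5 14 = YY ^ k"
              "vars h5 6 = 2 * YY ^ k" "vars h5 7 = YY ^ (d * kp)" "vars h5 8 = u * kp" "vars h5 9 = X ^ (bb)"
              "clk h5 \<le> clk h + u * 16 + k * 16 + d * kp * 16 + bb * 16 + 52"
              using 10 a4 by (simp_all add: frame_def)
            show ?case
            proof (rule wp_Seq, rule wp_Assign, simp add: w2 w2[simplified] o o[simplified] a5, rule wp_Seq, rule wp_mono[OF power_spec[where a = X and k = zc]], goal_cases)
              case (10 h6)
              have a6: "vars h6 1 = n" "vars h6 2 = X" "vars h6 4 = u" "vars h6 5 = YY" "vars h6 14 = YY ^ k"
                "vars h6 6 = 2 * YY ^ k" "vars h6 7 = YY ^ (d * kp)" "vars h6 8 = u * kp" "vars h6 9 = X ^ (bb) + 1"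
                "vars h6 0 = X ^ zc"
                "clk h6 \<le> clk h + u * 16 + k * 16 + d * kp * 16 + bb * 16 + zc * 16 + 66"
                using 10 a5 by (simp_all add: frame_def)
              show ?case
              proof (rule wp_Seq, rule wp_Assign, simp add: w2 w2[simplified] o o[simplified] a6, rule wp_Seq, rule wp_mono[OF power_spec[where a = 2 and k = "kd * (u * k + 2)"]], goal_cases)
                case (10 h7)
                have a7: "vars h7 1 = n" "vars h7 2 = X" "vars h7 5 = YY" "vars h7 14 = YY ^ k"
                  "vars h7 6 = 2 * YY ^ k" "vars h7 7 = YY ^ (d * kp)" "vars h7 8 = u * kp" "vars h7 9 = X ^ (bb) + 1"
                  "vars h7 0 = X ^ zc" "vars h7 10 = WW"
                  "clk h7 \<le> clk h + u * 16 + k * 16 + d * kp * 16 + bb * 16 + zc * 16 + (kd * (u * k + 2)) * 16 + 84"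
                  using 10 a6 by (simp_all add: frame_def W)
                show ?case using a7 w2 o by (intro wp_Assign) (simp_all add: algebra_simps W1)
              qed (use a6 o w2 Wlt in simp_all)
            qed (use a5 o w2 X1 in simp_all)
          qed (use a4 o w2 X1 Xb in simp_all)
        qed (use a3 o w2 Y1 in simp_all)
      qed (use a2 o w2 Y1 in simp_all)
    qed (use h u o w2 Wlt in simp_all)
  qed (use o in simp)
qed

end

section \<open>Discarding output\<close>

text \<open>Nothing limits what the preprocessing prints, whereas a call has to produce fewer than
  \<open>Z\<close> outputs. \<open>And\<close> of a register with itself is an instruction without
  effect that keeps addresses and running time.\<close>

fun mute_instr :: "instr \<Rightarrow> instr" where
  "mute_instr (Output r) = Op And r r r"
| "mute_instr i = i"

lemma mute_step: "step w (map mute_instr P) (s\<lparr>out := []\<rparr>) = (step w P s)\<lparr>out := []\<rparr>"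
proof (cases "halted P s")
  case False
  then show ?thesis by (cases "P ! pc s") (auto simp: step_def halted_def)
qed (simp add: step_def halted_def)

lemma mute_halts:
  assumes "halts_within w P (start a M) t s"
  shows "halts_within w (map mute_instr P) (start a M) t (s\<lparr>out := []\<rparr>)"
proof -
  have "(step w (map mute_instr P) ^^ t) (s0\<lparr>out := []\<rparr>) = ((step w P ^^ t) s0)\<lparr>out := []\<rparr>" for s0
    by (induction t) (simp_all add: mute_step)
  from this[of "start a M"] show ?thesis using assms by (simp add: halts_within_def halted_def start_def)
qed

definition work :: "nat \<Rightarrow> nat \<Rightarrow> nat \<Rightarrow> program \<Rightarrow> program \<Rightarrow> com" where
  "work r b k Pre Qry = pick r b k ;; build ;; Call (map mute_instr Pre) 6 ;; search Qry"

context prog_ds begin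

lemma work_spec:
  assumes h: "base h" "vars h 10 = 2 ^ wd - 1" "arr h 1 = (\<lambda>_. 0)" "arr h 8 = (\<lambda>_. 0)" "outs h = []"
    and NNk: "NN = Y ^ k" and kw: "k < 2 ^ w"
    and D: "\<And>s. 1 \<le> s \<Longrightarrow> s \<le> M \<Longrightarrow> card {d. d dvd s} \<le> D" and A: "\<And>i. i < n \<Longrightarrow> A i + A i \<le> M"
  shows "wp (work r b k Pre Qry) (\<lambda>h'. outs h' = [of_bool (\<exists>l<n. sol l)] \<and>
    (\<exists>F. Y ^ k * F \<le> D ^ k * n ^ 3 \<and> clk h' \<le> clk h + (k * (Y * (count_time + 50) + 40) + 20) +
      (NN * 18 + n * 110 + 40) + (num_regs (map mute_instr Pre) + 2 + 5 * pn) +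
      (n * (2 * num_regs Qry + 20) + (5 * qn + 350) * (3 * n + F) + 20))) h" (is "wp _ ?Q h")
  unfolding work_def
proof (rule wp_Seq, rule wp_mono[OF pick_spec[OF h(1) NNk kw D A]], assumption, assumption, assumption, elim conjE)
  fix h1 assume h1: "frame (pick r b k) h h1" "1 \<le> vars h1 12" "vars h1 12 \<le> NN"
    "Y ^ k * false_sols A n (vars h1 12) \<le> D ^ k * n ^ 3" "clk h1 \<le> clk h + (k * (Y * (count_time + 50) + 40) + 20)"
  define m where "m = vars h1 12"
  have m: "1 \<le> m" "m \<le> NN" using h1 by (auto simp: m_def)
  have b1: "base h1" using base_frame[OF h(1) h1(1)] by simp
  have sil: "silent (pick r b k)" "silent build"
    by (simp_all add: pick_def try_factor_def count_def hist_def embed_def digits_def dft_def axis_def butterfly_def sumup_def build_def)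
  have v1: "vars h1 10 = 2 ^ wd - 1" "arr h1 1 = (\<lambda>_. 0)" "arr h1 8 = (\<lambda>_. 0)" "outs h1 = []"
    using h1(1) h sil by (simp_all add: frame_def)
  show "wp (build ;; Call (map mute_instr Pre) 6 ;; search Qry) ?Q h1"
  proof (rule wp_Seq, rule wp_mono[OF build_spec[OF b1 v1(1) m_def[symmetric] m v1(2,3)]], elim conjE)
    fix h2 assume h2: "frame build h1 h2" "qinv m h2" "arr h2 1 = mem_of (bits m @ bits m)"
      "clk h2 \<le> clk h1 + (NN * 18 + n * 110 + 40)"
    have o2: "outs h2 = []" using h2(1) sil v1 by (simp add: frame_def)
    have v2: "vars h2 6 = 2 * NN" using qinvD(1)[OF h2(2)] by (simp add: baseD)
    obtain t s where ts: "halts_within wd Pre (start (2 * NN) (mem_of (bits m @ bits m))) t s" "t \<le> pn"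
      using ds_pre[OF bits_vector] by blast
    have b01: "\<forall>i. mem_of (bits m @ bits m) i < 2 ^ wd"
    proof
      fix i
      have "mem_of (bits m @ bits m) i \<le> 1" by (auto simp: mem_of_def bits_def nth_append)
      then show "mem_of (bits m @ bits m) i < 2 ^ wd" using wdN zw(10) by linarith
    qed
    have NNwd: "2 * NN < 2 ^ wd" using wdN by linarith
    define h3 where "h3 = h2\<lparr>vars := (vars h2)(11 := length (out (s\<lparr>out := []\<rparr>))),
      arr := (arr h2)(1 := mem (s\<lparr>out := []\<rparr>), 2 := (\<lambda>i. if i < length (out (s\<lparr>out := []\<rparr>)) then out (s\<lparr>out := []\<rparr>) ! i else arr h2 2 i)),
      clk := clk h2 + (num_regs (map mute_instr Pre) + 2 + 5 * t)\<rparr>"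
    have q3: "qinv m h3" by (rule qinv_cong[OF h2(2)]) (simp_all add: h3_def)
    have d3: "dsinv m h3" unfolding dsinv_def
      using ds_memory.preprocess[OF ts(1)] bnd_halts[OF ts(1) NNwd b01] by (simp add: h3_def)
    have w3: "wp (search Qry) ?Q h3"
      by (rule wp_mono[OF search_spec[OF q3 m d3]])
        (use o2 ts(2) h2(4) h1(4,5) in \<open>auto simp: h3_def m_def[symmetric] intro!: exI[of _ "false_sols A n m"]\<close>)
    show "wp (Call (map mute_instr Pre) 6 ;; search Qry) ?Q h2"
    proof (rule wp_Seq, rule wp_Call)
      show "wp (search Qry) ?Q (h2\<lparr>vars := (vars h2)(11 := length (out (s\<lparr>out := []\<rparr>))),
      arr := (arr h2)(1 := mem (s\<lparr>out := []\<rparr>), 2 := (\<lambda>i. if i < length (out (s\<lparr>out := []\<rparr>)) then out (s\<lparr>out := []\<rparr>) ! i else arr h2 2 i)),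
      clk := clk h2 + (num_regs (map mute_instr Pre) + 2 + 5 * t)\<rparr>)" using w3 unfolding h3_def .
      show "halts_within wd (map mute_instr Pre) (start (vars h2 6) (arr h2 1)) t (s\<lparr>out := []\<rparr>)"
        unfolding v2 h2(3) by (rule mute_halts[OF ts(1)])
    qed (use NNwd b01 Z in \<open>simp_all add: h3_def v2 h2(3)[simplified] qinvD(2)[OF h2(2)] baseD[OF qinvD(1)[OF h2(2)]]\<close>)
  qed
qed

end

section \<open>Correctness and running time for fixed parameters\<close>

text \<open>\<open>F\<close> is the number of remaining false solutions, known only through an
  inequality. Since the bound is monotone in \<open>F\<close>, the largest admissible value can be
  inserted later.\<close>

definition total_time :: "nat \<Rightarrow> nat \<Rightarrow> nat \<Rightarrow> nat \<Rightarrow> nat \<Rightarrow> nat \<Rightarrow> nat \<Rightarrow> nat \<Rightarrow> nat \<Rightarrow> nat \<Rightarrow> nat \<Rightarrow> nat \<Rightarrow> nat \<Rightarrow> nat" where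
  "total_time n k r Y NN H K L a0 a1 pn qn F =
     (n * 30 + a0 * L + a0) +
     (k * (Y * ((NN * 18 + n * 33 + 16) + (H * (K * 50 + 100) + 8) +
        2 * (K * (H * (r * 60 + 72) + 40) + 12) + (H * 50 + 10) + 50) + 40) + 20) +
     (NN * 18 + n * 110 + 40) + (a1 + 5 * pn) + (n * (a1 + 20) + (5 * qn + 350) * (3 * n + F) + 20)"

definition main :: "nat \<Rightarrow> nat \<Rightarrow> nat \<Rightarrow> nat \<Rightarrow> nat \<Rightarrow> program \<Rightarrow> program \<Rightarrow> com" where
  "main d kp B zc kd Pre Qry = log_com ;; params_com d kp B zc kd ;; table_com (2 ^ d) ;;
     work (2 ^ d) (2 ^ (d - 1)) ((d - 1) * kp) Pre Qry"

text \<open>The word length is \<open>(zc + 6) * L\<close>, which makes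
  \<open>2 ^ w = Z * X ^ 6\<close> with \<open>Z = X ^ zc\<close>. The exponent \<open>zc\<close>
  adds up all demands on \<open>Z\<close>: the transform and the input up to \<open>n ^ c\<close>,
  the product \<open>Q * Q\<close>, the address space of the data structure, the constants in the
  program text, and some slack.\<close>

lemma run_main:
  fixes d kp B kd c n :: nat and xs :: "nat list" and Pre Qry :: program
  defines "k \<equiv> (d - 1) * kp"
  defines "zc \<equiv> d * kp + k + 3 * d + c + kd * (k + 2) + 2 * 2 ^ (d - 1) + B + kd + kp + 20"
  defines "L \<equiv> floorlog 2 n"
  defines "u \<equiv> L div B"
  defines "N' \<equiv> 2 * (2 ^ u) ^ k"
  defines "wd \<equiv> word_size kd N'"
  assumes par: "4 \<le> d" "1 \<le> kp" "1 \<le> B" "d * kp \<le> 2 * B" "2 \<le> kd"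
    and n: "1 \<le> n" and xs: "distinct xs" "length xs = n" "set xs \<subseteq> {1..n ^ c}"
    and pre: "\<And>V. bit_vector N' V \<Longrightarrow> \<exists>t s. halts_within wd Pre (start N' (mem_of (V @ V))) t s \<and> t \<le> pn"
    and qry: "\<And>V M k. bit_vector N' V \<Longrightarrow> ds_memory wd Pre Qry N' V V M \<Longrightarrow> k \<in> {1..2 * N'} \<Longrightarrow>
      \<exists>t s ws. halts_within wd Qry (start k M) t s \<and> distinct ws \<and> set ws = witnesses N' V V k \<and>
        out s = concat (map (\<lambda>(i, j). [i, j]) ws) \<and> t \<le> qn * (1 + card (witnesses N' V V k))"
    and D: "\<And>s. 1 \<le> s \<Longrightarrow> s \<le> 2 * n ^ c \<Longrightarrow> card {d. d dvd s} \<le> D"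
  shows "\<exists>t s F. halts_within (word_size (zc + 6) n) (compile (main d kp B zc kd Pre Qry)) (start n (mem_of xs)) t s \<and>
    out s = [of_bool (has_3sum (set xs))] \<and> (2 ^ u) ^ k * F \<le> D ^ k * n ^ 3 \<and>
    t \<le> total_time n k (2 ^ d) (2 ^ u) ((2 ^ u) ^ k) ((2 ^ u) ^ (d * kp)) (u * kp) L
      (16 * (3 + k + d * kp + 2 ^ (d - 1) + zc + kd * (k + 2)) + 200 + 2 ^ d * 30)
      (num_regs (map mute_instr Pre) + 2 * num_regs Qry + 2) pn qn F"
proof -
  define X where "X = (2::nat) ^ L"
  define Y where "Y = (2::nat) ^ u"
  define b where "b = (2::nat) ^ (d - 1)"
  define r where "r = (2::nat) ^ d"
  define Q where "Q = X ^ b + 1"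
  define Z where "Z = X ^ zc"
  define K where "K = u * kp"
  define NN where "NN = Y ^ k"
  define H where "H = Y ^ (d * kp)"
  define w where "w = word_size (zc + 6) n"
  define A where "A = (\<lambda>i. xs ! i)"
  have nb: "2 ^ (L - 1) \<le> n" "n < X" using floorlog_bounds[of n 2] n by (auto simp: L_def X_def)
  have L1: "1 \<le> L" using nb(2) n by (cases L) (auto simp: X_def)
  have X2: "2 \<le> X" using L1 unfolding X_def by (metis one_le_numeral power_increasing power_one_right)
  have uL: "u \<le> L" "u * B \<le> L" using par(3) by (auto simp: u_def)
  have YX: "1 \<le> Y" "Y \<le> X" using uL(1) by (auto simp: X_def Y_def)
  have pX: "2 ^ j \<le> X ^ j" for j using X2 by (intro power_mono) auto
  have ml: "X ^ i \<le> X ^ j" if "i \<le> j" for i j using X2 that by (intro power_increasing) auto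
  have N': "N' = 2 * NN" by (simp add: N'_def NN_def Y_def)
  have w: "w = (zc + 6) * L" by (simp add: w_def word_size_def L_def)
  have W: "2 ^ w = Z * X ^ 6" unfolding w Z_def X_def by (simp add: power_mult[symmetric] power_add[symmetric] algebra_simps)
  have X6: "64 \<le> X ^ 6" using pX[of 6] by simp
  have Zpos: "0 < Z" using X2 by (simp add: Z_def)
  have Zw: "40 * Z \<le> 2 ^ w" using mult_le_mono2[OF X6, of Z] unfolding W by linarith
  have wd_eq: "wd = kd * (u * k + 2)"
  proof -
    have "N' = 2 ^ (u * k + 1)" by (simp add: N'_def power_mult)
    then have "floorlog 2 N' = u * k + 2" using floorlog_leI[of N' 2 "u * k + 2"] floorlog_ge_SucI[of 2 "u * k + 1" N'] by simp
    then show ?thesis by (simp add: wd_def word_size_def)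
  qed
  have wdL: "wd \<le> kd * (k + 2) * L"
  proof -
    have "u * k + 2 \<le> L * k + 2 * L" using uL(1) L1 by (intro add_mono mult_le_mono1) auto
    then have "kd * (u * k + 2) \<le> kd * (L * k + 2 * L)" by (rule mult_le_mono2)
    then show ?thesis unfolding wd_eq by (simp add: algebra_simps)
  qed
  have wdZ: "2 ^ wd \<le> Z"
  proof -
    have "kd * (k + 2) \<le> zc" by (simp add: zc_def)
    then have "kd * (k + 2) * L \<le> zc * L" by (rule mult_le_mono1)
    then have "wd \<le> zc * L" using wdL by linarith
    then have "(2::nat) ^ wd \<le> 2 ^ (zc * L)" by (intro power_increasing) auto
    then show ?thesis by (simp add: Z_def X_def power_mult[symmetric] mult.commute)
  qed
  \<comment> \<open>\<open>M\<close> dominates the exponents of \<open>X\<close> that bound the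
    terms of \<open>HZ\<close> and \<open>AZ\<close>. Three more powers absorb the factor 8, and
    another three the sum of five terms.\<close>
  define M where "M = d * kp + k + 3 * d + c + 1"
  have z5: "5 * X ^ (M + 3) < Z"
  proof -
    have "5 * X ^ (M + 3) < 8 * X ^ (M + 3)" using X2 by simp
    also have "\<dots> \<le> X ^ 3 * X ^ (M + 3)" using pX[of 3] by (intro mult_le_mono1) simp
    also have "\<dots> = X ^ (M + 6)" by (simp add: power_add[symmetric] add.commute)
    also have "\<dots> \<le> Z" unfolding Z_def by (rule ml) (simp add: M_def zc_def)
    finally show ?thesis .
  qed
  have e8: "8 * x \<le> X ^ (M + 3)" if "x \<le> X ^ j" "j \<le> M" for x j
  proof -
    have "8 * x \<le> X ^ 3 * X ^ M" using pX[of 3] order_trans[OF that(1) ml[OF that(2)]] by (intro mult_le_mono) auto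
    then show ?thesis by (simp add: power_add[symmetric] add.commute)
  qed
  have Hle: "H \<le> X ^ (d * kp)" and NNle: "NN \<le> X ^ k" using YX by (auto simp: H_def NN_def intro!: power_mono)
  have HZ: "8 * H + 8 * NN + 8 * n + 8 * X + 8 * (r * r * r) < Z"
  proof -
    have "r * r * r = 2 ^ (3 * d)" by (simp add: r_def power_add[symmetric])
    then have "8 * (r * r * r) \<le> X ^ (M + 3)" using pX[of "3 * d"] by (intro e8[of _ "3 * d"]) (simp_all add: M_def)
    moreover have "8 * H \<le> X ^ (M + 3)" by (rule e8[OF Hle]) (simp add: M_def)
    moreover have "8 * NN \<le> X ^ (M + 3)" by (rule e8[OF NNle]) (simp add: M_def)
    moreover have "8 * n \<le> X ^ (M + 3)" by (rule e8[of _ 1]) (use nb in \<open>simp_all add: M_def\<close>)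
    moreover have "8 * X \<le> X ^ (M + 3)" by (rule e8[of _ 1]) (simp_all add: M_def)
    ultimately show ?thesis using z5 by linarith
  qed
  have Ain: "A i \<in> set xs" if "i < n" for i using that xs(2) by (simp add: A_def)
  have Ac: "A i \<le> n ^ c" "1 \<le> A i" if "i < n" for i using Ain[OF that] xs(3) by auto
  have ncX: "n ^ c \<le> X ^ c" using nb by (intro power_mono) auto
  have AZ: "4 * A i < Z" if "i < n" for i
  proof -
    have "8 * A i \<le> X ^ (M + 3)" by (rule e8[OF order_trans[OF Ac(1)[OF that] ncX]]) (simp add: M_def)
    then show ?thesis using z5 Ac(2)[OF that] by linarith
  qed
  have b5: "5 \<le> b"
  proof -
    have "(2::nat) ^ 3 \<le> 2 ^ (d - 1)" using par(1) by (intro power_increasing) auto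
    then show ?thesis by (simp add: b_def)
  qed
  have XbX: "X ^ b + 1 \<le> X ^ (b + 1)"
  proof -
    have "1 \<le> X ^ b" using X2 by (intro one_le_power) simp
    then have "X ^ b + 1 \<le> X * X ^ b" using mult_le_mono1[OF X2, of "X ^ b"] by linarith
    then show ?thesis by simp
  qed
  have QZ: "4 * (Q * Q) < Z"
  proof -
    have "Q * Q \<le> X ^ (b + 1) * X ^ (b + 1)" unfolding Q_def by (intro mult_le_mono XbX)
    also have "\<dots> = X ^ (2 * b + 2)" by (simp add: power_add[symmetric] mult_2)
    finally have "4 * (Q * Q) < 8 * X ^ (2 * b + 2)" using X2 by (simp add: Q_def)
    also have "\<dots> \<le> X ^ 3 * X ^ (2 * b + 2)" using pX[of 3] by (intro mult_le_mono1) simp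
    also have "\<dots> = X ^ (3 + (2 * b + 2))" by (simp only: power_add[symmetric])
    also have "3 + (2 * b + 2) = 2 * b + 5" by simp
    also have "X ^ (2 * b + 5) \<le> Z" unfolding Z_def by (rule ml) (simp add: b_def zc_def)
    finally show ?thesis .
  qed
  \<comment> \<open>From \<open>d * kp \<le> 2 * B\<close> follows \<open>H \<le> X ^ 2\<close>, so
    the product is at most \<open>X ^ 5\<close>; \<open>4 \<le> d\<close> makes \<open>b\<close> at
    least 8, hence \<open>X ^ 5 \<le> X ^ b < Q\<close>.\<close>
  have HQ: "H * n ^ 3 < Q"
  proof -
    have "u * (d * kp) \<le> u * (2 * B)" using par(4) by (intro mult_le_mono2)
    moreover have "u * (2 * B) = 2 * (u * B)" by simp
    ultimately have "u * (d * kp) \<le> 2 * L" using uL(2) by linarith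
    then have "(2::nat) ^ (u * (d * kp)) \<le> 2 ^ (2 * L)" by (intro power_increasing) auto
    then have H2: "H \<le> X ^ 2" by (simp add: H_def Y_def X_def power_mult[symmetric] mult.commute)
    have "H * n ^ 3 \<le> X ^ 2 * X ^ 3" using H2 nb by (intro mult_le_mono power_mono) auto
    also have "\<dots> = X ^ 5" by (simp add: power_add[symmetric])
    also have "\<dots> \<le> X ^ b" by (rule ml[OF b5])
    finally show ?thesis by (simp add: Q_def)
  qed
  have NNK: "NN = b ^ K" and HK: "H = r ^ K"
    by (simp_all add: NN_def H_def Y_def b_def r_def K_def k_def power_mult[symmetric] mult_ac)
  have has: "has_3sum (set xs) \<longleftrightarrow> (\<exists>l<n. \<exists>i<n. \<exists>j<n. A i + A j = A l)"
  proof -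
    have sx: "set xs = A ` {..<n}" using xs(2) by (auto simp: A_def in_set_conv_nth)
    show ?thesis unfolding has_3sum_def sx by (simp only: bex_simps lessThan_iff) (auto simp: Bex_def)
  qed
  interpret prog_ds w Z wd d X r b Q n A Y K NN H Pre Qry pn qn
  proof unfold_locales
    show "8 * NN < 2 ^ wd"
    proof -
      have "2 * (u * k + 2) \<le> wd" unfolding wd_eq using par(5) by (intro mult_le_mono1)
      then have "2 * (u * k) + 4 \<le> wd" by simp
      then have "u * k + 4 \<le> wd" by linarith
      then have "(2::nat) ^ (u * k + 4) \<le> 2 ^ wd" by (intro power_increasing) auto
      moreover have "(2::nat) ^ (u * k + 4) = 16 * NN" by (simp add: NN_def Y_def power_add power_mult)
      moreover have "0 < NN" using YX by (simp add: NN_def)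
      ultimately show ?thesis by linarith
    qed
    show "inj_on A {..<n}" using xs by (auto simp: inj_on_def A_def nth_eq_iff_index_eq)
    show "1 \<le> wd" using par(5) by (simp add: wd_eq)
    show "2 \<le> b" using b5 by simp
  qed (use Zpos Zw wdZ par X2 n nb AZ YX NNK HK HZ QZ HQ pre[unfolded N'] qry[unfolded N'] in \<open>auto simp: r_def b_def Q_def\<close>)
  have cz: "j < 2 ^ w" if "j \<le> zc" for j
  proof -
    have "j < 2 ^ j" by (rule less_exp)
    also have "\<dots> \<le> X ^ j" by (rule pX)
    also have "\<dots> \<le> Z" unfolding Z_def by (rule ml[OF that])
    finally show ?thesis by (rule Zw)
  qed
  define h0 :: hstate where "h0 = \<lparr>vars = (\<lambda>_. 0)(0 := n), arr = (\<lambda>j i. if j = 0 then mem_of xs i else 0), outs = [], clk = 0\<rparr>"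
  let ?T = "total_time n k (2 ^ d) (2 ^ u) ((2 ^ u) ^ k) ((2 ^ u) ^ (d * kp)) (u * kp) L
      (16 * (3 + k + d * kp + 2 ^ (d - 1) + zc + kd * (k + 2)) + 200 + 2 ^ d * 30)
      (num_regs (map mute_instr Pre) + 2 * num_regs Qry + 2) pn qn"
  let ?Q = "\<lambda>h'. outs h' = [of_bool (\<exists>l<n. sol l)] \<and> (\<exists>F. Y ^ k * F \<le> D ^ k * n ^ 3 \<and> clk h' \<le> ?T F)"
  let ?P = "params_com d kp B zc kd" and ?W = "work (2 ^ d) (2 ^ (d - 1)) ((d - 1) * kp) Pre Qry"
  have u_eq: "u = L div B" and k_eq: "k = (d - 1) * kp" by (simp_all add: u_def k_def)
  have zc_le: "B \<le> zc" "kp \<le> zc" "d * kp \<le> zc" "k \<le> zc" "kd \<le> zc" "2 ^ (d - 1) \<le> zc" by (simp_all add: zc_def)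
  have wd_w: "wd < 2 ^ w" by (rule Zw, rule less_le_trans[OF less_exp wdZ])
  have wdk: "u * k + 2 \<le> wd"
  proof -
    have "1 * (u * k + 2) \<le> kd * (u * k + 2)" using par(5) by (intro mult_le_mono1) simp
    then show ?thesis by (simp only: mult_1 wd_eq)
  qed
  have "wp (log_com ;; ?P ;; table_com (2 ^ d) ;; ?W) ?Q h0"
  proof (rule wp_Seq, rule wp_mono[OF log_spec[of h0 n]])
    show "4 * n < 2 ^ w" by (rule Zw) (use HZ in linarith)
  next
    fix h1 assume h1': "(vars h1 1 = n \<and> vars h1 2 = 2 ^ floorlog 2 n \<and> vars h1 3 = floorlog 2 n) \<and> clk h1 \<le> clk h0 + (n * 30 + 20)"
      "frame log_com h0 h1"
    have h1: "vars h1 1 = n" "vars h1 2 = X" "vars h1 3 = L" "clk h1 \<le> n * 30 + 20" "arr h1 = arr h0" "outs h1 = []"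
      using h1' by (auto simp: X_def L_def h0_def frame_def)
    show "wp (?P ;; table_com (2 ^ d) ;; ?W) ?Q h1"
    proof (rule wp_Seq, rule wp_mono[OF params_spec[OF h1(1-3) u_eq k_eq X2 Y_def b_def refl]])
      show "B < 2 ^ w" "k < 2 ^ w" "d * kp < 2 ^ w" "kp < 2 ^ w" "zc < 2 ^ w" "kd < 2 ^ w"
        using zc_le by (auto intro!: cz)
      show "b < 2 ^ w" using cz[OF zc_le(6)] by (simp only: b_def)
      show "u < 2 ^ w" using uL(1) L1 less_exp[of L] zw(1) X_def nb HZ by (intro Zw) linarith
      show "Y ^ k < 2 ^ w" "2 * Y ^ k < 2 ^ w" "Y ^ (d * kp) < 2 ^ w" "u * kp < 2 ^ w"
        using zw(3,4,5,6,12) by (auto intro!: Zw simp: NN_def[symmetric] H_def[symmetric] K_def[symmetric])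
      show "X ^ b + 1 < 2 ^ w" using Zw[OF zw(6)] by (simp only: Q_def)
      show "X ^ zc < 2 ^ w" using Zw Zpos Z unfolding Z_def[symmetric] by linarith
      show "u * k < 2 ^ w" "u * k + 2 < 2 ^ w" "kd * (u * k + 2) < 2 ^ w" using wd_w wdk wd_eq by linarith+
      show "2 ^ (kd * (u * k + 2)) < (2::nat) ^ w" using wdZ Z Zpos unfolding wd_eq by linarith
      show "Y < 2 ^ w" using YX HZ by (intro Zw) linarith
    next
      fix h2 assume h2': "(vars h2 0 = X ^ zc \<and> vars h2 1 = n \<and> vars h2 2 = X \<and> vars h2 5 = Y \<and>
         vars h2 6 = 2 * Y ^ k \<and> vars h2 7 = Y ^ (d * kp) \<and> vars h2 8 = u * kp \<and> vars h2 9 = X ^ b + 1 \<and>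
         vars h2 14 = Y ^ k \<and> vars h2 10 = 2 ^ (kd * (u * k + 2)) - 1) \<and>
         clk h2 \<le> clk h1 + 16 * (u + k + d * kp + b + zc + kd * (u * k + 2)) + 120" "frame ?P h1 h2"
      have h2: "arr h2 = arr h0" "outs h2 = []" using h2'(2) h1 by (auto simp: frame_def params_com_def)
      have v2: "vars h2 0 = Z" "vars h2 2 = X" "vars h2 9 = Q" using h2'(1) by (simp_all add: Z_def Q_def)
      have QQ: "1 < Q" "X < Q" "Q * Q < 2 ^ w"
      proof -
        show "1 < Q" using Q_gt by simp
        have "X ^ 1 \<le> X ^ b" by (rule ml) (use b5 in simp)
        then show "X < Q" by (simp add: Q_def)
        show "Q * Q < 2 ^ w" by (rule Zw) (use QZ in linarith)
      qed
      have rZ: "2 ^ d < Z" using zw(7) by (simp add: r_def)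
      show "wp (table_com (2 ^ d) ;; ?W) ?Q h2"
      proof (rule wp_Seq, rule wp_mono[OF table_spec[OF v2 QQ rZ]], elim conjE)
        fix h3 assume h3: "frame (table_com (2 ^ d)) h2 h3" "\<forall>t<2 ^ d. arr h3 7 t = X ^ t mod Q" "clk h3 \<le> clk h2 + (2 ^ d * 30 + 10)"
        have ar: "arr h3 0 = mem_of xs" "arr h3 1 = (\<lambda>_. 0)" "arr h3 8 = (\<lambda>_. 0)" "outs h3 = []"
          using h3(1) h2 by (simp_all add: frame_def h0_def)
        have v3: "vars h3 10 = 2 ^ wd - 1" using h3(1) h2'(1) by (simp add: frame_def wd_eq)
        have b3: "base h3"
          unfolding base_def using h3 h2'(1) ar(1) xs(2)
          by (simp add: frame_def Z_def NN_def H_def K_def Q_def r_def A_def mem_of_def)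
        have A2: "A i + A i \<le> 2 * n ^ c" if "i < n" for i using Ac(1)[OF that] by simp
        have t3: "clk h3 \<le> n * 30 + (16 * (3 + k + d * kp + b + zc + kd * (k + 2)) + 200 + 2 ^ d * 30) * L +
            (16 * (3 + k + d * kp + b + zc + kd * (k + 2)) + 200 + 2 ^ d * 30)"
        proof -
          define a where "a = 16 * (3 + k + d * kp + b + zc + kd * (k + 2)) + 200 + 2 ^ d * 30"
          have e: "kd * (u * k + 2) = wd" by (simp add: wd_eq)
          have "clk h3 \<le> n * 30 + (16 * (u + k + d * kp + b + zc + wd) + (150 + 2 ^ d * 30))"
            using h3(3) h2'(1) h1(4) unfolding e by linarith
          moreover have "16 * (u + k + d * kp + b + zc + wd) + (150 + 2 ^ d * 30) \<le> 16 * u + 16 * wd + a"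
            by (simp add: a_def)
          moreover have "16 * u + 16 * wd \<le> (16 + 16 * (kd * (k + 2))) * L"
            using uL(1) wdL by (simp add: algebra_simps)
          moreover have "(16 + 16 * (kd * (k + 2))) * L \<le> a * L" by (intro mult_le_mono1) (simp add: a_def)
          ultimately have "clk h3 \<le> n * 30 + a * L + a" by linarith
          then show ?thesis by (simp only: a_def)
        qed
        have W_eq: "?W = work r b k Pre Qry" by (simp only: r_def b_def k_def)
        show "wp ?W ?Q h3" unfolding W_eq
        proof (rule wp_mono[OF work_spec[OF b3 v3 ar(2-4) NN_def cz[OF zc_le(4)] D A2]], assumption, assumption, assumption, elim conjE exE)
          fix h4 F assume h4: "outs h4 = [of_bool (\<exists>l<n. sol l)]" "Y ^ k * F \<le> D ^ k * n ^ 3"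
            "clk h4 \<le> clk h3 + (k * (Y * (count_time + 50) + 40) + 20) +
      (NN * 18 + n * 110 + 40) + (num_regs (map mute_instr Pre) + 2 + 5 * pn) +
      (n * (2 * num_regs Qry + 20) + (5 * qn + 350) * (3 * n + F) + 20)"
          have m: "n * (2 * num_regs Qry + 20) \<le> n * (num_regs (map mute_instr Pre) + 2 * num_regs Qry + 2 + 20)"
            by (intro mult_le_mono2) simp
          have "clk h4 \<le> ?T F"
            unfolding total_time_def Y_def[symmetric] NN_def[symmetric] H_def[symmetric] K_def[symmetric] r_def[symmetric] b_def[symmetric]
              count_time_def[symmetric]
            using h4(3) t3 m unfolding r_def[symmetric] by linarith
          then show "?Q h4" using h4(1,2) by blast
        qed
      qed
    qed
  qed (use n in \<open>simp_all add: h0_def\<close>)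
  then have wpm: "wp (main d kp B zc kd Pre Qry) ?Q h0" by (simp only: main_def)
  \<comment> \<open>The input fits into array 0, as \<open>n \<le> Z\<close>, and all memory behind
    it is 0; this supplies the cleared arrays 1 and 8 that \<open>build\<close> starts from.\<close>
  have mem0: "\<forall>j. \<forall>i<Z. mem_of xs (j * Z + i) = arr h0 j i"
  proof (intro allI impI)
    fix j i assume "i < Z"
    have "n \<le> Z" using zw(2) by simp
    then have "n \<le> j * Z + i" if "j \<noteq> 0" using that mult_le_mono1[of 1 j Z] by linarith
    then show "mem_of xs (j * Z + i) = arr h0 j i" using xs(2) by (auto simp: h0_def mem_of_def)
  qed
  have v0: "vars h0 = (\<lambda>_. 0)(0 := n)" and o0: "outs h0 = []" and c0: "clk h0 = 0" by (simp_all add: h0_def)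
  show ?thesis
  proof (rule wp_start[OF wpm v0 mem0 o0 c0], goal_cases)
    case (1 t s h')
    then obtain F where F: "Y ^ k * F \<le> D ^ k * n ^ 3" "clk h' \<le> ?T F" by blast
    moreover have "out s = [of_bool (has_3sum (set xs))]" using 1 by (simp add: has sol_def)
    moreover have "t \<le> ?T F" using 1(3) F(2) by (rule order_trans)
    ultimately show ?case using 1(2) unfolding w_def Y_def by blast
  qed
qed

section \<open>Asymptotics\<close>

abbreviation powO :: "real \<Rightarrow> (nat \<Rightarrow> real) set" where
  "powO a \<equiv> O(\<lambda>n. real n powr a)"

lemma powO_mono: "f \<in> powO a \<Longrightarrow> a \<le> b \<Longrightarrow> f \<in> powO b"
proof (erule landau_o.big.trans)
  assume ab: "a \<le> b"
  have "\<forall>\<^sub>F n in sequentially. norm (real n powr a) \<le> 1 * norm (real n powr b)"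
    using eventually_ge_at_top[of 1] by eventually_elim (simp add: ab powr_mono)
  then show "(\<lambda>n. real n powr a) \<in> powO b" by (rule bigoI)
qed

lemma powO_bound:
  assumes "g \<in> powO a" "\<And>n. 1 \<le> n \<Longrightarrow> 0 \<le> f n \<and> f n \<le> g n"
  shows "f \<in> powO a"
proof (rule landau_o.big.trans[OF bigoI assms(1)])
  show "\<forall>\<^sub>F n in sequentially. norm (f n) \<le> 1 * norm (g n)"
    using eventually_ge_at_top[of 1]
  proof eventually_elim
    case (elim n)
    then show ?case using assms(2)[of n] by simp
  qed
qed

lemma powO_add: "f \<in> powO a \<Longrightarrow> g \<in> powO a \<Longrightarrow> (\<lambda>n. f n + g n) \<in> powO a"
  by (rule sum_in_bigo)

lemma powO_mult:
  assumes "f \<in> powO a" "g \<in> powO b" "a + b \<le> s"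
  shows "(\<lambda>n. f n * g n) \<in> powO s"
  by (rule powO_mono[OF _ assms(3)]) (use landau_o.big.mult[OF assms(1,2)] in \<open>simp add: powr_add\<close>)

lemma powO_const: "0 \<le> a \<Longrightarrow> (\<lambda>_. x) \<in> powO a"
proof (rule powO_mono[of _ 0])
  have "\<forall>\<^sub>F n in sequentially. norm x \<le> norm x * norm (real n powr 0)"
    using eventually_ge_at_top[of 1] by eventually_elim simp
  then show "(\<lambda>_. x) \<in> powO 0" by (rule bigoI)
qed

lemma powO_cmult: "f \<in> powO a \<Longrightarrow> (\<lambda>n. x * f n) \<in> powO a" "f \<in> powO a \<Longrightarrow> (\<lambda>n. f n * x) \<in> powO a"
  by (simp_all add: powO_mult[OF powO_const, of 0] powO_mult[OF _ powO_const, of _ _ 0])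

lemma powO_id: "1 \<le> a \<Longrightarrow> real \<in> powO a"
  by (rule powO_mono[of _ 1], rule bigoI[of _ 1]) auto

lemma powO_power: "f \<in> powO a \<Longrightarrow> (\<lambda>n. f n ^ j) \<in> powO (real j * a)"
proof (induction j)
  case 0
  then show ?case using powO_const[of 0 1] by simp
next
  case (Suc j)
  then show ?case using powO_mult[OF Suc.prems Suc.IH[OF Suc.prems]] by (simp add: algebra_simps)
qed

lemma powO_powr:
  assumes f: "f \<in> powO a" "\<And>n. 0 \<le> f n" and b: "0 \<le> b"
  shows "(\<lambda>n. f n powr b) \<in> powO (a * b)"
proof -
  from f(1) obtain c where c: "c > 0" "\<forall>\<^sub>F n in sequentially. norm (f n) \<le> c * norm (real n powr a)"
    by (rule landau_o.bigE)
  have "\<forall>\<^sub>F n in sequentially. norm (f n powr b) \<le> c powr b * norm (real n powr (a * b))"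
    using c(2)
  proof eventually_elim
    case (elim n)
    then have "f n powr b \<le> (c * real n powr a) powr b" using f(2)[of n] b by (intro powr_mono2) auto
    then show ?case using c(1) by (simp add: powr_mult powr_powr)
  qed
  then show ?thesis by (rule bigoI)
qed

lemma powO_nat_ceiling:
  assumes "f \<in> powO a" "0 \<le> a"
  shows "(\<lambda>n. real (nat \<lceil>f n\<rceil>)) \<in> powO a"
proof (rule powO_bound)
  show "(\<lambda>n. \<bar>f n\<bar> + 1) \<in> powO a" using assms by (intro powO_add powO_const) auto
  show "0 \<le> real (nat \<lceil>f n\<rceil>) \<and> real (nat \<lceil>f n\<rceil>) \<le> \<bar>f n\<bar> + 1" for n
    using ceiling_correct[of "f n"] by (cases "0 \<le> \<lceil>f n\<rceil>") auto
qed

text \<open>The small exponent \<open>\<sigma>\<close> covers the logarithmic quantities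
  \<open>K\<close> and \<open>L\<close>. The conditions on \<open>s\<close> correspond to the costs
  of the counts, of preprocessing, of one round of queries per number, and of the false solutions at
  query cost each.\<close>

lemma total_time_bigo:
  fixes Y NN H K L pn qn F :: "nat \<Rightarrow> nat"
  assumes O: "(\<lambda>n. real (Y n)) \<in> powO y" "(\<lambda>n. real (NN n)) \<in> powO b" "(\<lambda>n. real (H n)) \<in> powO h"
      "(\<lambda>n. real (K n)) \<in> powO \<sigma>" "(\<lambda>n. real (L n)) \<in> powO \<sigma>" "(\<lambda>n. real (pn n)) \<in> powO p"
      "(\<lambda>n. real (qn n)) \<in> powO q" "(\<lambda>n. real (F n)) \<in> powO f"
    and nn: "0 \<le> y" "0 \<le> h" "0 \<le> \<sigma>" "0 \<le> q" "0 \<le> f"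
    and le: "y + b \<le> s" "y + 1 \<le> s" "y + h + \<sigma> \<le> s" "p \<le> s" "q + 1 \<le> s" "q + f \<le> s"
  shows "(\<lambda>n. real (total_time n k r (Y n) (NN n) (H n) (K n) (L n) a0 a1 (pn n) (qn n) (F n))) \<in> powO s"
proof -
  have up: "(\<lambda>n. real (NN n)) \<in> powO (s - y)" "real \<in> powO (s - y)" "(\<lambda>n. real (H n)) \<in> powO (s - y)"
      "real \<in> powO s" "(\<lambda>n. real (NN n)) \<in> powO s" "(\<lambda>n. real (L n)) \<in> powO s" "(\<lambda>n. real (pn n)) \<in> powO s"
    using O nn le by (auto elim!: powO_mono intro!: powO_id)
  have HK: "(\<lambda>n. real (H n) * (real (K n) * 50 + 100)) \<in> powO (s - y)"
    using nn le by (intro powO_mult[OF O(3) powO_add[OF powO_cmult(2)[OF O(4)] powO_const]]) auto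
  have KH: "(\<lambda>n. real (K n) * (real (H n) * (real r * 60 + 72) + 40)) \<in> powO (s - y)"
    using nn le by (intro powO_mult[OF O(4) powO_add[OF powO_cmult(2)[OF O(3)] powO_const]]) auto
  have in1: "(\<lambda>n. (real (NN n) * 18 + real n * 33 + 16) + (real (H n) * (real (K n) * 50 + 100) + 8) +
        2 * (real (K n) * (real (H n) * (real r * 60 + 72) + 40) + 12) + (real (H n) * 50 + 10) + 50) \<in> powO (s - y)"
    using nn le by (intro powO_add powO_cmult up HK KH powO_const) auto
  have q5: "(\<lambda>n. 5 * real (qn n) + 350) \<in> powO q"
    using nn by (intro powO_add powO_cmult O powO_const)
  have in2: "(\<lambda>n. (5 * real (qn n) + 350) * real (F n)) \<in> powO s"
    by (rule powO_mult[OF q5 O(8) le(6)])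
  have in3: "(\<lambda>n. (5 * real (qn n) + 350) * (3 * real n)) \<in> powO s"
    by (rule powO_mult[OF q5 powO_cmult(1)[OF powO_id[OF order_refl]] le(5)])
  have s: "0 \<le> s" "y + (s - y) \<le> s" using nn le by auto
  show ?thesis
    unfolding total_time_def of_nat_add of_nat_mult of_nat_numeral distrib_left[of _ "3 * _"]
    by (intro powO_add powO_cmult up in2 in3 powO_const s powO_mult[OF O(1) in1 s(2)])
qed

text \<open>A rational r = m/l between the two bounds is realized exactly as (d - 1) kp / B by d - 1
  = e, kp = m, B = e l. Increasing e moves d kp / B towards r and 1 / B towards 0, which makes both
  the embedding and the number of candidates cheap.\<close>

lemma exponents:
  fixes \<alpha> \<gamma> :: real
  assumes "0 < \<gamma>" "\<gamma> < \<alpha> / 2" "\<alpha> < 1"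
  shows "\<exists>d kp B. 4 \<le> d \<and> 1 \<le> kp \<and> 1 \<le> B \<and> d * kp \<le> 2 * B \<and>
    1 / (1 - \<gamma>) < real ((d - 1) * kp) / real B \<and> real ((d - 1) * kp) / real B < 2 / (2 - \<alpha>) \<and>
    real (d * kp) / real B + 1 / real B < 2 \<and> 1 + 1 / real B < 2"
proof -
  have "1 / (1 - \<gamma>) < 2 / (2 - \<alpha>)" using assms by (simp add: field_simps)
  then obtain r where r: "r \<in> \<rat>" "1 / (1 - \<gamma>) < r" "r < 2 / (2 - \<alpha>)" using Rats_dense_in_real by blast
  have "1 < 1 / (1 - \<gamma>)" "2 / (2 - \<alpha>) < 2" using assms by (simp_all add: field_simps)
  then have r12: "1 < r" "r < 2" using r by linarith+
  obtain m l where ml: "l \<noteq> 0" "r = real m / real l" using Rats_abs_nat_div_natE[OF r(1)] r12 by (metis abs_of_pos less_trans zero_less_one)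
  have m: "1 \<le> m" using ml r12 by (cases m) auto
  \<comment> \<open>The excess r/e + 1/(e l) is at most 3/e, which has to be below 2 - r; the bound
    3 yields \<open>4 \<le> d\<close>.\<close>
  obtain e where e: "max 3 (3 / (2 - r)) < real e" using reals_Archimedean2 by blast
  then have e': "3 < real e" "3 / (2 - r) < real e" by (simp_all only: max_less_iff_conj)
  then have e3: "3 < e" by simp
  have "3 < real e * (2 - r)" using e'(2) r12 by (simp add: pos_divide_less_eq)
  then have er: "3 / real e < 2 - r" using e3 by (simp add: pos_divide_less_eq mult.commute)
  have r1: "real (e * m) / real (e * l) = r" using ml e3 by simp
  have "real (Suc e * m) / real (e * l) = r + r / real e" using ml e3 by (simp add: field_simps)
  moreover have "1 / real (e * l) \<le> 1 / real e" using ml e3 by (intro divide_left_mono) auto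
  moreover have "r / real e \<le> 2 / real e" using r12 by (intro divide_right_mono) auto
  moreover have "2 / real e + 1 / real e = 3 / real e" by (simp add: add_divide_distrib[symmetric])
  ultimately have h: "real (Suc e * m) / real (e * l) + 1 / real (e * l) < 2" using er by linarith
  have "1 / real e < 1" using e3 by simp
  then have b1: "1 + 1 / real (e * l) < 2" using \<open>1 / real (e * l) \<le> 1 / real e\<close> by linarith
  have "0 \<le> 1 / real (e * l)" by simp
  then have "real (Suc e * m) / real (e * l) < 2" using h by linarith
  then have "real (Suc e * m) < 2 * real (e * l)" using ml e3 by (simp add: pos_divide_less_eq)
  then have "real (Suc e * m) < real (2 * (e * l))" by simp
  then have "Suc e * m \<le> 2 * (e * l)" by (simp only: of_nat_less_iff)
  then show ?thesis
    using r e3 ml(1) m r1 h b1 by (intro exI[of _ "Suc e"] exI[of _ m] exI[of _ "e * l"]) simp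
qed

lemma floorlog_powO: "0 < \<sigma> \<Longrightarrow> (\<lambda>n. real (floorlog 2 n)) \<in> powO \<sigma>"
proof (rule powO_bound)
  assume \<sigma>: "0 < \<sigma>"
  then show "(\<lambda>n. (1 / \<sigma> / ln 2) * real n powr \<sigma> + 1) \<in> powO \<sigma>"
    by (intro powO_add powO_cmult powO_const) auto
  show "0 \<le> real (floorlog 2 n) \<and> real (floorlog 2 n) \<le> (1 / \<sigma> / ln 2) * real n powr \<sigma> + 1" if "1 \<le> n" for n
  proof -
    have "real (floorlog 2 n) \<le> log 2 (real n) + 1"
      using that floor_correct[of "log 2 (real n)"] zero_le_log_cancel_iff[of 2 n] by (simp add: floorlog_def)
    moreover have "log 2 (real n) \<le> real n powr \<sigma> / \<sigma> / ln 2"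
      unfolding log_def using ln_powr_bound[of "real n" \<sigma>] that \<sigma> by (intro divide_right_mono) auto
    ultimately show ?thesis by simp
  qed
qed

text \<open>\<open>Y\<close>, a power of two, agrees with the \<open>B\<close>-th root of
  \<open>n\<close> up to a constant factor: rounding the binary length down to a multiple of
  \<open>B\<close> gives Y^B \<le> 2n and n \<le> (2Y)^B.\<close>

lemma root_bounds:
  assumes "1 \<le> B" "1 \<le> n"
  shows "real (2 ^ (floorlog 2 n div B)) \<le> 2 powr (1 / real B) * real n powr (1 / real B)"
    and "real n powr (1 / real B) \<le> 2 * real (2 ^ (floorlog 2 n div B))"
proof -
  define L where "L = floorlog 2 n"
  define Y where "Y = (2::nat) ^ (L div B)"
  have nb: "2 ^ (L - 1) \<le> n" "n < 2 ^ L" using floorlog_bounds[of n 2] assms(2) by (auto simp: L_def)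
  have L1: "1 \<le> L" using nb(2) assms(2) by (cases L) auto
  have B: "0 < real B" using assms(1) by simp
  have pB: "real (y ^ B) powr (1 / real B) = real y" if "0 < y" for y :: nat
    using that B by (simp add: powr_realpow[symmetric] powr_powr)
  have "Y ^ B = 2 ^ (L div B * B)" by (simp add: Y_def power_mult)
  also have "\<dots> \<le> 2 ^ L" by (intro power_increasing) auto
  also have "\<dots> = 2 * 2 ^ (L - 1)" using L1 by (cases L) auto
  finally have "Y ^ B \<le> 2 * n" using nb(1) by linarith
  then have "real (Y ^ B) powr (1 / real B) \<le> real (2 * n) powr (1 / real B)" by (intro powr_mono2) (auto simp del: of_nat_mult of_nat_power)
  then show "real (2 ^ (floorlog 2 n div B)) \<le> 2 powr (1 / real B) * real n powr (1 / real B)"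
    using pB[of Y] by (simp add: Y_def[symmetric] L_def[symmetric] powr_mult) (simp add: Y_def)
  have "L \<le> L div B * B + B" using div_mult_mod_eq[of L B] mod_less_divisor[of B L] assms(1) by linarith
  then have "(2::nat) ^ L \<le> 2 ^ (L div B * B + B)" by (intro power_increasing) auto
  also have "\<dots> = (2 * Y) ^ B" by (simp add: Y_def power_add power_mult power_mult_distrib)
  finally have "n \<le> (2 * Y) ^ B" using nb(2) by linarith
  then have "real n powr (1 / real B) \<le> real ((2 * Y) ^ B) powr (1 / real B)" by (intro powr_mono2) (auto simp del: of_nat_mult of_nat_power)
  also have "\<dots> = real (2 * Y)" by (rule pB) (simp add: Y_def)
  finally show "real n powr (1 / real B) \<le> 2 * real (2 ^ (floorlog 2 n div B))" by (simp add: Y_def L_def)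
qed

text \<open>Refuting the hypothesis takes one \<epsilon> for all universes n^c. Hence \<epsilon>
  comes from the exponents alone, before \<open>c\<close> is known; only the exponent of the divisor
  bound and the word length are adapted to \<open>c\<close>.\<close>

lemma subquadratic_3sum:
  assumes ds: "convolution_witness_ds kd Pre Qry p q"
    and p: "p \<in> powO (2 - \<alpha>)" and q: "q \<in> powO \<gamma>"
    and \<gamma>: "0 < \<gamma>" "\<gamma> < \<alpha> / 2" "\<alpha> < 1"
  shows "\<exists>\<epsilon>>0. \<forall>c. \<exists>\<kappa> P T. solves_3sum c \<kappa> P T \<and> T \<in> powO (2 - \<epsilon>)"
proof -
  from exponents[OF \<gamma>] obtain d kp B where par: "4 \<le> d" "1 \<le> kp" "1 \<le> B" "d * kp \<le> 2 * B"
    and \<beta>': "1 / (1 - \<gamma>) < real ((d - 1) * kp) / real B" "real ((d - 1) * kp) / real B < 2 / (2 - \<alpha>)"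
    and hB: "real (d * kp) / real B + 1 / real B < 2" and B1: "1 + 1 / real B < 2"
    by blast
  define k where "k = (d - 1) * kp"
  define \<beta> where "\<beta> = real k / real B"
  define h where "h = real (d * kp) / real B"
  define y where "y = 1 / real B"
  have y: "0 < y" using par by (simp add: y_def)
  note \<beta>' = \<beta>'[folded k_def, folded \<beta>_def]
  have \<beta>: "1 < \<beta> * (1 - \<gamma>)" "\<beta> * (2 - \<alpha>) < 2" "1 < \<beta>"
  proof -
    show 1: "1 < \<beta> * (1 - \<gamma>)" using \<beta>'(1) \<gamma> by (simp add: pos_divide_less_eq)
    show "\<beta> * (2 - \<alpha>) < 2" using \<beta>'(2) \<gamma> by (simp add: pos_less_divide_eq)
    have "1 < 1 / (1 - \<gamma>)" using \<gamma> by simp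
    then show "1 < \<beta>" using \<beta>'(1) by linarith
  qed
  have \<beta>h: "\<beta> \<le> h" unfolding \<beta>_def h_def k_def by (intro divide_right_mono of_nat_mono mult_le_mono1) auto
  have \<beta>\<gamma>: "1 + \<beta> * \<gamma> < 2"
  proof -
    have "\<beta> * (2 * \<gamma>) \<le> \<beta> * (2 - \<alpha>)" using \<beta>(3) \<gamma> by (intro mult_left_mono) auto
    then show ?thesis using \<beta>(2) by simp
  qed
  have \<beta>\<gamma>0: "0 \<le> \<beta> * \<gamma>" using \<beta> \<gamma> by simp
  \<comment> \<open>The slack below 2 of the five dominant exponents: transforms, bucket counts for
    all candidates, preprocessing, queries without false solutions, and false solutions. Half of it
    is spent on divisors and logarithms; the other half is the saving.\<close>
  define \<delta> where "\<delta> = 2 - max (h + y) (max (1 + y) (max (\<beta> * (2 - \<alpha>)) (max (1 + \<beta> * \<gamma>) (3 - \<beta> * (1 - \<gamma>)))))"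
  define \<epsilon> where "\<epsilon> = \<delta> / 2"
  have \<delta>: "0 < \<delta>" using hB B1 \<beta> \<beta>\<gamma> by (simp add: \<delta>_def h_def y_def)
  have \<delta>le: "h + y \<le> 2 - \<delta>" "1 + y \<le> 2 - \<delta>" "\<beta> * (2 - \<alpha>) \<le> 2 - \<delta>" "1 + \<beta> * \<gamma> \<le> 2 - \<delta>" "3 - \<beta> * (1 - \<gamma>) \<le> 2 - \<delta>"
    by (simp_all add: \<delta>_def)
  have \<delta>\<epsilon>: "\<delta> = 2 * \<epsilon>" by (simp add: \<epsilon>_def)
  have \<epsilon>: "0 < \<epsilon>" using \<delta> by (simp add: \<epsilon>_def)
  have \<epsilon>le: "h + y + 2 * \<epsilon> \<le> 2" "1 + y + 2 * \<epsilon> \<le> 2" "\<beta> * (2 - \<alpha>) + 2 * \<epsilon> \<le> 2" "1 + \<beta> * \<gamma> + 2 * \<epsilon> \<le> 2" "3 - \<beta> + \<beta> * \<gamma> + 2 * \<epsilon> \<le> 2"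
    using \<delta>le unfolding \<delta>\<epsilon> by (simp_all add: right_diff_distrib)
  show ?thesis
  proof (intro exI[of _ \<epsilon>] conjI \<epsilon> allI)
    fix c :: nat
    \<comment> \<open>Numbers up to 2 n^c are subject to the divisor bound in each of
      \<open>k\<close> stages, so the total loss is about n^(k c \<eta>), at most n^\<epsilon>. The
      1 avoids a zero denominator for c = 0.\<close>
    define \<eta> where "\<eta> = \<epsilon> / real (k * c + 1)"
    have \<eta>: "0 < \<eta>" unfolding \<eta>_def using \<epsilon> by (rule divide_pos_pos) (simp only: of_nat_0_less_iff)
    from divisor_bound[OF \<eta>] obtain C where C: "1 \<le> C" "\<And>s. 1 \<le> s \<Longrightarrow> real (card {d. d dvd s}) \<le> C * real s powr \<eta>" by blast
    define zc where "zc = d * kp + k + 3 * d + c + kd * (k + 2) + 2 * 2 ^ (d - 1) + B + kd + kp + 20"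
    define L where "L = (\<lambda>n. floorlog 2 n)"
    define u where "u = (\<lambda>n. L n div B)"
    define Y where "Y = (\<lambda>n. (2::nat) ^ u n)"
    define N' where "N' = (\<lambda>n. 2 * Y n ^ k)"
    define D where "D = (\<lambda>n::nat. nat \<lfloor>C * real (2 * n ^ c) powr \<eta>\<rfloor>)"
    \<comment> \<open>The largest value compatible with the inequality that \<open>run_main\<close>
      guarantees.\<close>
    define F where "F = (\<lambda>n. D n ^ k * n ^ 3 div Y n ^ k)"
    define pn where "pn = (\<lambda>n. nat \<lceil>p (N' n)\<rceil>)"
    define qn where "qn = (\<lambda>n. nat \<lceil>q (N' n)\<rceil>)"
    define T where "T = (\<lambda>n. total_time n k (2 ^ d) (Y n) (Y n ^ k) (Y n ^ (d * kp)) (u n * kp) (L n)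
      (16 * (3 + k + d * kp + 2 ^ (d - 1) + zc + kd * (k + 2)) + 200 + 2 ^ d * 30)
      (num_regs (map mute_instr Pre) + 2 * num_regs Qry + 2) (pn n) (qn n) (F n))"
    have Ypos: "0 < Y n" for n by (simp add: Y_def)
    have N'pos: "1 \<le> N' n" for n using Ypos[of n] by (simp add: N'_def)
    have kd: "2 \<le> kd" using ds by (simp add: convolution_witness_ds_def)
    have solves: "solves_3sum c (zc + 6) (compile (main d kp B zc kd Pre Qry)) (\<lambda>n. real (T n))"
      unfolding solves_3sum_def
    proof (intro conjI allI impI, goal_cases)
      case (3 n xs)
      then have n: "1 \<le> n" and xs: "distinct xs" "length xs = n" "set xs \<subseteq> {1..n ^ c}" by auto
      have "\<exists>t s F'. halts_within (word_size (zc + 6) n) (compile (main d kp B zc kd Pre Qry)) (start n (mem_of xs)) t s \<and>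
        out s = [of_bool (has_3sum (set xs))] \<and> Y n ^ k * F' \<le> D n ^ k * n ^ 3 \<and>
        t \<le> total_time n k (2 ^ d) (Y n) (Y n ^ k) (Y n ^ (d * kp)) (u n * kp) (L n)
          (16 * (3 + k + d * kp + 2 ^ (d - 1) + zc + kd * (k + 2)) + 200 + 2 ^ d * 30)
          (num_regs (map mute_instr Pre) + 2 * num_regs Qry + 2) (pn n) (qn n) F'"
        unfolding Y_def u_def L_def k_def zc_def
      proof (rule run_main[OF par kd n xs])
        have N'_eq: "2 * (2 ^ (floorlog 2 n div B)) ^ ((d - 1) * kp) = N' n" by (simp only: N'_def Y_def u_def L_def k_def)
        {
          fix V assume "bit_vector (2 * (2 ^ (floorlog 2 n div B)) ^ ((d - 1) * kp)) V"
          then obtain t s where "halts_within (word_size kd (N' n)) Pre (start (N' n) (mem_of (V @ V))) t s" "real t \<le> p (N' n)"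
            using ds N'pos[of n] unfolding convolution_witness_ds_def N'_eq by blast
          moreover from this(2) have "t \<le> pn n" unfolding pn_def by linarith
          ultimately show "\<exists>t s. halts_within (word_size kd (2 * (2 ^ (floorlog 2 n div B)) ^ ((d - 1) * kp))) Pre
              (start (2 * (2 ^ (floorlog 2 n div B)) ^ ((d - 1) * kp)) (mem_of (V @ V))) t s \<and> t \<le> pn n"
            unfolding N'_eq by blast
        next
          fix V M and j :: nat
          assume "bit_vector (2 * (2 ^ (floorlog 2 n div B)) ^ ((d - 1) * kp)) V"
            "ds_memory (word_size kd (2 * (2 ^ (floorlog 2 n div B)) ^ ((d - 1) * kp))) Pre Qry
              (2 * (2 ^ (floorlog 2 n div B)) ^ ((d - 1) * kp)) V V M"
            "j \<in> {1..2 * (2 * (2 ^ (floorlog 2 n div B)) ^ ((d - 1) * kp))}"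
          then obtain t s ws where *: "halts_within (word_size kd (N' n)) Qry (start j M) t s" "distinct ws"
            "set ws = witnesses (N' n) V V j" "out s = concat (map (\<lambda>(i, j). [i, j]) ws)"
            "real t \<le> q (N' n) * (1 + real (card (witnesses (N' n) V V j)))"
            using ds N'pos[of n] unfolding convolution_witness_ds_def N'_eq by blast
          have "q (N' n) * (1 + real (card (witnesses (N' n) V V j))) \<le> real (qn n) * (1 + real (card (witnesses (N' n) V V j)))"
            unfolding qn_def by (intro mult_right_mono real_nat_ceiling_ge) auto
          from order_trans[OF *(5) this] have "real t \<le> real (qn n * (1 + card (witnesses (N' n) V V j)))"
            by (simp only: of_nat_mult of_nat_add of_nat_1)
          then have "t \<le> qn n * (1 + card (witnesses (N' n) V V j))" by (simp only: of_nat_le_iff)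
          with *(1-4) show "\<exists>t s ws. halts_within (word_size kd (2 * (2 ^ (floorlog 2 n div B)) ^ ((d - 1) * kp))) Qry (start j M) t s \<and>
              distinct ws \<and> set ws = witnesses (2 * (2 ^ (floorlog 2 n div B)) ^ ((d - 1) * kp)) V V j \<and>
              out s = concat (map (\<lambda>(i, j). [i, j]) ws) \<and>
              t \<le> qn n * (1 + card (witnesses (2 * (2 ^ (floorlog 2 n div B)) ^ ((d - 1) * kp)) V V j))"
            unfolding N'_eq by blast
        next
          fix s :: nat assume s: "1 \<le> s" "s \<le> 2 * n ^ c"
          have "real s \<le> real (2 * n ^ c)" using s(2) by (simp only: of_nat_le_iff)
          then have "C * real s powr \<eta> \<le> C * real (2 * n ^ c) powr \<eta>" using C(1) \<eta> by (intro mult_left_mono powr_mono2) auto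
          with C(2)[OF s(1)] have "real (card {d. d dvd s}) \<le> C * real (2 * n ^ c) powr \<eta>" by linarith
          then show "card {d. d dvd s} \<le> D n" unfolding D_def by (rule le_nat_floor)
        }
      qed
      then obtain t s F' where *: "halts_within (word_size (zc + 6) n) (compile (main d kp B zc kd Pre Qry)) (start n (mem_of xs)) t s"
        "out s = [of_bool (has_3sum (set xs))]" "Y n ^ k * F' \<le> D n ^ k * n ^ 3"
        "t \<le> total_time n k (2 ^ d) (Y n) (Y n ^ k) (Y n ^ (d * kp)) (u n * kp) (L n)
          (16 * (3 + k + d * kp + 2 ^ (d - 1) + zc + kd * (k + 2)) + 200 + 2 ^ d * 30)
          (num_regs (map mute_instr Pre) + 2 * num_regs Qry + 2) (pn n) (qn n) F'"
        by blast
      have "F' \<le> F n" using *(3) Ypos[of n] by (simp add: F_def less_eq_div_iff_mult_less_eq mult.commute)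
      then have "t \<le> T n" unfolding T_def by (intro order_trans[OF *(4)]) (auto simp: total_time_def intro!: add_mono mult_le_mono)
      then have "real t \<le> real (T n)" by (rule of_nat_mono)
      then show ?case using *(1,2) by blast
    qed (simp_all add: zc_def)
    have Y_O: "(\<lambda>n. real (Y n)) \<in> powO y"
      by (rule powO_bound[OF powO_cmult(1)[of "\<lambda>n. real n powr y" y "2 powr y"]])
        (use root_bounds(1)[OF par(3)] in \<open>auto simp: Y_def u_def L_def y_def\<close>)
    have Yinv: "inverse (real (Y n ^ k)) \<le> 2 ^ k * real n powr (- \<beta>)" if "1 \<le> n" for n
    proof -
      have "(real n powr y) ^ k \<le> (2 * real (Y n)) ^ k"
        using root_bounds(2)[OF par(3) that] by (intro power_mono) (auto simp: Y_def u_def L_def y_def)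
      moreover have "(real n powr y) ^ k = real n powr \<beta>"
        using that by (simp add: powr_realpow[symmetric] powr_powr y_def \<beta>_def)
      ultimately have "real n powr \<beta> \<le> 2 ^ k * real (Y n ^ k)" by (simp add: power_mult_distrib)
      then show ?thesis using that Ypos[of n] by (simp add: powr_minus field_simps)
    qed
    have NN_O: "(\<lambda>n. real (Y n ^ k)) \<in> powO \<beta>" using powO_power[OF Y_O, of k] by (simp add: y_def \<beta>_def)
    have H_O: "(\<lambda>n. real (Y n ^ (d * kp))) \<in> powO h" using powO_power[OF Y_O, of "d * kp"] by (simp add: y_def h_def)
    have L_O: "(\<lambda>n. real (L n)) \<in> powO \<epsilon>" unfolding L_def by (rule floorlog_powO[OF \<epsilon>])
    have K_O: "(\<lambda>n. real (u n * kp)) \<in> powO \<epsilon>"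
      by (rule powO_bound[OF powO_cmult(2)[OF L_O, of "real kp"]]) (auto simp: u_def intro!: mult_right_mono)
    have N'_O: "(\<lambda>n. real (N' n)) \<in> powO \<beta>" unfolding N'_def using powO_cmult(1)[OF NN_O, of 2] by simp
    \<comment> \<open>The bounds on \<open>p\<close> and \<open>q\<close> hold only for large
      arguments, so composing them with \<open>N'\<close> requires that \<open>N'\<close> tends to
      infinity.\<close>
    have "filterlim (\<lambda>n. real (N' n)) at_top sequentially"
    proof (rule filterlim_at_top_mono)
      show "filterlim (\<lambda>n. inverse (2 ^ k) * real n) at_top sequentially"
        by (rule filterlim_tendsto_pos_mult_at_top[OF tendsto_const _ filterlim_real_sequentially]) simp
      show "\<forall>\<^sub>F n in sequentially. inverse (2 ^ k) * real n \<le> real (N' n)"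
        using eventually_ge_at_top[of 1]
      proof eventually_elim
        case (elim n)
        have "real n \<le> real n powr \<beta>" using powr_mono[of 1 \<beta> "real n"] \<beta>(3) elim by simp
        also have "\<dots> \<le> 2 ^ k * real (Y n ^ k)"
          using Yinv[OF elim] elim Ypos[of n] by (simp add: powr_minus field_simps)
        finally have "inverse (2 ^ k) * real n \<le> real (Y n ^ k)" by (simp add: field_simps)
        also have "\<dots> \<le> real (N' n)" by (simp add: N'_def)
        finally show ?case .
      qed
    qed
    then have lim: "filterlim N' at_top sequentially" by (simp only: filterlim_sequentially_iff_filterlim_real)
    have p_O: "(\<lambda>n. real (pn n)) \<in> powO (\<beta> * (2 - \<alpha>))" unfolding pn_def
      using \<beta>(3) \<gamma> by (intro powO_nat_ceiling landau_o.big.trans[OF landau_o.big.compose[OF p lim] powO_powr[OF N'_O]]) auto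
    have q_O: "(\<lambda>n. real (qn n)) \<in> powO (\<beta> * \<gamma>)" unfolding qn_def
      using \<beta>\<gamma>0 \<gamma> by (intro powO_nat_ceiling landau_o.big.trans[OF landau_o.big.compose[OF q lim] powO_powr[OF N'_O]]) auto
    have D_O: "(\<lambda>n. real (D n)) \<in> powO (real c * \<eta>)"
    proof (rule powO_bound)
      show "(\<lambda>n. (C * 2 powr \<eta>) * real n powr (real c * \<eta>)) \<in> powO (real c * \<eta>)" by (intro powO_cmult) simp
      show "0 \<le> real (D n) \<and> real (D n) \<le> (C * 2 powr \<eta>) * real n powr (real c * \<eta>)" if "1 \<le> n" for n
      proof -
        have "real (D n) \<le> C * real (2 * n ^ c) powr \<eta>" unfolding D_def using C(1) by (intro of_nat_floor) auto
        also have "\<dots> = (C * 2 powr \<eta>) * real n powr (real c * \<eta>)"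
          using that by (simp add: powr_mult powr_realpow[symmetric] powr_powr)
        finally show ?thesis by simp
      qed
    qed
    have F_O: "(\<lambda>n. real (F n)) \<in> powO (\<epsilon> + 3 - \<beta>)"
    proof (rule powO_bound)
      have e: "real k * (real c * \<eta>) + 3 \<le> \<epsilon> + 3"
      proof -
        have fr: "real (k * c) / real (k * c + 1) \<le> 1" by (subst divide_le_eq_1_pos) (simp_all only: of_nat_le_iff of_nat_0_less_iff)
        have "real k * (real c * \<eta>) = \<epsilon> * (real (k * c) / real (k * c + 1))" by (simp add: \<eta>_def)
        also have "\<dots> \<le> \<epsilon> * 1"
          using \<epsilon> fr by (intro mult_left_mono) (simp_all only: less_imp_le)
        finally show ?thesis by simp
      qed
      have n3: "(\<lambda>n. real n ^ 3) \<in> powO 3" using powO_power[OF powO_id[OF order_refl], of 3] by simp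
      have i: "(\<lambda>n. 2 ^ k * real n powr (- \<beta>)) \<in> powO (- \<beta>)" by (intro powO_cmult) simp
      show "(\<lambda>n. (real (D n) ^ k * real n ^ 3) * (2 ^ k * real n powr (- \<beta>))) \<in> powO (\<epsilon> + 3 - \<beta>)"
        by (rule powO_mult[OF powO_mult[OF powO_power[OF D_O] n3 e] i]) simp
      show "0 \<le> real (F n) \<and> real (F n) \<le> (real (D n) ^ k * real n ^ 3) * (2 ^ k * real n powr (- \<beta>))" if "1 \<le> n" for n
      proof -
        have "real (F n) \<le> real (D n ^ k * n ^ 3) / real (Y n ^ k)" unfolding F_def by (rule of_nat_div_le_of_nat)
        also have "\<dots> = (real (D n) ^ k * real n ^ 3) * inverse (real (Y n ^ k))" by (simp add: divide_inverse)
        also have "\<dots> \<le> (real (D n) ^ k * real n ^ 3) * (2 ^ k * real n powr (- \<beta>))"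
          by (intro mult_left_mono Yinv[OF that]) auto
        finally show ?thesis by simp
      qed
    qed
    have "(\<lambda>n. real (T n)) \<in> powO (2 - \<epsilon>)"
      unfolding T_def using \<beta>h \<beta> \<beta>\<gamma>0 y \<epsilon> \<epsilon>le
      by (intro total_time_bigo[OF Y_O NN_O H_O K_O L_O p_O q_O F_O]) linarith+
    then show "\<exists>\<kappa> P T. solves_3sum c \<kappa> P T \<and> T \<in> powO (2 - \<epsilon>)" using solves by blast
  qed
qed

theorem theoremC2:
  fixes \<alpha> :: real
  assumes "0 < \<alpha>" "\<alpha> < 1"
    and "deterministic_3sum_hypothesis"
  shows "\<forall>\<epsilon>::real. \<epsilon> > 0 \<longrightarrow>
    \<not> (\<exists>\<kappa> Pre Qry p q. convolution_witness_ds \<kappa> Pre Qry p q \<and>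
        p \<in> O(\<lambda>n. real n powr (2 - \<alpha>)) \<and>
        q \<in> O(\<lambda>n. real n powr (\<alpha> / 2 - \<epsilon>)))"
proof (intro allI impI notI, elim exE conjE)
  fix \<epsilon> :: real and \<kappa> Pre Qry p q
  assume "\<epsilon> > 0" and ds: "convolution_witness_ds \<kappa> Pre Qry p q"
    and p: "p \<in> O(\<lambda>n. real n powr (2 - \<alpha>))" and q: "q \<in> O(\<lambda>n. real n powr (\<alpha> / 2 - \<epsilon>))"
  \<comment> \<open>For large \<epsilon> the exponent \<alpha>/2 - \<epsilon> would be negative; the
    minimum keeps \<gamma> positive and only weakens the bound on \<open>q\<close>.\<close>
  define \<gamma> where "\<gamma> = \<alpha> / 2 - min \<epsilon> (\<alpha> / 4)"
  have \<gamma>: "0 < \<gamma>" "\<gamma> < \<alpha> / 2" using assms(1) \<open>\<epsilon> > 0\<close> by (auto simp: \<gamma>_def min_def)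
  have "q \<in> powO \<gamma>" by (rule powO_mono[OF q]) (simp add: \<gamma>_def)
  from subquadratic_3sum[OF ds p this \<gamma> assms(2)] assms(3) show False
    unfolding deterministic_3sum_hypothesis_def by blast
qed

end
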